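(* Let $\{\varepsilon_n : n\ge 1\}$ be i.i.d. random variables with values in $(0,4)$, let $S=(0,1)$, and consider the Markov process on $S$ defined by $X_{n+1}=\varepsilon_{n+1}X_n(1-X_n)$, $n\ge 0$, with $X_0$ an $S$-valued random variable independent of $\{\varepsilon_n : n\ge1\}$. Let $p^{(n)}(x,dy)$ denote its $n$-step transition probability. Assume that the distribution of $\varepsilon_1$ has a nonzero absolutely continuous component (with respect to Lebesgue measure on $(0,4)$) whose density is bounded away from zero on some nondegenerate interval contained in $(1,4)$. If, in addition, the family of probability measures $\left\{\frac1N\sum_{n=1}^N p^{(n)}(x,dy) : N\ge 1\right\}$ is tight on $S=(0,1)$ for some $x\in S$, then: (i) $\{X_n : n\ge 0\}$ is Harris recurrent and has a unique invariant probability $\pi$ on $S$; (ii) for every $x\in S$, $\frac1N\sum_{n=1}^N p^{(n)}(x,dy)$ converges to $\pi$ in total variation distance as $N\to\infty$.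
   Context: The one-step transition probability on $S=(0,1)$ with its Borel $\sigma$-field is $p(x,B)=P(\varepsilon_1x(1-x)\in B)$. Tightness: a sequence $\mu_n$, $n\ge1$, of probability measures on $S=(0,1)$ is tight if for every $\eta>0$ there is a compact $K_\eta\subset S$ (compact subset of the open interval $(0,1)$) with $\mu_n(K_\eta)\ge 1-\eta$ for all $n\ge 1$. Harris recurrence (the definition used here): put $U(x,B):=\sum_{n=1}^\infty p^{(n)}(x,B)$. The process is $\varphi$-irreducible, for a nonzero $\sigma$-finite measure $\varphi$ on $S$, if $U(x,B)>0$ for all $x\in S$ whenever $\varphi(B)>0$. A $\varphi$-irreducible process is Harris recurrent (or $\varphi$-recurrent) if $U(x,B)=\infty$ for all $x\in S$ whenever $\varphi(B)>0$. "Harris recurrent" without reference to $\varphi$ means that this holds for some nonzero $\sigma$-finite $\varphi$. An invariant probability is a probability measure $\pi$ on $S$ with $\pi(B)=\int_S p(x,B)\,\pi(dx)$ for all Borel $B\subset S$. Convergence in total variation distance of $\mu_N$ to $\pi$ means $\sup_{B}|\mu_N(B)-\pi(B)|\to0$, the supremum being over Borel $B\subset S$. *)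

theory Defs
  imports "HOL-Probability.Probability"
begin

section \<open>Markov kernels on a measurable space S\<close>

text \<open>A transition probability on \<open>S\<close> is a function \<open>P\<close> in
  \<open>measurable S (prob_algebra S)\<close>; \<open>emeasure (P x) B\<close> is \<open>p(x,B)\<close>.\<close>

primrec nstep :: "'a measure \<Rightarrow> ('a \<Rightarrow> 'a measure) \<Rightarrow> nat \<Rightarrow> 'a \<Rightarrow> 'a measure" where
  "nstep S P 0 x = return S x"
| "nstep S P (Suc n) x = nstep S P n x \<bind> P"

definition potential :: "'a measure \<Rightarrow> ('a \<Rightarrow> 'a measure) \<Rightarrow> 'a \<Rightarrow> 'a set \<Rightarrow> ennreal" where
  "potential S P x B = (\<Sum>n. emeasure (nstep S P (Suc n) x) B)"

definition irreducible_wrt :: "'a measure \<Rightarrow> ('a \<Rightarrow> 'a measure) \<Rightarrow> 'a measure \<Rightarrow> bool" where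
  "irreducible_wrt S P \<phi> \<longleftrightarrow>
     sigma_finite_measure \<phi> \<and> sets \<phi> = sets S \<and> emeasure \<phi> (space S) \<noteq> 0 \<and>
     (\<forall>B\<in>sets S. emeasure \<phi> B > 0 \<longrightarrow> (\<forall>x\<in>space S. potential S P x B > 0))"

definition Harris_recurrent_wrt :: "'a measure \<Rightarrow> ('a \<Rightarrow> 'a measure) \<Rightarrow> 'a measure \<Rightarrow> bool" where
  "Harris_recurrent_wrt S P \<phi> \<longleftrightarrow>
     irreducible_wrt S P \<phi> \<and>
     (\<forall>B\<in>sets S. emeasure \<phi> B > 0 \<longrightarrow> (\<forall>x\<in>space S. potential S P x B = \<infinity>))"

definition Harris_recurrent :: "'a measure \<Rightarrow> ('a \<Rightarrow> 'a measure) \<Rightarrow> bool" where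
  "Harris_recurrent S P \<longleftrightarrow> (\<exists>\<phi>. Harris_recurrent_wrt S P \<phi>)"

definition invariant_prob :: "'a measure \<Rightarrow> ('a \<Rightarrow> 'a measure) \<Rightarrow> 'a measure \<Rightarrow> bool" where
  "invariant_prob S P \<pi> \<longleftrightarrow>
     prob_space \<pi> \<and> sets \<pi> = sets S \<and>
     (\<forall>B\<in>sets S. emeasure \<pi> B = (\<integral>\<^sup>+x. emeasure (P x) B \<partial>\<pi>))"

text \<open>Only meaningful for \<open>N \<ge> 1\<close>; see \<open>emeasure_cesaro\<close> below for the values.\<close>

definition cesaro :: "'a measure \<Rightarrow> ('a \<Rightarrow> 'a measure) \<Rightarrow> 'a \<Rightarrow> nat \<Rightarrow> 'a measure" where
  "cesaro S P x N =
     measure_of (space S) (sets S) (\<lambda>B. (\<Sum>n = 1..N. emeasure (nstep S P n x) B) / of_nat N)"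

definition tv_dist :: "'a measure \<Rightarrow> 'a measure \<Rightarrow> 'a measure \<Rightarrow> real" where
  "tv_dist S \<mu> \<nu> = (SUP B\<in>sets S. \<bar>measure \<mu> B - measure \<nu> B\<bar>)"

text \<open>Tightness on a subset \<open>T\<close> (here the open interval (0,1)): the compact sets must lie in \<open>T\<close>.
  The library's \<open>tight\<close> is about measures on the whole real line.\<close>

definition tight_on :: "'a::topological_space set \<Rightarrow> (nat \<Rightarrow> 'a measure) \<Rightarrow> bool" where
  "tight_on T \<mu> \<longleftrightarrow>
     (\<forall>\<eta>>0. \<exists>K. compact K \<and> K \<subseteq> T \<and> (\<forall>n\<ge>1. measure (\<mu> n) K \<ge> 1 - \<eta>))"

text \<open>\<open>\<nu> = density \<mu> h + \<sigma>\<close> with \<open>\<sigma>\<close> singular to \<open>\<mu>\<close>, so \<open>density \<mu> h\<close> is the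
  absolutely continuous component of \<open>\<nu>\<close>.\<close>

definition lebesgue_decomposition ::
    "'a measure \<Rightarrow> 'a measure \<Rightarrow> ('a \<Rightarrow> ennreal) \<Rightarrow> 'a measure \<Rightarrow> bool" where
  "lebesgue_decomposition \<mu> \<nu> h \<sigma> \<longleftrightarrow>
     h \<in> borel_measurable \<mu> \<and> sets \<sigma> = sets \<mu> \<and>
     (\<exists>Z\<in>null_sets \<mu>. emeasure \<sigma> (space \<mu> - Z) = 0) \<and>
     (\<forall>B\<in>sets \<mu>. emeasure \<nu> B = emeasure (density \<mu> h) B + emeasure \<sigma> B)"

section \<open>The random logistic map\<close>

abbreviation state_space :: "real measure" where
  "state_space \<equiv> restrict_space borel {0<..<1}"

abbreviation param_space :: "real measure" where
  "param_space \<equiv> restrict_space borel {0<..<4}"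

definition logistic_kernel :: "'w measure \<Rightarrow> (nat \<Rightarrow> 'w \<Rightarrow> real) \<Rightarrow> real \<Rightarrow> real measure" where
  "logistic_kernel M \<epsilon> x = distr M state_space (\<lambda>\<omega>. \<epsilon> 1 \<omega> * x * (1 - x))"

section \<open>The definitions compute what they should\<close>

lemma logistic_map_unit:
  fixes e x :: real
  assumes "0 < e" "e < 4" "0 < x" "x < 1"
  shows "0 < e * x * (1 - x)" "e * x * (1 - x) < 1"
proof -
  show "0 < e * x * (1 - x)" using assms by simp
  have "x * (1 - x) \<le> 1 / 4"
    using zero_le_power2[of "x - 1/2"] by (simp add: power2_eq_square algebra_simps)
  moreover have "0 < x * (1 - x)" using assms by simp
  ultimately have "e * (x * (1 - x)) < 4 * (1 / 4)"
    using assms by (intro mult_less_le_imp_less) auto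
  then show "e * x * (1 - x) < 1" by (simp add: mult.assoc)
qed

lemma logistic_kernel_measurable:
  assumes "prob_space M" and e[measurable]: "\<epsilon> 1 \<in> measurable M param_space"
  shows "logistic_kernel M \<epsilon> \<in> measurable state_space (prob_algebra state_space)"
proof -
  interpret prob_space M by fact
  have e': "\<epsilon> 1 \<in> borel_measurable M"
    and er: "\<And>\<omega>. \<omega> \<in> space M \<Longrightarrow> \<epsilon> 1 \<omega> \<in> {0<..<4}"
    using e by (auto simp: measurable_restrict_space2_iff space_restrict_space)
  note e'[measurable]
  have idm: "(\<lambda>x. x) \<in> measurable state_space borel"
    by (rule measurable_restrict_space1) simp
  have [measurable]: "fst \<in> measurable (state_space \<Otimes>\<^sub>M M) borel"
    using measurable_comp[OF measurable_fst idm] by (simp add: comp_def)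
  have "(\<lambda>p. \<epsilon> 1 (snd p) * fst p * (1 - fst p)) \<in> borel_measurable (state_space \<Otimes>\<^sub>M M)"
    by measurable
  then have pair: "(\<lambda>(x, \<omega>). \<epsilon> 1 \<omega> * x * (1 - x)) \<in> measurable (state_space \<Otimes>\<^sub>M M) state_space"
    unfolding case_prod_beta
    by (rule measurable_restrict_space2[rotated])
       (use er logistic_map_unit in \<open>auto simp: space_pair_measure space_restrict_space\<close>)
  have const: "(\<lambda>_. M) \<in> measurable state_space (subprob_algebra M)"
    by (simp add: space_subprob_algebra subprob_space_axioms)
  have sub: "logistic_kernel M \<epsilon> \<in> measurable state_space (subprob_algebra state_space)"
    unfolding logistic_kernel_def by (rule measurable_distr2[OF pair const])
  have "logistic_kernel M \<epsilon> x \<in> space (prob_algebra state_space)" if "x \<in> space state_space" for x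
  proof -
    have "(\<lambda>\<omega>. \<epsilon> 1 \<omega> * x * (1 - x)) \<in> measurable M state_space"
      using measurable_Pair2[OF pair that] by simp
    then show ?thesis
      by (simp add: logistic_kernel_def space_prob_algebra prob_space_distr)
  qed
  then show ?thesis
    using sub by (auto simp: prob_algebra_def intro!: measurable_restrict_space2 simp: space_restrict_space)
qed

lemma nstep_measurable:
  assumes P: "P \<in> measurable S (prob_algebra S)"
  shows "nstep S P n \<in> measurable S (prob_algebra S)"
proof (induction n)
  case 0
  have "nstep S P 0 = return S" by (rule ext) simp
  then show ?case by (simp add: measurable_prob_algebraI[OF prob_space_return])
next
  case (Suc n)
  have "(\<lambda>x. nstep S P n x \<bind> P) \<in> measurable S (prob_algebra S)"
    by (rule measurable_bind_prob_space[OF Suc P])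
  then show ?case by (simp cong: measurable_cong)
qed

lemma emeasure_nstep_Suc:
  assumes P: "P \<in> measurable S (prob_algebra S)" and x: "x \<in> space S" and B: "B \<in> sets S"
  shows "emeasure (nstep S P (Suc n) x) B = (\<integral>\<^sup>+y. emeasure (P y) B \<partial>nstep S P n x)"
proof -
  have s: "sets (nstep S P n x) = sets S" and p: "prob_space (nstep S P n x)"
    using measurable_space[OF nstep_measurable[OF P] x] by (auto simp: space_prob_algebra)
  have "P \<in> measurable (nstep S P n x) (subprob_algebra S)"
    using measurable_prob_algebraD[OF P] s by (simp cong: measurable_cong_sets)
  then show ?thesis
    using prob_space.not_empty[OF p] B by (simp add: emeasure_bind)
qed

lemma emeasure_cesaro:
  assumes P: "P \<in> measurable S (prob_algebra S)" and x: "x \<in> space S" and B: "B \<in> sets S"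
  shows "emeasure (cesaro S P x N) B = (\<Sum>n = 1..N. emeasure (nstep S P n x) B) / of_nat N"
proof (rule emeasure_measure_of[OF cesaro_def])
  have s: "sets (nstep S P n x) = sets S" for n
    using measurable_space[OF nstep_measurable[OF P] x] by (auto simp: space_prob_algebra)
  show "countably_additive (sets (cesaro S P x N))
          (\<lambda>B. (\<Sum>n = 1..N. emeasure (nstep S P n x) B) / of_nat N)"
  proof (rule countably_additiveI)
    fix A :: "nat \<Rightarrow> 'a set"
    assume A: "range A \<subseteq> sets (cesaro S P x N)" and d: "disjoint_family A"
    have A': "range A \<subseteq> sets S"
      using A by (simp add: cesaro_def sets.space_closed sets.sigma_sets_eq)
    have "(\<Sum>i. (\<Sum>n = 1..N. emeasure (nstep S P n x) (A i)) / of_nat N)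
            = (\<Sum>n = 1..N. (\<Sum>i. emeasure (nstep S P n x) (A i))) / of_nat N"
      by (simp add: divide_ennreal_def ennreal_suminf_multc suminf_sum)
    also have "\<dots> = (\<Sum>n = 1..N. emeasure (nstep S P n x) (\<Union>i. A i)) / of_nat N"
      using A' d s by (simp add: suminf_emeasure)
    finally show "(\<Sum>i. (\<Sum>n = 1..N. emeasure (nstep S P n x) (A i)) / of_nat N)
            = (\<Sum>n = 1..N. emeasure (nstep S P n x) (\<Union>i. A i)) / of_nat N" .
  qed
qed (use B sets.space_closed[of S] in
      \<open>auto simp: positive_def cesaro_def sets.sigma_sets_eq sets.space_closed\<close>)

end

theory Submission
  imports Defs
begin

text \<open>
  Since the noise has a density bounded below on an interval \<open>{a<..<b}\<close> in \<open>(1,4)\<close>, the chain can be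
  steered with parameters from that interval. An open set that is invariant under this steering must meet the critical orbit of the
  map with the midpoint parameter: this is Singer's theorem, which here only needs that the quadratic
  family satisfies a two-point form of the negative Schwarzian condition. Hence an accumulation point
  of that critical orbit can be reached from everywhere, and spreading the noise around it yields
  one measure that minorizes some power of the kernel, uniformly on compact sets.

  The chain returns to a fixed compact set almost surely: on the event that it does not, it tends to 0
  in probability, and a chain driven by the same noise from the point \<open>x\<^sub>0\<close> with tight averages
  would then be dragged to 0 as well. Recurrence and minorization give a Liouville theorem: bounded
  functions that are asymptotically harmonic are asymptotically constant. Applied to the averages of
  indicators of arbitrarily chosen sets \<open>B\<^sub>N\<close>, it yields convergence in total variation to
  the invariant probability, which exists by the Krylov-Bogoliubov argument.
\<close>

section \<open>Steering the logistic map\<close>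

text \<open>The noise may put mass below 1, where 0 attracts, and no moment condition restrains it.
  Only the tight averages forbid escape to 0, and they are given for one starting point. Hence a
  comparison of two chains by common noise: \<open>x \<le> c * y\<close> persists as long as
  \<open>y\<close> is small. The bound 1/5 on \<kappa> comes from parameters below 4: a step from
  below \<kappa> ends below 4\<kappa> \<le> 1 - \<kappa>, and so does a step from above 1 -
  \<kappa>, so no chain leaps over \<open>{\<kappa>..1-\<kappa>}\<close> on its way up from 0. The
  chain may be periodic (noise close to a parameter with an attracting 2-cycle). So the number of
  steps in the minorization depends on the state and only averages converge; an average over N steps
  is harmonic up to order 1/N, whatever set is averaged. Steering uses parameters above 1 and thus
  keeps away from 0 and 1. The steered set is open but may have many components; one that returns to
  itself is found by compactness, because a steering step from [d,1-d] always sweeps an interval of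
  length bounded below.\<close>

text \<open>\<open>v\<close> is the first point after \<open>r\<close> where the graph meets the
  diagonal or the derivative stops being positive. A diagonal met from below forces slope at least
  1. Otherwise the derivative vanishes at \<open>v\<close>, while \<open>G\<close> is increasing and
  below the diagonal on \<open>{r..v}\<close>: the iterates of \<open>v\<close> decrease until they
  pass \<open>r\<close>, and by monotonicity the first one to do so is still at least
  \<open>G r\<close>.\<close>

lemma first_crossing:
  fixes G DG :: "real \<Rightarrow> real"
  assumes D: "\<And>t. (G has_real_derivative DG t) (at t)"
    and cD: "continuous_on UNIV DG"
    and r: "G r < r" "DG r > 0"
    and T: "r < T" "G T \<ge> T \<or> DG T \<le> 0"
  shows "\<exists>v>r. v \<le> T \<and> (\<forall>t. r \<le> t \<longrightarrow> t < v \<longrightarrow> DG t > 0) \<and>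
    ((G v = v \<and> DG v \<ge> 1) \<or> (DG v = 0 \<and> (\<exists>k\<ge>1. G r \<le> (G ^^ k) v \<and> (G ^^ k) v < r)))"
proof -
  have cG: "continuous_on UNIV G"
    using D by (intro continuous_at_imp_continuous_on) (auto intro: DERIV_isCont)
  define A where "A = {r..T} \<inter> ({t. t \<le> G t} \<union> {t. DG t \<le> 0})"
  have "closed A"
    unfolding A_def
    by (intro closed_Int closed_Un closed_Collect_le continuous_intros cD cG)
  moreover have "T \<in> A" using T by (auto simp: A_def)
  then have "A \<noteq> {}" by blast
  moreover have bA: "bdd_below A" by (auto simp: A_def bdd_below_def)
  ultimately have vA: "Inf A \<in> A" by (intro closed_contains_Inf)
  define v where "v = Inf A"
  have v: "r \<le> v" "v \<le> T" "v \<le> G v \<or> DG v \<le> 0" using vA by (auto simp: A_def v_def)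
  with r have rv: "r < v" by (cases "r = v") auto
  have below: "G t < t" "DG t > 0" if "r \<le> t" "t < v" for t
  proof -
    have "t \<notin> A" using cInf_lower[OF _ bA, of t] that by (auto simp: v_def)
    then show "G t < t" "DG t > 0" using that v by (auto simp: A_def)
  qed
  have lim: "((\<lambda>t. F t) \<longlongrightarrow> F v) (at_left v)" if "continuous_on UNIV F" for F :: "real \<Rightarrow> real"
    using that by (simp add: continuous_on_eq_continuous_at isCont_def filterlim_at_split)
  have ev: "eventually (\<lambda>t. r \<le> t \<and> t < v) (at_left v)"
    using rv eventually_at_left[of r v] by (auto intro!: exI[of _ r])
  have Gv: "G v \<le> v"
  proof (rule tendsto_le[OF _ _ lim[OF cG]])
    show "((\<lambda>t. t) \<longlongrightarrow> v) (at_left v)" by (rule tendsto_ident_at)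
    show "eventually (\<lambda>t. G t \<le> t) (at_left v)"
      using ev by eventually_elim (use below less_imp_le in blast)
  qed simp
  have DGv: "DG v \<ge> 0"
    by (rule tendsto_lowerbound[OF lim[OF cD]])
       (use ev below less_imp_le in \<open>auto elim!: eventually_mono\<close>)
  have mono: "G s \<le> G t" if "r \<le> s" "s \<le> t" "t \<le> v" for s t
  proof (rule DERIV_nonneg_imp_nondecreasing[OF that(2)])
    fix z assume "s \<le> z" "z \<le> t"
    then have "DG z \<ge> 0" using below(2)[of z] DGv that by (cases "z = v") auto
    then show "\<exists>y. (G has_real_derivative y) (at z) \<and> 0 \<le> y" using D by blast
  qed
  have "(G v = v \<and> DG v \<ge> 1) \<or> (DG v = 0 \<and> (\<exists>k\<ge>1. G r \<le> (G ^^ k) v \<and> (G ^^ k) v < r))"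
  proof (cases "G v = v")
    case True
    have "((\<lambda>t. (G t - G v) / (t - v)) \<longlongrightarrow> DG v) (at_left v)"
      using D[of v] by (simp add: has_field_derivative_iff filterlim_at_split)
    then have "1 \<le> DG v"
    proof (rule tendsto_lowerbound)
      show "eventually (\<lambda>t. 1 \<le> (G t - G v) / (t - v)) (at_left v)"
        using ev by eventually_elim (use below(1) True in \<open>force simp: field_simps\<close>)
    qed simp
    with True show ?thesis by blast
  next
    case False
    with v Gv DGv have lt: "G v < v" "DG v = 0" by auto
    then have below': "G t < t" if "r \<le> t" "t \<le> v" for t
      using below(1)[of t] that by (cases "t = v") auto
    \<comment> \<open>Iterates that stayed above \<open>r\<close> would decrease to a fixed point in
      \<open>{r..v}\<close>, where \<open>G t < t\<close>.\<close>
    have ex: "\<exists>k. (G ^^ k) v < r"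
    proof (rule ccontr)
      assume "\<not> ?thesis"
      then have ge: "r \<le> (G ^^ k) v" for k by (auto simp: not_less)
      have le: "(G ^^ k) v \<le> v" for k
      proof (induction k)
        case (Suc k)
        with below'[OF ge Suc] show ?case by simp
      qed simp
      have "decseq (\<lambda>k. (G ^^ k) v)"
        using below'[OF ge le] by (intro decseq_SucI) (simp add: less_imp_le)
      then obtain w where w: "(\<lambda>k. (G ^^ k) v) \<longlonglongrightarrow> w"
        using decseq_convergent[of "\<lambda>k. (G ^^ k) v" r] ge by blast
      have "r \<le> w" "w \<le> v"
        using LIMSEQ_le_const[OF w, of r] LIMSEQ_le_const2[OF w, of v] ge le by auto
      have "(\<lambda>k. G ((G ^^ k) v)) \<longlonglongrightarrow> G w"
        using cG by (intro isCont_tendsto_compose[OF _ w]) (simp add: continuous_on_eq_continuous_at)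
      moreover have "(\<lambda>k. G ((G ^^ k) v)) \<longlonglongrightarrow> w"
        using LIMSEQ_Suc[OF w] by simp
      ultimately have "G w = w" by (rule LIMSEQ_unique)
      with below'[OF \<open>r \<le> w\<close> \<open>w \<le> v\<close>] show False by simp
    qed
    define k where "k = (LEAST k. (G ^^ k) v < r)"
    have k: "(G ^^ k) v < r" unfolding k_def using ex by (rule LeastI_ex)
    have k0: "k \<noteq> 0" using k rv by (intro notI) simp
    have small: "r \<le> (G ^^ j) v" if "j < k" for j
      using not_less_Least[of j "\<lambda>k. (G ^^ k) v < r"] that by (simp add: k_def not_less)
    have le: "(G ^^ j) v \<le> v" if "j < k" for j
      using that
    proof (induction j)
      case (Suc j)
      then show ?case using below'[OF small[of j]] by fastforce
    qed simp
    obtain j where j: "k = Suc j" using k0 not0_implies_Suc by blast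
    have "G r \<le> (G ^^ k) v"
      using mono[OF order_refl small le] j by simp
    with k k0 lt show ?thesis by (intro disjI2 conjI exI[of _ k]) auto
  qed
  then show ?thesis using rv v(2) below(2) by blast
qed

section \<open>Iterates of the logistic map\<close>

definition lmap :: "real \<Rightarrow> real \<Rightarrow> real" where "lmap \<theta> x = \<theta> * x * (1 - x)"

text \<open>The chain-rule product along the orbit. For \<theta> \<noteq> 0 it vanishes exactly when
  one of the first \<open>k\<close> orbit points is the critical point 1/2.\<close>

definition dlmap :: "real \<Rightarrow> nat \<Rightarrow> real \<Rightarrow> real" where
  "dlmap \<theta> k x = (\<Prod>i<k. \<theta> * (1 - 2 * (lmap \<theta> ^^ i) x))"

lemma DERIV_lmap_funpow: "((lmap \<theta> ^^ k) has_real_derivative dlmap \<theta> k x) (at x)"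
proof (induction k)
  case (Suc k)
  have "(lmap \<theta> has_real_derivative \<theta> * (1 - 2 * y)) (at y)" for y
    unfolding lmap_def by (auto intro!: derivative_eq_intros simp: algebra_simps)
  from DERIV_chain[OF this Suc] show ?case by (simp add: dlmap_def mult.commute comp_def)
qed (simp add: dlmap_def id_def)

lemma continuous_lmap_funpow: "continuous_on A (lmap \<theta> ^^ k)"
  by (intro continuous_at_imp_continuous_on) (use DERIV_lmap_funpow DERIV_isCont in blast)

lemma continuous_dlmap: "continuous_on A (dlmap \<theta> k)"
  unfolding dlmap_def by (intro continuous_intros continuous_lmap_funpow)

lemma dlmap_add: "dlmap \<theta> (j + k) x = dlmap \<theta> j x * dlmap \<theta> k ((lmap \<theta> ^^ j) x)"
proof (induction k)
  case (Suc k)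
  have "(lmap \<theta> ^^ (j + k)) x = (lmap \<theta> ^^ k) ((lmap \<theta> ^^ j) x)"
    by (subst add.commute) (simp add: funpow_add)
  then show ?case using Suc by (simp add: dlmap_def)
qed (simp add: dlmap_def)

text \<open>By AM-GM the inequality holds for one step, and the chain rule preserves it; it replaces the
  Schwarzian derivative.\<close>

lemma lmap_two_point:
  assumes "u \<noteq> v" "\<theta> > 0"
    and side: "\<And>i. i < k \<Longrightarrow> (1 - 2 * (lmap \<theta> ^^ i) u) * (1 - 2 * (lmap \<theta> ^^ i) v) > 0"
    and "k > 0"
  shows "dlmap \<theta> k u * dlmap \<theta> k v * (u - v)\<^sup>2 < ((lmap \<theta> ^^ k) u - (lmap \<theta> ^^ k) v)\<^sup>2"
proof -
  have "0 < dlmap \<theta> j u * dlmap \<theta> j v \<and> (lmap \<theta> ^^ j) u \<noteq> (lmap \<theta> ^^ j) v \<and>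
     dlmap \<theta> j u * dlmap \<theta> j v * (u - v)\<^sup>2 \<le> ((lmap \<theta> ^^ j) u - (lmap \<theta> ^^ j) v)\<^sup>2 \<and>
     (0 < j \<longrightarrow> dlmap \<theta> j u * dlmap \<theta> j v * (u - v)\<^sup>2 < ((lmap \<theta> ^^ j) u - (lmap \<theta> ^^ j) v)\<^sup>2)"
    if "j \<le> k" for j
    using that
  proof (induction j)
    case 0
    then show ?case using assms(1) by (simp add: dlmap_def)
  next
    case (Suc j)
    define X where "X = (lmap \<theta> ^^ j) u"
    define Y where "Y = (lmap \<theta> ^^ j) v"
    define A where "A = dlmap \<theta> j u * dlmap \<theta> j v"
    define p where "p = \<theta> * (1 - 2 * X)"
    define q where "q = \<theta> * (1 - 2 * Y)"
    have IH: "0 < A" "X \<noteq> Y" "A * (u - v)\<^sup>2 \<le> (X - Y)\<^sup>2"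
      using Suc by (auto simp: X_def Y_def A_def)
    have "p * q = \<theta>\<^sup>2 * ((1 - 2 * X) * (1 - 2 * Y))" by (simp add: p_def q_def power2_eq_square)
    then have pq: "p * q > 0"
      using side[of j] Suc.prems assms(2) by (simp add: X_def Y_def)
    have "p \<noteq> q" using IH assms(2) by (simp add: p_def q_def)
    then have "0 < (p - q)\<^sup>2" by simp
    then have amgm: "p * q < ((p + q) / 2)\<^sup>2" by (simp add: power2_eq_square field_simps)
    have d: "dlmap \<theta> (Suc j) u * dlmap \<theta> (Suc j) v = p * q * A"
      by (simp add: dlmap_def p_def q_def A_def X_def Y_def)
    \<comment> \<open>The map is quadratic, so its secant slope between \<open>X\<close> and
      \<open>Y\<close> is exactly the mean of the end slopes \<open>p\<close> and
      \<open>q\<close>.\<close>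
    have e: "(lmap \<theta> ^^ Suc j) u - (lmap \<theta> ^^ Suc j) v = ((p + q) / 2) * (X - Y)"
      by (simp add: X_def[symmetric] Y_def[symmetric] lmap_def p_def q_def field_simps)
    have "p * q * A * (u - v)\<^sup>2 \<le> p * q * (X - Y)\<^sup>2"
      using mult_left_mono[OF IH(3) less_imp_le[OF pq]] by (simp only: mult.assoc)
    also have "\<dots> < ((p + q) / 2)\<^sup>2 * (X - Y)\<^sup>2"
      using amgm IH by (intro mult_strict_right_mono) auto
    finally have s: "p * q * A * (u - v)\<^sup>2 < (((p + q) / 2) * (X - Y))\<^sup>2"
      by (simp only: power_mult_distrib)
    have "((p + q) / 2) * (X - Y) \<noteq> 0"
    proof
      assume eq: "((p + q) / 2) * (X - Y) = 0"
      have "p * q * A * (u - v)\<^sup>2 < 0" using s unfolding eq by simp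
      moreover have "0 \<le> p * q * A * (u - v)\<^sup>2" using pq IH by simp
      ultimately show False by simp
    qed
    then have "(lmap \<theta> ^^ Suc j) u \<noteq> (lmap \<theta> ^^ Suc j) v" using e by auto
    moreover have "0 < p * q * A" using pq IH by simp
    ultimately show ?case using s unfolding d e by (auto intro: less_imp_le)
  qed
  from this[of k] assms(4) show ?thesis by simp
qed

lemma same_sign_interval:
  fixes h :: "real \<Rightarrow> real"
  assumes "continuous_on {l..r} h" "\<And>t. t \<in> {l..r} \<Longrightarrow> h t \<noteq> 0" "x \<in> {l..r}" "y \<in> {l..r}"
  shows "h x * h y > 0"
proof (rule ccontr)
  assume neg: "\<not> ?thesis"
  have "connected (h ` {l..r})" using assms(1) by (intro connected_continuous_image) auto
  then have iv: "is_interval (h ` {l..r})" by (simp add: is_interval_connected_1)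
  have "(h x \<le> 0 \<and> 0 \<le> h y) \<or> (h y \<le> 0 \<and> 0 \<le> h x)"
    using neg by (auto simp: not_less mult_le_0_iff)
  then have "0 \<in> h ` {l..r}"
    using iv assms(3,4) unfolding is_interval_1 by blast
  with assms(2) show False by auto
qed

text \<open>A control set that misses the critical orbit of \<open>lmap \<theta>\<close> would have a component that an even
  iterate of \<open>lmap \<theta>\<close> maps increasingly into itself; between the two repelling fixed points that
  bound its basin of attraction this contradicts \<open>lmap_two_point\<close>, as in Singer's theorem.\<close>

lemma critical_orbit_enters:
  fixes R :: "real set"
  assumes R: "open R" "R \<subseteq> {d..1-d}" "0 < d" "z \<in> R"
    and inv: "\<And>y t. y \<in> R \<Longrightarrow> a < t \<Longrightarrow> t < b \<Longrightarrow> t * y * (1 - y) \<in> R"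
    and th: "0 < a" "a < \<theta>" "\<theta> < b"
  shows "\<exists>n. (lmap \<theta> ^^ n) (1/2) \<in> R"
proof (rule ccontr)
  assume no: "\<not> ?thesis"
  have th0: "0 < \<theta>" using th by simp
  have prod_pos: "d * d \<le> y * (1 - y)" if "y \<in> {d..1-d}" for y
    using that R(3) by (intro mult_mono) auto
  have lR: "lmap \<theta> y \<in> R" if "y \<in> R" for y
    using inv[OF that] th by (simp add: lmap_def)
  have lRn: "(lmap \<theta> ^^ n) y \<in> R" if "y \<in> R" for y n
    by (induction n) (use that lR in auto)
  \<comment> \<open>A nearby point \<open>w\<close> of \<open>R\<close> imitates the limit point
    \<open>y\<close> exactly: a slight change of the parameter, to \<open>t\<close>, compensates the
    change from \<open>y\<close> to \<open>w\<close>.\<close>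
  have clR: "lmap \<theta> y \<in> R" if y: "y \<in> closure R" for y
  proof -
    have "closure R \<subseteq> {d..1-d}" using R(2) by (intro closure_minimal) auto
    then have "0 < y * (1 - y)" using prod_pos[of y] y R(3) by (smt (verit) mult_pos_pos subsetD)
    then have lt: "a * (y * (1 - y)) < \<theta> * (y * (1 - y))" "\<theta> * (y * (1 - y)) < b * (y * (1 - y))"
      using th by (auto simp only: intro: mult_strict_right_mono)
    define W where "W = {w. a * (w * (1 - w)) < \<theta> * (y * (1 - y))} \<inter> {w. \<theta> * (y * (1 - y)) < b * (w * (1 - w))}"
    have "open W" unfolding W_def by (intro open_Int open_Collect_less continuous_intros)
    moreover have "y \<in> W" using lt by (simp add: W_def)
    ultimately have "W \<inter> R \<noteq> {}" using y open_Int_closure_eq_empty[of W R] by blast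
    then obtain w where w: "w \<in> W" "w \<in> R" by blast
    have w0: "0 < w * (1 - w)" using prod_pos[of w] w R by (smt (verit) mult_pos_pos subsetD)
    define t where "t = \<theta> * (y * (1 - y)) / (w * (1 - w))"
    have "a < t" "t < b" using w w0 by (auto simp: t_def W_def pos_less_divide_eq pos_divide_less_eq)
    from inv[OF w(2) this] have "t * (w * (1 - w)) \<in> R" by (simp only: mult.assoc)
    moreover have "X / s * s = X" if "0 < s" for X s :: real using that by simp
    ultimately show ?thesis using w0 unfolding t_def lmap_def by (simp only: mult.assoc)
  qed
  define zs where "zs i = (lmap \<theta> ^^ i) z" for i
  have zs: "zs i \<in> R" for i unfolding zs_def by (rule lRn[OF R(4)])
  \<comment> \<open>For \<open>y\<close> in \<open>{d..1-d}\<close> one has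
    \<open>y * (1 - y) \<ge> d * d\<close>. Hence every point within \<rho> of
    \<open>lmap \<theta> y\<close> is reached from \<open>y\<close> with some parameter in
    \<open>{a<..<b}\<close>.\<close>
  define \<rho> where "\<rho> = min (\<theta> - a) (b - \<theta>) * (d * d)"
  have "\<rho> > 0" using th R(3) by (simp add: \<rho>_def)
  obtain i j where ij: "i < j" "\<bar>zs (Suc i) - zs (Suc j)\<bar> < \<rho>"
  proof -
    have "seq_compact {d..1-d}" by (simp add: compact_imp_seq_compact)
    moreover have "\<forall>n. zs (Suc n) \<in> {d..1-d}" using zs R(2) by blast
    ultimately obtain w r where r: "strict_mono r" "((\<lambda>n. zs (Suc n)) \<circ> r) \<longlonglongrightarrow> w"
      unfolding seq_compact_def by (metis (no_types, lifting))
    from LIMSEQ_imp_Cauchy[OF r(2)] \<open>\<rho> > 0\<close> obtain N where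
      "\<forall>m\<ge>N. \<forall>n\<ge>N. dist (((\<lambda>n. zs (Suc n)) \<circ> r) m) (((\<lambda>n. zs (Suc n)) \<circ> r) n) < \<rho>"
      unfolding Cauchy_def by meson
    then have "\<bar>zs (Suc (r N)) - zs (Suc (r (Suc N)))\<bar> < \<rho>" by (auto simp: dist_real_def)
    moreover have "r N < r (Suc N)" using r(1) by (simp add: strict_mono_Suc_iff)
    ultimately show thesis by (rule that[rotated])
  qed
  define m where "m = j - i"
  have m: "m > 0" "j = m + i" using ij by (auto simp: m_def)
  define p where "p = zs (Suc i)"
  define K where "K = connected_component_set R p"
  have pR: "p \<in> R" by (simp add: p_def zs)
  have KR: "K \<subseteq> R" by (simp add: K_def connected_component_subset)
  have Kabs: "T \<subseteq> K" if "connected T" "T \<subseteq> R" "T \<inter> K \<noteq> {}" for T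
  proof -
    from that obtain t where t: "t \<in> T" "t \<in> K" by blast
    have "T \<subseteq> connected_component_set R t" by (rule connected_component_maximal[OF t(1) that(1,2)])
    also have "\<dots> = K" using t(2) connected_component_eq[of t R p] by (simp add: K_def)
    finally show ?thesis .
  qed
  have pK: "p \<in> K" using pR by (simp add: K_def)
  define s where "s = zs i * (1 - zs i)"
  have zi: "d * d \<le> s" using zs[of i] R(2) unfolding s_def by (intro prod_pos) auto
  moreover have "0 < d * d" using R(3) by simp
  ultimately have s0: "0 < s" by linarith
  define I where "I = {a * s<..<b * s}"
  have pth: "p = \<theta> * s" by (simp add: p_def zs_def lmap_def s_def)
  have pI: "p \<in> I" using th s0 by (simp add: I_def pth)
  have "I \<subseteq> K"
  proof (rule Kabs)
    show "I \<subseteq> R"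
    proof
      fix y assume y: "y \<in> I"
      define t where "t = y / s"
      have "a < t" "t < b" using y s0 by (auto simp: t_def I_def pos_less_divide_eq pos_divide_less_eq)
      from inv[OF zs this] have "t * s \<in> R" by (simp only: mult.assoc s_def)
      then show "y \<in> R" using s0 by (simp add: t_def)
    qed
    show "I \<inter> K \<noteq> {}" using pK pI by blast
  qed (auto simp: I_def)
  moreover have "zs (Suc j) \<in> I"
  proof -
    have "\<rho> \<le> (\<theta> - a) * s" "\<rho> \<le> (b - \<theta>) * s"
      unfolding \<rho>_def using zi th R(3) by (auto intro!: mult_mono)
    then show ?thesis using ij(2) unfolding I_def p_def[symmetric] pth
      by (auto simp: algebra_simps)
  qed
  ultimately have jK: "zs (Suc j) \<in> K" by blast
  have zj: "zs (Suc j) = (lmap \<theta> ^^ m) p"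
    unfolding zs_def p_def m(2) by (metis add_Suc_right comp_apply funpow_add)
  \<comment> \<open>\<open>(lmap \<theta> ^^ m) p\<close> is the later orbit point that came back
    close to \<open>p\<close>, so the connected image of the component \<open>K\<close> meets
    \<open>K\<close> and is absorbed by it.\<close>
  have gK: "(lmap \<theta> ^^ m) ` K \<subseteq> K"
  proof (rule Kabs)
    show "connected ((lmap \<theta> ^^ m) ` K)"
      by (intro connected_continuous_image continuous_lmap_funpow) (simp add: K_def)
    show "(lmap \<theta> ^^ m) ` K \<subseteq> R" using KR lRn by auto
    show "(lmap \<theta> ^^ m) ` K \<inter> K \<noteq> {}"
      using jK pK zj by auto
  qed
  define l where "l = Inf K"
  define r where "r = Sup K"
  have Kd: "K \<subseteq> {d..1-d}" using KR R(2) by blast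
  then have bdd: "bdd_below K" "bdd_above K"
    by (meson bdd_below_Icc bdd_above_Icc bdd_below_mono bdd_above_mono)+
  have K_lr: "l \<le> y" "y \<le> r" if "y \<in> K" for y
    using cInf_lower[OF that bdd(1)] cSup_upper[OF that bdd(2)] by (auto simp: l_def r_def)
  have edge: "y \<notin> R" if y: "y = l \<or> y = r" for y
  proof
    assume "y \<in> R"
    with R(1) obtain e where e: "e > 0" "ball y e \<subseteq> R" by (auto simp: open_contains_ball)
    have "y \<in> closure K"
      using y pK bdd closure_contains_Inf[of K] closure_contains_Sup[of K] unfolding l_def r_def by blast
    then have "ball y e \<inter> K \<noteq> {}" using e(1) open_Int_closure_eq_empty[of "ball y e" K] centre_in_ball[of y e] by blast
    then have "ball y e \<subseteq> K" using e(2) by (intro Kabs) auto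
    moreover have "y - e/2 \<in> ball y e" "y + e/2 \<in> ball y e" using e(1) by (auto simp: dist_real_def)
    ultimately have "y - e/2 \<in> K" "y + e/2 \<in> K" by blast+
    then show False using K_lr[of "y - e/2"] K_lr[of "y + e/2"] y e(1) by auto
  qed
  have Keq: "K = {l<..<r}"
  proof
    show "K \<subseteq> {l<..<r}"
      using K_lr KR edge by (smt (verit, ccfv_SIG) greaterThanLessThan_iff subset_iff)
    show "{l<..<r} \<subseteq> K"
    proof
      fix y assume y: "y \<in> {l<..<r}"
      then obtain x1 x2 where "x1 \<in> K" "x1 < y" "x2 \<in> K" "y < x2"
        using cInf_less_iff[of K y] less_cSup_iff[of K y] pK bdd unfolding l_def r_def by auto
      moreover have "is_interval K" by (simp add: is_interval_connected_1 K_def)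
      ultimately show "y \<in> K" unfolding is_interval_1 by (meson less_imp_le)
    qed
  qed
  have lr: "l < r" using pK Keq by auto
  have clK: "{l..r} = closure K" using lr by (simp add: Keq)
  have cl_sub: "{l..r} \<subseteq> closure R" unfolding clK by (rule closure_mono[OF KR])
  have lrd: "{l..r} \<subseteq> {d..1-d}" unfolding clK using Kd by (intro closure_minimal) auto
  have l0: "0 < l" "r < 1" using lrd lr R(3) by auto
  have g_lr: "(lmap \<theta> ^^ m) t \<in> {l..r}" if "t \<in> {l..r}" for t
  proof -
    have "(lmap \<theta> ^^ m) ` closure K \<subseteq> {l..r}"
      using gK Keq by (intro image_closure_subset continuous_lmap_funpow) force+
    then show ?thesis using that clK by auto
  qed
  have clRn: "(lmap \<theta> ^^ n) t \<in> R" if "t \<in> {l..r}" "n > 0" for t n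
    using lRn[OF clR[of t], of "n - 1"] that cl_sub by (cases n) (auto simp: funpow_swap1)
  \<comment> \<open>A visit to 1/2 from \<open>{l..r}\<close> would put the next point, the critical
    value, into \<open>R\<close>.\<close>
  have nocrit: "1 - 2 * (lmap \<theta> ^^ n) t \<noteq> 0" if "t \<in> {l..r}" for t n
  proof
    assume "1 - 2 * (lmap \<theta> ^^ n) t = 0"
    then have h: "(lmap \<theta> ^^ n) t = 1/2" by simp
    have "(lmap \<theta> ^^ Suc n) t \<in> R" by (rule clRn[OF that]) simp
    then have "(lmap \<theta> ^^ 1) (1/2) \<in> R" using h by simp
    with no show False by blast
  qed
  \<comment> \<open>Doubling \<open>m\<close> makes the derivative a product of two factors of equal
    sign, so it is positive on \<open>{l..r}\<close> whether the first return preserves or reverses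
    orientation.\<close>
  define M where "M = m + m"
  define G where "G = lmap \<theta> ^^ M"
  define DG where "DG = dlmap \<theta> M"
  have M0: "M > 0" using m by (simp add: M_def)
  have DGpos: "DG t > 0" if t: "t \<in> {l..r}" for t
  proof -
    have "dlmap \<theta> m x \<noteq> 0" if "x \<in> {l..r}" for x
      using nocrit[OF that] th0 by (simp add: dlmap_def)
    from same_sign_interval[OF continuous_dlmap this t g_lr[OF t]]
    show ?thesis by (simp add: DG_def M_def dlmap_add)
  qed
  have G_lr: "G t \<in> {l<..<r}" if "t \<in> {l..r}" for t
  proof -
    have "G t \<in> {l..r}" using g_lr[OF g_lr[OF that]] by (simp add: G_def M_def funpow_add)
    moreover have "G t \<in> R" unfolding G_def by (rule clRn[OF that M0])
    ultimately show ?thesis using edge by (auto simp: less_le)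
  qed
  \<comment> \<open>A zero of \<open>DG\<close> passes through 1/2 in fewer than \<open>M\<close>
    steps, so landing in \<open>{l<..<r}\<close> would bring the critical orbit into
    \<open>R\<close>. This excludes the second alternative of \<open>first_crossing\<close> on
    either side of the component.\<close>
  have bad: False if k: "k \<ge> 1" "(G ^^ k) w \<in> {l<..<r}" and D0: "DG w = 0" for w k
  proof -
    obtain i where i: "i < M" "(lmap \<theta> ^^ i) w = 1/2" using D0 th0 by (auto simp: DG_def dlmap_def)
    have "i \<le> M * k" using i(1) k(1) by (metis less_imp_le le_trans mult_le_mono2 mult.right_neutral)
    then have "(lmap \<theta> ^^ (M * k)) w = (lmap \<theta> ^^ (M * k - i)) ((lmap \<theta> ^^ i) w)"
      by (metis comp_apply funpow_add le_add_diff_inverse2)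
    moreover have "(lmap \<theta> ^^ (M * k)) w \<in> R"
      using k(2) KR Keq by (auto simp: G_def funpow_mult)
    ultimately have "(lmap \<theta> ^^ (M * k - i)) (1/2) \<in> R" using i(2) by simp
    with no show False by blast
  qed
  have DG: "(G has_real_derivative DG t) (at t)" for t
    unfolding G_def DG_def by (rule DERIV_lmap_funpow)
  have cDG: "continuous_on UNIV DG" unfolding DG_def by (rule continuous_dlmap)
  have zero: "(lmap \<theta> ^^ n) 0 = 0" for n by (induction n) (auto simp: lmap_def)
  have Gr: "G r < r" and Gl: "l < G l" using G_lr[of r] G_lr[of l] lr by auto
  obtain M' where M': "M = Suc M'" using M0 by (cases M) auto
  \<comment> \<open>The point 1 is mapped to the fixed point 0, so \<open>DG 1\<close> equals
    \<open>- (\<theta> ^ M)\<close>: the search to the right of \<open>r\<close> ends at 1 at the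
    latest.\<close>
  have "DG 1 = \<theta> * (1 - 2) * (\<Prod>i<M'. \<theta> * (1 - 2 * (lmap \<theta> ^^ i) 0))"
    unfolding DG_def dlmap_def M' prod.lessThan_Suc_shift
    by (simp add: funpow_swap1 lmap_def del: funpow.simps(2)) (simp add: funpow_swap1 lmap_def)
  then have T: "G 1 \<ge> 1 \<or> DG 1 \<le> 0" using th0 by (simp add: zero)
  have rin: "r \<in> {l..r}" using lr by simp
  obtain v where vv: "r < v \<and> v \<le> 1 \<and> (\<forall>t. r \<le> t \<longrightarrow> t < v \<longrightarrow> DG t > 0) \<and>
    ((G v = v \<and> DG v \<ge> 1) \<or> (DG v = 0 \<and> (\<exists>k\<ge>1. G r \<le> (G ^^ k) v \<and> (G ^^ k) v < r)))"
    by (rule exE[OF first_crossing[OF DG cDG Gr DGpos[OF rin] l0(2) T]])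
  note v0 = vv[THEN conjunct1] and v = vv[THEN conjunct2, THEN conjunct2, THEN conjunct1]
    vv[THEN conjunct2, THEN conjunct2, THEN conjunct2]
  have "G v = v \<and> DG v \<ge> 1"
  proof (rule disjE[OF v(2)])
    assume "DG v = 0 \<and> (\<exists>k\<ge>1. G r \<le> (G ^^ k) v \<and> (G ^^ k) v < r)"
    then obtain k where k: "DG v = 0" "k \<ge> 1" "G r \<le> (G ^^ k) v" "(G ^^ k) v < r" by blast
    have "l < G r" using G_lr[of r] lr by simp
    then have "(G ^^ k) v \<in> {l<..<r}" using k by simp
    from bad[OF k(2) this k(1)] show ?thesis ..
  qed
  then have v1: "G v = v" "DG v \<ge> 1" by blast+
  \<comment> \<open>Reflection turns the search to the left of \<open>l\<close> into a search to the
    right; it ends at the fixed point 0 at the latest.\<close>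
  define H where "H t = - G (- t)" for t
  define DH where "DH t = DG (- t)" for t
  have DH: "(H has_real_derivative DH t) (at t)" for t
  proof -
    have "((\<lambda>t. G (- t)) has_real_derivative DG (- t) * (- 1)) (at t)"
      by (rule DERIV_chain2[where f = G, OF DG]) (auto intro!: derivative_eq_intros)
    from DERIV_minus[OF this] show ?thesis by (simp add: H_def[abs_def] DH_def)
  qed
  have cDH: "continuous_on UNIV DH"
    unfolding DH_def using cDG by (rule continuous_on_compose2) (auto intro: continuous_intros)
  have lin: "l \<in> {l..r}" using lr by simp
  have G0: "G 0 = 0" unfolding G_def by (rule zero)
  have H: "H (- l) < - l" "DH (- l) > 0" "- l < 0" "H 0 \<ge> 0 \<or> DH 0 \<le> 0"
    using Gl DGpos[OF lin] l0 G0 by (simp_all add: H_def DH_def)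
  obtain u' where uu: "- l < u' \<and> u' \<le> 0 \<and> (\<forall>t. - l \<le> t \<longrightarrow> t < u' \<longrightarrow> DH t > 0) \<and>
    ((H u' = u' \<and> DH u' \<ge> 1) \<or> (DH u' = 0 \<and> (\<exists>k\<ge>1. H (- l) \<le> (H ^^ k) u' \<and> (H ^^ k) u' < - l)))"
    by (rule exE[OF first_crossing[OF DH cDH H]])
  note u0 = uu[THEN conjunct1] and u' = uu[THEN conjunct2, THEN conjunct2, THEN conjunct1]
    uu[THEN conjunct2, THEN conjunct2, THEN conjunct2]
  have Hk: "(H ^^ k) t = - (G ^^ k) (- t)" for k t
  proof (induction k)
    case (Suc k)
    then show ?case by (simp only: funpow.simps comp_apply H_def minus_minus)
  qed simp
  define u where "u = - u'"
  have "G u = u \<and> DG u \<ge> 1"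
  proof (rule disjE[OF u'(2)])
    assume "DH u' = 0 \<and> (\<exists>k\<ge>1. H (- l) \<le> (H ^^ k) u' \<and> (H ^^ k) u' < - l)"
    then obtain k where k: "DG u = 0" "k \<ge> 1" "(G ^^ k) u \<le> G l" "l < (G ^^ k) u"
      unfolding Hk by (auto simp: H_def DH_def u_def)
    have "G l < r" using G_lr[of l] lr by simp
    then have "(G ^^ k) u \<in> {l<..<r}" using k by simp
    from bad[OF k(2) this k(1)] show ?thesis ..
  next
    assume "H u' = u' \<and> DH u' \<ge> 1"
    then show ?thesis by (auto simp: H_def DH_def u_def)
  qed
  then have u1: "G u = u" "DG u \<ge> 1" by blast+
  have DGuv: "DG t > 0" if "t \<in> {u..v}" for t
  proof -
    have "DG t > 0" if "u < t" "t \<le> l" using u'(1)[rule_format, of "- t"] that by (simp add: DH_def u_def)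
    moreover have "DG u > 0" "DG v > 0" using u1(2) v1(2) by linarith+
    moreover have "t = u \<or> t = v \<or> (u < t \<and> t \<le> l) \<or> t \<in> {l..r} \<or> (r \<le> t \<and> t < v)"
      using that by auto
    ultimately show ?thesis using v(1)[rule_format, of t] DGpos[of t] by blast
  qed
  have nz: "1 - 2 * (lmap \<theta> ^^ i) t \<noteq> 0" if "i < M" "t \<in> {u..v}" for i t
  proof -
    have "dlmap \<theta> M t \<noteq> 0" using DGuv[OF that(2)] by (simp add: DG_def)
    then show ?thesis using that(1) by (auto simp: dlmap_def)
  qed
  have uv: "u < v" using u0 v0 lr by (simp add: u_def)
  have "(1 - 2 * (lmap \<theta> ^^ i) u) * (1 - 2 * (lmap \<theta> ^^ i) v) > 0" if "i < M" for i
    by (rule same_sign_interval[of u v "\<lambda>t. 1 - 2 * (lmap \<theta> ^^ i) t"])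
       (use nz that uv in \<open>auto intro!: continuous_intros continuous_lmap_funpow\<close>)
  \<comment> \<open>\<open>u\<close> and \<open>v\<close> are fixed points of \<open>G\<close> with
    slopes at least 1 and no critical point of \<open>G\<close> between them, whereas
    \<open>lmap_two_point\<close> makes the product of the two slopes less than 1.\<close>
  from lmap_two_point[OF _ th0 this M0] uv
  have "DG u * DG v * (u - v)\<^sup>2 < (u - v)\<^sup>2" using u1 v1 by (simp add: DG_def G_def)
  moreover have "1 * (u - v)\<^sup>2 \<le> DG u * DG v * (u - v)\<^sup>2"
    using u1(2) v1(2) mult_mono[of 1 "DG u" 1 "DG v"] by (intro mult_right_mono) auto
  ultimately show False by simp
qed

definition lstep :: "real \<Rightarrow> real \<Rightarrow> real \<Rightarrow> real \<Rightarrow> bool" where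
  "lstep a b x y \<longleftrightarrow> (\<exists>t. a < t \<and> t < b \<and> y = t * x * (1 - x))"

lemma lstep_iff:
  assumes "0 < x" "x < 1"
  shows "lstep a b x y \<longleftrightarrow> a * (x * (1 - x)) < y \<and> y < b * (x * (1 - x))"
proof -
  define s where "s = x * (1 - x)"
  have s: "s > 0" using assms by (simp add: s_def)
  have "lstep a b x y \<longleftrightarrow> (\<exists>t. a < t \<and> t < b \<and> y = t * s)"
    by (simp add: lstep_def s_def mult.assoc)
  also have "\<dots> \<longleftrightarrow> a < y / s \<and> y / s < b"
  proof
    assume "a < y / s \<and> y / s < b"
    then show "\<exists>t. a < t \<and> t < b \<and> y = t * s" using s by (intro exI[of _ "y / s"]) auto
  qed (use s in auto)
  also have "\<dots> \<longleftrightarrow> a * s < y \<and> y < b * s" using s by (simp add: pos_less_divide_eq pos_divide_less_eq)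
  finally show ?thesis by (simp add: s_def)
qed

lemma mult_one_minus_le_quarter: "x * (1 - x) \<le> 1 / (4::real)"
  using zero_le_power2[of "x - 1/2"] by (simp add: power2_eq_square algebra_simps)

text \<open>From above, a step never exceeds \<open>b / 4 < 1\<close>. From below, the first step
  ends above \<open>x * (1 - x)\<close>, and afterwards \<open>y \<ge> d\<close> persists because
  \<open>a * (1 - d) \<ge> 1\<close>. These three requirements are the entries of the minimum that
  defines \<open>d\<close>.\<close>

lemma lstep_reach_bounds:
  assumes ab: "1 < a" "a < b" "b < 4" and x: "0 < x" "x < (1::real)"
  obtains d where "0 < d" "\<And>y. (lstep a b)\<^sup>+\<^sup>+ x y \<Longrightarrow> y \<in> {d..1-d}"
proof -
  define d where "d = Min {x * (1 - x), 1 - b / 4, 1 - 1 / a}"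
  have d: "d \<le> x * (1 - x)" "d \<le> 1 - b / 4" "d \<le> 1 - 1 / a" by (auto simp: d_def)
  have d0: "0 < d" using ab x by (auto simp: d_def)
  have up: "t * y * (1 - y) \<le> 1 - d" if "t < b" "0 < t" for t y :: real
  proof -
    have "t * (y * (1 - y)) \<le> t * (1 / 4)" using mult_one_minus_le_quarter that by (intro mult_left_mono) auto
    also have "\<dots> \<le> b / 4" using that by simp
    also have "\<dots> \<le> 1 - d" using d by simp
    finally show ?thesis by (simp only: mult.assoc)
  qed
  have "y \<in> {d..1-d}" if "(lstep a b)\<^sup>+\<^sup>+ x y" for y
    using that
  proof (induction rule: tranclp_induct)
    case (base y)
    then obtain t where t: "a < t" "t < b" "y = t * x * (1 - x)" by (auto simp: lstep_def)
    have "1 * (x * (1 - x)) \<le> t * (x * (1 - x))" using t ab x by (intro mult_right_mono) auto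
    then show ?case using t d up[of t x] ab by (auto simp: mult.assoc)
  next
    case (step y w)
    then obtain t where t: "a < t" "t < b" "w = t * y * (1 - y)" by (auto simp: lstep_def)
    have "0 \<le> (y - d) * (1 - d - y)" using step.IH by (intro mult_nonneg_nonneg) auto
    then have dy: "d * (1 - d) \<le> y * (1 - y)" by (simp add: algebra_simps)
    have "d * 1 \<le> d * (a * (1 - d))"
      using d(3) d0 ab by (intro mult_left_mono) (auto simp: field_simps)
    also have "\<dots> = a * (d * (1 - d))" by (rule mult.left_commute)
    also have "\<dots> \<le> t * (y * (1 - y))"
    proof (rule mult_mono[OF _ dy])
      show "0 \<le> d * (1 - d)" using d0 step.IH by auto
    qed (use t ab in auto)
    finally have "d \<le> t * (y * (1 - y))" by simp
    then show ?case using t up[of t y] ab by (auto simp: mult.assoc)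
  qed
  then show thesis by (rule that[OF d0])
qed

text \<open>Every state can be steered into the critical orbit of one fixed map, hence exactly onto each
  accumulation point of that orbit.\<close>

lemma lstep_hub:
  assumes ab: "1 < a" "a < b" "b < (4::real)"
  obtains q where "0 < q" "q < 1" "\<And>x. 0 < x \<Longrightarrow> x < 1 \<Longrightarrow> (lstep a b)\<^sup>+\<^sup>+ x q"
proof -
  define \<theta> where "\<theta> = (a + b) / 2"
  have th: "0 < a" "a < \<theta>" "\<theta> < b" using ab by (auto simp: \<theta>_def)
  define c where "c n = (lmap \<theta> ^^ n) (1/2)" for n
  have cstep: "lstep a b (c n) (c (Suc n))" for n
    using th unfolding lstep_def by (intro exI[of _ \<theta>]) (simp add: c_def lmap_def)
  have cr: "(lstep a b)\<^sup>+\<^sup>+ (c n) (c (Suc n + k))" for n k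
  proof (induction k)
    case 0 show ?case using tranclp.r_into_trancl[of "lstep a b", OF cstep[of n]] by simp
  next
    case (Suc k) from tranclp.trancl_into_trancl[OF this cstep] show ?case by simp
  qed
  have half: "0 < (1/2::real)" "1/2 < (1::real)" by auto
  obtain d where d: "0 < d" "\<And>y. (lstep a b)\<^sup>+\<^sup>+ (1/2) y \<Longrightarrow> y \<in> {d..1-d}"
    by (rule lstep_reach_bounds[OF ab half]) blast
  have cd: "c (Suc n) \<in> {d..1-d}" for n using cr[of 0 n] by (intro d(2)) (simp add: c_def)
  have "seq_compact {d..1-d}" by (simp add: compact_imp_seq_compact)
  with cd obtain q r where q: "q \<in> {d..1-d}" and r: "strict_mono r" "((\<lambda>n. c (Suc n)) \<circ> r) \<longlonglongrightarrow> q"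
    unfolding seq_compact_def by (metis (no_types, lifting))
  have "(lstep a b)\<^sup>+\<^sup>+ x q" if x: "0 < x" "x < 1" for x
  proof -
    obtain d' where d': "0 < d'" "\<And>y. (lstep a b)\<^sup>+\<^sup>+ x y \<Longrightarrow> y \<in> {d'..1-d'}"
      by (rule lstep_reach_bounds[OF ab x]) blast
    define R where "R = {y. (lstep a b)\<^sup>+\<^sup>+ x y}"
    have Rsub: "R \<subseteq> {d'..1-d'}" using d' by (auto simp: R_def)
    \<comment> \<open>A reached point is interior, since the last parameter can be varied.\<close>
    have "open R"
    proof (subst open_subopen, intro ballI)
      fix y assume "y \<in> R"
      then have "(lstep a b)\<^sup>+\<^sup>+ x y" by (simp add: R_def)
      then have "\<exists>w. lstep a b w y \<and> (w = x \<or> (lstep a b)\<^sup>+\<^sup>+ x w)"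
        by (rule tranclp.cases) blast+
      then obtain w where w: "lstep a b w y" "w = x \<or> (lstep a b)\<^sup>+\<^sup>+ x w" by blast
      then have w01: "0 < w" "w < 1" using x d'(1) d'(2)[of w] by auto
      define I where "I = {a * (w * (1 - w))<..<b * (w * (1 - w))}"
      have "I \<subseteq> R"
      proof
        fix p assume "p \<in> I"
        then have "lstep a b w p" using lstep_iff[OF w01, of a b] by (simp add: I_def)
        with w(2) have "(lstep a b)\<^sup>+\<^sup>+ x p"
          by (metis tranclp.r_into_trancl tranclp.trancl_into_trancl)
        then show "p \<in> R" by (simp add: R_def)
      qed
      moreover have "y \<in> I" using w(1) lstep_iff[OF w01, of a b] by (auto simp: I_def)
      ultimately show "\<exists>T. open T \<and> y \<in> T \<and> T \<subseteq> R" by (intro exI[of _ I]) (auto simp: I_def)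
    qed
    moreover have "lstep a b x (\<theta> * x * (1 - x))" using th by (auto simp: lstep_def)
    then have "\<theta> * x * (1 - x) \<in> R" by (simp add: R_def tranclp.r_into_trancl)
    moreover have "t * y * (1 - y) \<in> R" if "y \<in> R" "a < t" "t < b" for y t
    proof -
      have "lstep a b y (t * y * (1 - y))" using that(2,3) by (auto simp: lstep_def)
      with that(1) show ?thesis unfolding R_def by (simp add: tranclp.trancl_into_trancl)
    qed
    ultimately have "\<exists>n. (lmap \<theta> ^^ n) (1/2) \<in> R"
      by (rule critical_orbit_enters[OF _ Rsub d'(1) _ _ th])
    then obtain n where n: "c n \<in> R" by (auto simp: c_def)
    \<comment> \<open>The margin within which a change of the last parameter alone replaces the
      target \<open>c (Suc k)\<close> by \<open>q\<close>.\<close>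
    define l where "l = min (\<theta> - a) (b - \<theta>) * (d * d)"
    have "l > 0" using th d by (simp add: l_def)
    then obtain N where N: "\<And>k. k \<ge> N \<Longrightarrow> \<bar>c (Suc (r k)) - q\<bar> < l"
      using LIMSEQ_D[OF r(2)] by auto
    \<comment> \<open>Large enough that \<open>k > n\<close>, so \<open>c k\<close> is reached after
      \<open>c n\<close>, and that \<open>c (Suc k)\<close> is within \<open>l\<close> of
      \<open>q\<close>.\<close>
    define k where "k = r (N + n + 2)"
    have "N + n + 2 \<le> k" unfolding k_def by (rule strict_mono_imp_increasing[OF r(1)])
    then have j: "Suc n + Suc (k - n - 2) = k" by simp
    have "(lstep a b)\<^sup>+\<^sup>+ x (c n)" using n by (simp only: R_def mem_Collect_eq)
    with cr[of n "Suc (k - n - 2)", unfolded j] have reach: "(lstep a b)\<^sup>+\<^sup>+ x (c k)" by simp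
    have ck: "c k \<in> {d..1-d}" using cd[of "k - 1"] \<open>N + n + 2 \<le> k\<close> by simp
    then have s: "d * d \<le> c k * (1 - c k)" using d by (intro mult_mono) auto
    have "l \<le> (\<theta> - a) * (c k * (1 - c k))" "l \<le> (b - \<theta>) * (c k * (1 - c k))"
      unfolding l_def using s th d by (auto intro!: mult_mono)
    moreover have "c (Suc k) = \<theta> * (c k * (1 - c k))" by (simp add: c_def lmap_def)
    moreover have "\<bar>c (Suc k) - q\<bar> < l" unfolding k_def by (rule N) simp
    ultimately have "lstep a b (c k) q"
      using lstep_iff[of "c k" a b q] ck d(1) by (auto simp: algebra_simps)
    with reach show ?thesis by (rule tranclp.trancl_into_trancl)
  qed
  then show thesis using q d(1) by (intro that[of q]) auto
qed

section \<open>Markov operators and the Liouville property\<close>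

definition bounded_measurable :: "'a measure \<Rightarrow> ('a \<Rightarrow> real) \<Rightarrow> bool" where
  "bounded_measurable S f \<longleftrightarrow> f \<in> borel_measurable S \<and> (\<exists>c. \<forall>x\<in>space S. \<bar>f x\<bar> \<le> c)"

lemma bounded_measurableI:
  "f \<in> borel_measurable S \<Longrightarrow> (\<And>x. x \<in> space S \<Longrightarrow> \<bar>f x\<bar> \<le> c) \<Longrightarrow> bounded_measurable S f"
  by (auto simp: bounded_measurable_def)

lemma bounded_measurableD: "bounded_measurable S f \<Longrightarrow> f \<in> borel_measurable S"
  by (simp add: bounded_measurable_def)

lemma bounded_measurable_const [simp]: "bounded_measurable S (\<lambda>_. c)"
  by (rule bounded_measurableI[of _ _ "\<bar>c\<bar>"]) auto

lemma bounded_measurable_indicator: "A \<in> sets S \<Longrightarrow> bounded_measurable S (indicator A)"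
  by (rule bounded_measurableI[of _ _ 1]) (auto simp: indicator_def)

lemma bounded_measurable_add:
  assumes "bounded_measurable S f" "bounded_measurable S g"
  shows "bounded_measurable S (\<lambda>x. f x + g x)"
proof -
  obtain c d where "\<forall>x\<in>space S. \<bar>f x\<bar> \<le> c" "\<forall>x\<in>space S. \<bar>g x\<bar> \<le> d"
    using assms by (auto simp: bounded_measurable_def)
  then show ?thesis using assms
    by (intro bounded_measurableI[of _ _ "c + d"])
       (auto simp: bounded_measurable_def intro: order_trans[OF abs_triangle_ineq add_mono])
qed

lemma bounded_measurable_mult:
  assumes "bounded_measurable S f" "bounded_measurable S g"
  shows "bounded_measurable S (\<lambda>x. f x * g x)"
proof -
  obtain c d where cd: "\<forall>x\<in>space S. \<bar>f x\<bar> \<le> c" "\<forall>x\<in>space S. \<bar>g x\<bar> \<le> d"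
    using assms by (auto simp: bounded_measurable_def)
  have "\<bar>f x * g x\<bar> \<le> c * d" if "x \<in> space S" for x
    unfolding abs_mult using cd that by (intro mult_mono) (auto intro: order_trans[OF abs_ge_zero])
  then show ?thesis using assms
    by (intro bounded_measurableI[of _ _ "c * d"]) (auto simp: bounded_measurable_def)
qed

lemma bounded_measurable_cmult:
  "bounded_measurable S f \<Longrightarrow> bounded_measurable S (\<lambda>x. c * f x)"
  by (intro bounded_measurable_mult) auto

lemma bounded_measurable_diff:
  "bounded_measurable S f \<Longrightarrow> bounded_measurable S g \<Longrightarrow> bounded_measurable S (\<lambda>x. f x - g x)"
  using bounded_measurable_add[of S f "\<lambda>x. -1 * g x"] bounded_measurable_cmult[of S g "-1"] by simp

lemma bounded_measurable_sum:
  "(\<And>i. i \<in> I \<Longrightarrow> bounded_measurable S (f i)) \<Longrightarrow> bounded_measurable S (\<lambda>x. \<Sum>i\<in>I. f i x)"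
  by (induction I rule: infinite_finite_induct) (auto intro: bounded_measurable_add)

lemma bounded_measurable_max:
  assumes "bounded_measurable S f"
  shows "bounded_measurable S (\<lambda>x. max 0 (f x))"
proof -
  obtain c where "\<forall>x\<in>space S. \<bar>f x\<bar> \<le> c" using assms by (auto simp: bounded_measurable_def)
  then show ?thesis using assms
    by (intro bounded_measurableI[of _ _ c]) (auto simp: bounded_measurable_def max_def)
qed

lemma integrable_bounded_measurable:
  assumes "bounded_measurable S f" "prob_space \<mu>" "sets \<mu> = sets S"
  shows "integrable \<mu> f"
proof -
  interpret prob_space \<mu> by fact
  obtain c where "\<forall>x\<in>space S. \<bar>f x\<bar> \<le> c" using assms(1) by (auto simp: bounded_measurable_def)
  then show ?thesis using assms(1) sets_eq_imp_space_eq[OF assms(3)]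
    by (intro integrable_const_bound[of _ c])
       (auto simp: bounded_measurable_def measurable_cong_sets[OF assms(3) refl])
qed

lemma integral_mono_bounded_measurable:
  assumes "bounded_measurable S f" "bounded_measurable S g" "prob_space \<mu>" "sets \<mu> = sets S"
    and "\<And>x. x \<in> space S \<Longrightarrow> f x \<le> g x"
  shows "(\<integral>x. f x \<partial>\<mu>) \<le> (\<integral>x. g x \<partial>\<mu>)"
  using assms sets_eq_imp_space_eq[OF assms(4)]
  by (intro integral_mono integrable_bounded_measurable[of S]) auto

lemma integral_tendsto_0:
  assumes f: "\<And>N. f N \<in> borel_measurable S" "\<And>N x. x \<in> space S \<Longrightarrow> \<bar>f N x\<bar> \<le> c"
    and lim: "\<And>x. x \<in> space S \<Longrightarrow> (\<lambda>N. f N x) \<longlonglongrightarrow> (0::real)"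
    and \<mu>: "prob_space \<mu>" "sets \<mu> = sets S"
  shows "(\<lambda>N. \<integral>x. f N x \<partial>\<mu>) \<longlonglongrightarrow> 0"
proof -
  interpret prob_space \<mu> by fact
  have "(\<lambda>N. \<integral>x. f N x \<partial>\<mu>) \<longlonglongrightarrow> (\<integral>x. 0 \<partial>\<mu>)"
    using f lim sets_eq_imp_space_eq[OF \<mu>(2)] \<mu>(2)
    by (intro integral_dominated_convergence[where w = "\<lambda>_. c"])
       (auto simp: measurable_cong_sets[OF \<mu>(2) refl])
  then show ?thesis by simp
qed

text \<open>The inequality on sets is an inequality in the order on measures once \<beta> is
  absorbed by \<open>scale_measure\<close>; it then passes to integrals of nonnegative
  functions.\<close>

lemma integral_le_of_measure_le:
  assumes \<mu>: "prob_space \<mu>" "sets \<mu> = sets S" and \<phi>: "prob_space \<phi>" "sets \<phi> = sets S"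
    and le: "\<And>B. B \<in> sets S \<Longrightarrow> \<beta> * measure \<phi> B \<le> measure \<mu> B" and "\<beta> \<ge> 0"
    and f: "bounded_measurable S f" "\<And>x. x \<in> space S \<Longrightarrow> 0 \<le> f x"
  shows "\<beta> * (\<integral>x. f x \<partial>\<phi>) \<le> (\<integral>x. f x \<partial>\<mu>)"
proof -
  interpret \<mu>: prob_space \<mu> by fact
  interpret \<phi>: prob_space \<phi> by fact
  have fm: "f \<in> borel_measurable \<phi>" "f \<in> borel_measurable \<mu>"
    using f \<mu> \<phi> by (simp_all add: bounded_measurable_def measurable_cong_sets[OF \<mu>(2) refl] measurable_cong_sets[OF \<phi>(2) refl])
  have sp: "space \<mu> = space S" "space \<phi> = space S" using sets_eq_imp_space_eq[OF \<mu>(2)] sets_eq_imp_space_eq[OF \<phi>(2)] by auto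
  have "scale_measure (ennreal \<beta>) \<phi> \<le> \<mu>"
  proof (intro le_measure[THEN iffD2] ballI)
    fix B assume "B \<in> sets (scale_measure (ennreal \<beta>) \<phi>)"
    then have "B \<in> sets S" using \<phi> by simp
    from le[OF this] show "emeasure (scale_measure (ennreal \<beta>) \<phi>) B \<le> emeasure \<mu> B"
      using \<open>\<beta> \<ge> 0\<close> by (simp add: \<mu>.emeasure_eq_measure \<phi>.emeasure_eq_measure flip: ennreal_mult)
  qed (use \<mu> \<phi> in simp)
  then have "(\<integral>\<^sup>+x. f x \<partial>scale_measure (ennreal \<beta>) \<phi>) \<le> (\<integral>\<^sup>+x. f x \<partial>\<mu>)"
    using \<mu> \<phi> by (intro nn_integral_mono_measure) auto
  then have "ennreal \<beta> * (\<integral>\<^sup>+x. f x \<partial>\<phi>) \<le> (\<integral>\<^sup>+x. f x \<partial>\<mu>)"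
    using fm by (simp add: nn_integral_scale_measure)
  moreover have "(\<integral>\<^sup>+x. f x \<partial>\<phi>) = ennreal (\<integral>x. f x \<partial>\<phi>)"
    using f integrable_bounded_measurable[OF f(1) \<phi>] sp by (intro nn_integral_eq_integral) auto
  moreover have "(\<integral>\<^sup>+x. f x \<partial>\<mu>) = ennreal (\<integral>x. f x \<partial>\<mu>)"
    using f integrable_bounded_measurable[OF f(1) \<mu>] sp by (intro nn_integral_eq_integral) auto
  moreover have "0 \<le> (\<integral>x. f x \<partial>\<phi>)" "0 \<le> (\<integral>x. f x \<partial>\<mu>)"
    using f sp by (auto intro!: Bochner_Integration.integral_nonneg_AE)
  ultimately show ?thesis using \<open>\<beta> \<ge> 0\<close> by (simp flip: ennreal_mult)
qed

section \<open>The transition operator\<close>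

locale markov_kernel =
  fixes S :: "'a measure" and P :: "'a \<Rightarrow> 'a measure"
  assumes P_measurable: "P \<in> measurable S (prob_algebra S)"
begin

lemma prob_space_P: "x \<in> space S \<Longrightarrow> prob_space (P x)"
  and sets_P: "x \<in> space S \<Longrightarrow> sets (P x) = sets S"
  using measurable_space[OF P_measurable] by (auto simp: space_prob_algebra)

lemma prob_space_nstep: "x \<in> space S \<Longrightarrow> prob_space (nstep S P n x)"
  and sets_nstep: "x \<in> space S \<Longrightarrow> sets (nstep S P n x) = sets S"
  using measurable_space[OF nstep_measurable[OF P_measurable]] by (auto simp: space_prob_algebra)

definition pop :: "('a \<Rightarrow> real) \<Rightarrow> 'a \<Rightarrow> real" where
  "pop f x = (\<integral>y. f y \<partial>P x)"

lemma pop_bounds: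
  assumes "f \<in> borel_measurable S" "\<And>x. x \<in> space S \<Longrightarrow> c \<le> f x \<and> f x \<le> d" "x \<in> space S"
  shows "c \<le> pop f x \<and> pop f x \<le> d"
proof -
  interpret prob_space "P x" by (rule prob_space_P[OF assms(3)])
  have b: "bounded_measurable S f"
    using assms(2) by (intro bounded_measurableI[OF assms(1), of "max \<bar>c\<bar> \<bar>d\<bar>"]) fastforce
  have sp: "space (P x) = space S" using sets_P[OF assms(3)] by (rule sets_eq_imp_space_eq)
  have "integrable (P x) f"
    by (rule integrable_bounded_measurable[OF b prob_space_P sets_P]) fact+
  then show ?thesis unfolding pop_def
    using integral_ge_const[of f c] integral_le_const[of f d] assms(2) sp by auto
qed

lemma bounded_measurable_pop:
  assumes "bounded_measurable S f" shows "bounded_measurable S (pop f)"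
proof -
  have f: "f \<in> borel_measurable S" by (rule bounded_measurableD[OF assms])
  obtain c where c: "\<forall>x\<in>space S. \<bar>f x\<bar> \<le> c" using assms by (auto simp: bounded_measurable_def)
  show ?thesis
  proof (rule bounded_measurableI)
    show "pop f \<in> borel_measurable S"
      using measurable_compose[OF measurable_prob_algebraD[OF P_measurable]
          integral_measurable_subprob_algebra[OF f]] by (simp add: pop_def[abs_def])
    show "\<bar>pop f x\<bar> \<le> c" if "x \<in> space S" for x
    proof -
      have "- c \<le> pop f x \<and> pop f x \<le> c" using c by (intro pop_bounds[OF f _ that]) fastforce
      then show ?thesis by auto
    qed
  qed
qed

lemma bounded_measurable_funpow_pop:
  "bounded_measurable S f \<Longrightarrow> bounded_measurable S ((pop ^^ n) f)"
  by (induction n) (auto intro: bounded_measurable_pop)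

lemma funpow_pop_bounds:
  assumes "bounded_measurable S f" "\<And>x. x \<in> space S \<Longrightarrow> c \<le> f x \<and> f x \<le> d" "x \<in> space S"
  shows "c \<le> (pop ^^ n) f x \<and> (pop ^^ n) f x \<le> d"
  using assms(3)
proof (induction n arbitrary: x)
  case (Suc n)
  then show ?case
    using pop_bounds[OF bounded_measurableD[OF bounded_measurable_funpow_pop[OF assms(1)]], of c n d x]
    by auto
qed (use assms(2) in auto)

text \<open>\<open>nstep\<close> appends the new step at the end, so the kernel meets
  \<open>f\<close> first. The induction therefore runs over all \<open>f\<close>, and
  \<open>funpow_swap1\<close> restores the order.\<close>

lemma integral_nstep:
  assumes "x \<in> space S" "bounded_measurable S f"
  shows "(\<integral>y. f y \<partial>nstep S P n x) = (pop ^^ n) f x"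
  using assms(2)
proof (induction n arbitrary: f)
  case 0
  then show ?case using assms(1) by (simp add: integral_return bounded_measurable_def)
next
  case (Suc n)
  interpret prob_space "nstep S P n x" by (rule prob_space_nstep[OF assms(1)])
  obtain c where c: "\<forall>x\<in>space S. \<bar>f x\<bar> \<le> c" using Suc.prems by (auto simp: bounded_measurable_def)
  have "(\<integral>y. f y \<partial>nstep S P (Suc n) x) = (\<integral>y. pop f y \<partial>nstep S P n x)"
    unfolding nstep.simps pop_def
  proof (rule integral_bind[where K = S and B' = 1 and B = c])
    show "f \<in> borel_measurable S" using Suc.prems by (simp add: bounded_measurable_def)
    show "P \<in> measurable (nstep S P n x) (subprob_algebra S)"
      using measurable_prob_algebraD[OF P_measurable] sets_nstep[OF assms(1)]
      by (simp cong: measurable_cong_sets)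
    have "emeasure (P y) (space (P y)) \<le> 1" if "y \<in> space (nstep S P n x)" for y
      using that sets_eq_imp_space_eq[OF sets_nstep[OF assms(1)]] prob_space.emeasure_space_1[OF prob_space_P]
      by auto
    then show "AE y in nstep S P n x. emeasure (P y) (space (P y)) \<le> ennreal 1" by auto
  qed (use c in \<open>auto intro: finite_measure_axioms\<close>)
  also have "\<dots> = (pop ^^ n) (pop f) x" by (rule Suc.IH[OF bounded_measurable_pop[OF Suc.prems]])
  also have "\<dots> = (pop ^^ Suc n) f x" by (simp add: funpow_swap1)
  finally show ?case .
qed

lemma measure_nstep:
  assumes "x \<in> space S" "B \<in> sets S"
  shows "measure (nstep S P n x) B = (pop ^^ n) (indicator B) x"
proof -
  interpret prob_space "nstep S P n x" by (rule prob_space_nstep[OF assms(1)])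
  show ?thesis
    using integral_nstep[OF assms(1) bounded_measurable_indicator[OF assms(2)], of n] assms
      sets.Int_space_eq2[of B "nstep S P n x"] sets_nstep[OF assms(1)] by simp
qed

lemma pop_mono:
  assumes "bounded_measurable S f" "bounded_measurable S g" "x \<in> space S"
    and "\<And>y. y \<in> space S \<Longrightarrow> f y \<le> g y"
  shows "pop f x \<le> pop g x"
  unfolding pop_def
  by (rule integral_mono_bounded_measurable[OF assms(1,2) prob_space_P sets_P]) fact+

lemma integrable_P: "bounded_measurable S f \<Longrightarrow> x \<in> space S \<Longrightarrow> integrable (P x) f"
  by (rule integrable_bounded_measurable[OF _ prob_space_P sets_P])

lemma pop_diff:
  assumes "bounded_measurable S f" "bounded_measurable S g" "x \<in> space S"
  shows "pop (\<lambda>y. f y - g y) x = pop f x - pop g x"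
  unfolding pop_def using integrable_P assms by (intro Bochner_Integration.integral_diff) auto

lemma pop_add:
  assumes "bounded_measurable S f" "bounded_measurable S g" "x \<in> space S"
  shows "pop (\<lambda>y. f y + g y) x = pop f x + pop g x"
  unfolding pop_def using integrable_P assms by (intro Bochner_Integration.integral_add) auto

lemma pop_cmult: "pop (\<lambda>y. c * f y) x = c * pop f x"
  by (simp add: pop_def)

lemma pop_const: "x \<in> space S \<Longrightarrow> pop (\<lambda>_. c) x = c"
  using prob_space.prob_space[OF prob_space_P] by (simp add: pop_def)

lemma pop_tendsto_0:
  assumes "\<And>N. f N \<in> borel_measurable S" "\<And>N x. x \<in> space S \<Longrightarrow> \<bar>f N x\<bar> \<le> c"
    and "\<And>x. x \<in> space S \<Longrightarrow> (\<lambda>N. f N x) \<longlonglongrightarrow> 0" "x \<in> space S"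
  shows "(\<lambda>N. pop (f N) x) \<longlonglongrightarrow> 0"
  unfolding pop_def
  by (rule integral_tendsto_0[OF assms(1,2,3) prob_space_P sets_P]) (use assms(4) in auto)

section \<open>Killing on a set and escape probabilities\<close>

text \<open>The iterate \<open>(taboo K ^^ n) f x\<close> is the expectation of \<open>f\<close> at
  time \<open>n\<close> on the event that \<open>K\<close> is avoided at the times 0 to
  \<open>n - 1\<close>; the position at time \<open>n\<close> itself is unrestricted.\<close>

definition taboo :: "'a set \<Rightarrow> ('a \<Rightarrow> real) \<Rightarrow> 'a \<Rightarrow> real" where
  "taboo K f x = indicator (space S - K) x * pop f x"

text \<open>\<open>esc K n x\<close> is the probability that the chain started in \<open>x\<close> avoids \<open>K\<close> at the times \<open>0, \<dots>, n-1\<close>.\<close>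

definition esc :: "'a set \<Rightarrow> nat \<Rightarrow> 'a \<Rightarrow> real" where
  "esc K n = (taboo K ^^ n) (\<lambda>_. 1)"

lemma esc_0 [simp]: "esc K 0 x = 1"
  by (simp add: esc_def)

lemma esc_Suc: "esc K (Suc n) = taboo K (esc K n)"
  by (simp add: esc_def)

lemma bounded_measurable_taboo:
  "K \<in> sets S \<Longrightarrow> bounded_measurable S f \<Longrightarrow> bounded_measurable S (taboo K f)"
  unfolding taboo_def[abs_def]
  by (intro bounded_measurable_mult bounded_measurable_indicator bounded_measurable_pop) auto

lemma bounded_measurable_funpow_taboo:
  "K \<in> sets S \<Longrightarrow> bounded_measurable S f \<Longrightarrow> bounded_measurable S ((taboo K ^^ n) f)"
  by (induction n) (auto intro: bounded_measurable_taboo)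

lemma bounded_measurable_esc: "K \<in> sets S \<Longrightarrow> bounded_measurable S (esc K n)"
  unfolding esc_def by (rule bounded_measurable_funpow_taboo) auto

lemma taboo_mono:
  assumes "bounded_measurable S f" "bounded_measurable S g" "x \<in> space S"
    and "\<And>y. y \<in> space S \<Longrightarrow> f y \<le> g y"
  shows "taboo K f x \<le> taboo K g x"
  using pop_mono[OF assms] by (auto simp: taboo_def indicator_def)

lemma funpow_taboo_mono:
  assumes "K \<in> sets S" "bounded_measurable S f" "bounded_measurable S g"
    and "\<And>y. y \<in> space S \<Longrightarrow> f y \<le> g y" "x \<in> space S"
  shows "(taboo K ^^ n) f x \<le> (taboo K ^^ n) g x"
  using assms(5)
proof (induction n arbitrary: x)
  case (Suc n)
  then show ?case
    using taboo_mono[OF bounded_measurable_funpow_taboo[OF assms(1,2)]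
        bounded_measurable_funpow_taboo[OF assms(1,3)], of x n n K] by simp
qed (use assms(4) in simp)

text \<open>Linearity in a form that serves both sums, with \<open>c = - 1\<close>, and bounds such
  as \<open>1 - p * g\<close>.\<close>

lemma funpow_taboo_diff:
  assumes "K \<in> sets S" "bounded_measurable S f" "bounded_measurable S g" "x \<in> space S"
  shows "(taboo K ^^ n) (\<lambda>y. f y - c * g y) x = (taboo K ^^ n) f x - c * (taboo K ^^ n) g x"
  using assms(4)
proof (induction n arbitrary: x)
  case (Suc n)
  have bm: "bounded_measurable S ((taboo K ^^ n) f)" "bounded_measurable S (\<lambda>y. c * (taboo K ^^ n) g y)"
    using assms by (auto intro: bounded_measurable_funpow_taboo bounded_measurable_cmult)
  have sp: "space (P x) = space S" by (rule sets_eq_imp_space_eq[OF sets_P[OF Suc.prems]])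
  have "pop ((taboo K ^^ n) (\<lambda>y. f y - c * g y)) x
      = pop (\<lambda>y. (taboo K ^^ n) f y - c * (taboo K ^^ n) g y) x"
    unfolding pop_def by (rule Bochner_Integration.integral_cong) (use Suc.IH sp in auto)
  also have "\<dots> = pop ((taboo K ^^ n) f) x - c * pop ((taboo K ^^ n) g) x"
    using pop_diff[OF bm Suc.prems] by (simp add: pop_cmult)
  finally show ?case
    by (simp only: funpow.simps comp_apply taboo_def[of K _ x]) (simp add: algebra_simps)
qed simp

lemma esc_range:
  assumes "K \<in> sets S" "x \<in> space S" shows "0 \<le> esc K n x \<and> esc K n x \<le> 1"
  using assms(2)
proof (induction n arbitrary: x)
  case (Suc n)
  have "0 \<le> pop (esc K n) x \<and> pop (esc K n) x \<le> 1"
    using bounded_measurableD[OF bounded_measurable_esc[OF assms(1)]] Suc by (intro pop_bounds) auto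
  then show ?case by (auto simp: esc_Suc taboo_def indicator_def)
qed simp

lemma esc_add: "esc K (m + n) = (taboo K ^^ m) (esc K n)"
  by (simp add: esc_def funpow_add)

lemma esc_decseq:
  assumes "K \<in> sets S" "x \<in> space S" shows "decseq (\<lambda>n. esc K n x)"
proof (rule decseq_SucI)
  fix n
  have "(taboo K ^^ n) (esc K 1) x \<le> (taboo K ^^ n) (\<lambda>_. 1) x"
    using assms by (intro funpow_taboo_mono) (auto simp: esc_range intro: bounded_measurable_esc)
  then show "esc K (Suc n) x \<le> esc K n x"
    using esc_add[of K n 1] by (simp add: esc_def)
qed

lemma esc_in: "x \<in> K \<Longrightarrow> esc K (Suc n) x = 0"
  by (simp add: esc_Suc taboo_def)

text \<open>Writing Q for \<open>pop\<close>: b - Q^(n+1) b = (b - Q b) + Q (b - Q^n b). The last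
  term tends to 0 by dominated convergence, so pointwise limits with a common bound are
  enough.\<close>

lemma almost_harmonic_funpow:
  assumes b: "\<And>N. bounded_measurable S (b N)" "\<And>N x. x \<in> space S \<Longrightarrow> \<bar>b N x\<bar> \<le> 1"
    and harm: "\<And>x. x \<in> space S \<Longrightarrow> (\<lambda>N. b N x - pop (b N) x) \<longlonglongrightarrow> 0"
    and x: "x \<in> space S"
  shows "(\<lambda>N. b N x - (pop ^^ n) (b N) x) \<longlonglongrightarrow> 0"
  using x
proof (induction n arbitrary: x)
  case (Suc n)
  have bm: "bounded_measurable S ((pop ^^ n) (b N))" for N
    by (rule bounded_measurable_funpow_pop[OF b(1)])
  have le1: "\<bar>(pop ^^ n) (b N) y\<bar> \<le> 1" if "y \<in> space S" for N y
    using funpow_pop_bounds[OF b(1)[of N], where c = "- 1" and d = 1 and x = y and n = n] b(2) that by (auto simp: abs_le_iff)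
  then have le2: "\<bar>b N y - (pop ^^ n) (b N) y\<bar> \<le> 2" if "y \<in> space S" for N y
    using b(2)[OF that, of N] le1[OF that, of N] by linarith
  have "(\<lambda>N. pop (\<lambda>y. b N y - (pop ^^ n) (b N) y) x) \<longlonglongrightarrow> 0"
    by (rule pop_tendsto_0[where c = 2])
       (use Suc le2 bounded_measurableD[OF bounded_measurable_diff[OF b(1) bm]] in auto)
  from tendsto_add[OF harm[OF Suc.prems] this] show ?case
    by (simp add: pop_diff[OF b(1) bm Suc.prems])
qed simp

text \<open>If \<open>c\<close> is an asymptotic upper bound, then minorization improves it to \<open>(1 - \<beta>) * c\<close> on \<open>K\<close>,
  and hence, by induction on \<open>n\<close>, to \<open>(1 - \<beta>) * c + \<beta> * c * esc K n x\<close> everywhere.\<close>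

lemma almost_harmonic_upper:
  fixes b :: "nat \<Rightarrow> 'a \<Rightarrow> real"
  assumes \<phi>: "prob_space \<phi>" "sets \<phi> = sets S"
    and K: "K \<in> sets S" and \<beta>: "0 < \<beta>" "\<beta> \<le> 1"
    and minor: "\<And>x. x \<in> K \<Longrightarrow> \<exists>n. \<forall>B\<in>sets S. \<beta> * measure \<phi> B \<le> measure (nstep S P n x) B"
    and rec: "\<And>x. x \<in> space S \<Longrightarrow> (\<lambda>n. esc K n x) \<longlonglongrightarrow> 0"
    and b: "\<And>N. bounded_measurable S (b N)" "\<And>N x. x \<in> space S \<Longrightarrow> \<bar>b N x\<bar> \<le> 1"
    and b0: "\<And>N. (\<integral>x. b N x \<partial>\<phi>) = 0"
    and harm: "\<And>x. x \<in> space S \<Longrightarrow> (\<lambda>N. b N x - pop (b N) x) \<longlonglongrightarrow> 0"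
    and x: "x \<in> space S"
  shows "(\<lambda>N. max 0 (b N x)) \<longlonglongrightarrow> 0"
proof -
  \<comment> \<open>That is, the limsup of \<open>b N x\<close> over \<open>N\<close> is at most
    \<open>u x\<close>. No uniformity in \<open>x\<close> is claimed; dominated convergence in
    \<open>int0\<close> makes up for it.\<close>
  define AB where "AB u x \<longleftrightarrow> (\<lambda>N. max 0 (b N x - u x)) \<longlonglongrightarrow> 0" for u :: "'a \<Rightarrow> real" and x
  have int0: "(\<lambda>N. \<integral>y. max 0 (b N y - u y) \<partial>\<mu>) \<longlonglongrightarrow> 0"
    if u: "bounded_measurable S u" and AB: "\<And>x. x \<in> space S \<Longrightarrow> AB u x"
      and \<mu>: "prob_space \<mu>" "sets \<mu> = sets S" for u \<mu>
  proof -
    obtain c where c: "\<And>x. x \<in> space S \<Longrightarrow> \<bar>u x\<bar> \<le> c" using u by (auto simp: bounded_measurable_def)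
    have "\<bar>max 0 (b N y - u y)\<bar> \<le> 1 + c" if "y \<in> space S" for N y
      using b(2)[OF that, of N] c[OF that] by (simp add: max_def abs_le_iff)
    then show ?thesis using AB
      by (intro integral_tendsto_0[OF _ _ _ \<mu>, where c = "1 + c"])
         (auto simp: AB_def intro: bounded_measurableD[OF bounded_measurable_max[OF bounded_measurable_diff[OF b(1) u]]])
  qed
  have AB_pop: "AB (pop u) x"
    if u: "bounded_measurable S u" and AB: "\<And>x. x \<in> space S \<Longrightarrow> AB u x" and x: "x \<in> space S" for u x
    unfolding AB_def
  proof (rule tendsto_sandwich[where f = "\<lambda>_. 0"])
    have "b N x - pop u x \<le> \<bar>b N x - pop (b N) x\<bar> + (\<integral>y. max 0 (b N y - u y) \<partial>P x)" for N
    proof -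
      have "pop (\<lambda>y. b N y - u y) x \<le> pop (\<lambda>y. max 0 (b N y - u y)) x"
        by (intro pop_mono bounded_measurable_max bounded_measurable_diff b(1) u x) auto
      then show ?thesis using pop_diff[OF b(1) u x, of N] by (simp add: pop_def)
    qed
    moreover have "0 \<le> (\<integral>y. max 0 (b N y - u y) \<partial>P x)" for N by simp
    ultimately show "eventually (\<lambda>N. max 0 (b N x - pop u x)
        \<le> \<bar>b N x - pop (b N) x\<bar> + (\<integral>y. max 0 (b N y - u y) \<partial>P x)) sequentially"
      by (intro always_eventually allI) (simp add: max_def add_nonneg_nonneg)
    show "(\<lambda>N. \<bar>b N x - pop (b N) x\<bar> + (\<integral>y. max 0 (b N y - u y) \<partial>P x)) \<longlonglongrightarrow> 0"
      using tendsto_add[OF tendsto_rabs_zero[OF harm[OF x]] int0[OF u AB prob_space_P[OF x] sets_P[OF x]]]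
      by simp
  qed (auto intro: always_eventually)
  \<comment> \<open>As \<open>b N\<close> has \<phi>-mean 0, \<open>c - b N\<close> has \<phi>-mean
    \<open>c\<close>. By minorization at least \<beta> times that mean is seen from \<open>x\<close>
    after \<open>n\<close> steps, so \<open>b N x\<close> stays below \<open>c\<close> by
    \<open>\<beta> * c\<close>, up to the vanishing mean excess of \<open>b N\<close> over
    \<open>c\<close>.\<close>
  have AB_K: "AB (\<lambda>_. (1 - \<beta>) * c) x" if "x \<in> K" "0 \<le> c" and AB: "\<And>x. x \<in> space S \<Longrightarrow> AB (\<lambda>_. c) x" for c x
  proof -
    have x: "x \<in> space S" using that K sets.sets_into_space by blast
    obtain n where n: "\<And>B. B \<in> sets S \<Longrightarrow> \<beta> * measure \<phi> B \<le> measure (nstep S P n x) B"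
      using minor[OF \<open>x \<in> K\<close>] by blast
    let ?\<mu> = "nstep S P n x"
    note \<mu> = prob_space_nstep[OF x, of n] sets_nstep[OF x, of n]
    have "b N x - (1 - \<beta>) * c \<le> \<bar>b N x - (pop ^^ n) (b N) x\<bar> + (\<integral>y. max 0 (b N y - c) \<partial>?\<mu>)" for N
    proof -
      have bm: "bounded_measurable S (\<lambda>y. max 0 (c - b N y))" "bounded_measurable S (\<lambda>y. max 0 (b N y - c))"
        "bounded_measurable S (\<lambda>y. c - b N y)"
        by (intro bounded_measurable_max bounded_measurable_diff b(1) bounded_measurable_const)+
      have "\<beta> * c = \<beta> * (\<integral>y. c - b N y \<partial>\<phi>)"
        using integrable_bounded_measurable[OF b(1) \<phi>] b0 prob_space.prob_space[OF \<phi>(1)]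
          finite_measure.integrable_const[OF prob_space.finite_measure[OF \<phi>(1)]]
        by (subst Bochner_Integration.integral_diff) auto
      also have "\<dots> \<le> \<beta> * (\<integral>y. max 0 (c - b N y) \<partial>\<phi>)"
        using \<beta> by (intro mult_left_mono integral_mono_bounded_measurable[OF bm(3,1) \<phi>]) auto
      also have "\<dots> \<le> (\<integral>y. max 0 (c - b N y) \<partial>?\<mu>)"
        using \<beta> by (intro integral_le_of_measure_le[OF \<mu> \<phi> n _ bm(1)]) auto
      also have "\<dots> = (\<integral>y. (c - b N y) + max 0 (b N y - c) \<partial>?\<mu>)"
        by (intro Bochner_Integration.integral_cong) auto
      also have "\<dots> = (\<integral>y. c - b N y \<partial>?\<mu>) + (\<integral>y. max 0 (b N y - c) \<partial>?\<mu>)"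
        by (intro Bochner_Integration.integral_add integrable_bounded_measurable[OF _ \<mu>] bm)
      also have "(\<integral>y. c - b N y \<partial>?\<mu>) = c - (pop ^^ n) (b N) x"
        using integrable_bounded_measurable[OF b(1) \<mu>] prob_space.prob_space[OF \<mu>(1)]
          finite_measure.integrable_const[OF prob_space.finite_measure[OF \<mu>(1)]] integral_nstep[OF x b(1)]
        by (subst Bochner_Integration.integral_diff) auto
      finally show ?thesis by (simp add: algebra_simps abs_if)
    qed
    note le = this
    show ?thesis unfolding AB_def
    proof (rule tendsto_sandwich[where f = "\<lambda>_. 0"])
      have nn: "0 \<le> (\<integral>y. max 0 (b N y - c) \<partial>?\<mu>)" for N by simp
      show "eventually (\<lambda>N. max 0 (b N x - (1 - \<beta>) * c)
        \<le> \<bar>b N x - (pop ^^ n) (b N) x\<bar> + (\<integral>y. max 0 (b N y - c) \<partial>?\<mu>)) sequentially"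
        using le nn by (intro always_eventually allI max.boundedI) (auto intro: add_nonneg_nonneg)
      show "(\<lambda>N. \<bar>b N x - (pop ^^ n) (b N) x\<bar> + (\<integral>y. max 0 (b N y - c) \<partial>?\<mu>)) \<longlonglongrightarrow> 0"
        using tendsto_add[OF tendsto_rabs_zero[OF almost_harmonic_funpow[OF b harm x, of n]]
            int0[OF bounded_measurable_const AB \<mu>]] by simp
    qed (auto intro: always_eventually)
  qed
  have step: "AB (\<lambda>_. (1 - \<beta>) * c) x" if c: "0 \<le> c" and AB: "\<And>x. x \<in> space S \<Longrightarrow> AB (\<lambda>_. c) x"
    and x: "x \<in> space S" for c x
  proof -
    \<comment> \<open>The bound is \<open>(1 - \<beta>) * c\<close> if \<open>K\<close> is met
      before time \<open>n\<close> and \<open>c\<close> if not, weighted by the probabilities of the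
      two events.\<close>
    have ABn: "AB (\<lambda>x. (1 - \<beta>) * c + \<beta> * c * esc K n x) y" if "y \<in> space S" for n y
      using that
    proof (induction n arbitrary: y)
      case 0
      then show ?case using AB by (simp add: algebra_simps)
    next
      case (Suc n)
      show ?case
      proof (cases "y \<in> K")
        case True
        then show ?thesis using AB_K[OF True c AB] by (simp add: AB_def esc_in)
      next
        case False
        have bm: "bounded_measurable S (\<lambda>x. \<beta> * c * esc K n x)"
          by (intro bounded_measurable_cmult bounded_measurable_esc K)
        have "AB (pop (\<lambda>x. (1 - \<beta>) * c + \<beta> * c * esc K n x)) y"
          using Suc by (intro AB_pop bounded_measurable_add bm) auto
        then show ?thesis
          using False Suc.prems pop_add[OF bounded_measurable_const bm Suc.prems]
          by (simp add: AB_def esc_Suc taboo_def pop_cmult pop_const)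
      qed
    qed
    show ?thesis unfolding AB_def
    proof (rule LIMSEQ_I)
      fix e :: real assume e: "0 < e"
      have "(\<lambda>n. \<beta> * c * esc K n x) \<longlonglongrightarrow> \<beta> * c * 0" by (intro tendsto_intros rec x)
      then have "eventually (\<lambda>n. \<beta> * c * esc K n x < e / 2) sequentially"
        using e by (intro order_tendstoD) auto
      then obtain n where n: "\<beta> * c * esc K n x < e / 2" by (auto dest: eventually_happens)
      have "eventually (\<lambda>N. max 0 (b N x - ((1 - \<beta>) * c + \<beta> * c * esc K n x)) < e / 2) sequentially"
        using ABn[OF x, of n] e unfolding AB_def by (intro order_tendstoD) auto
      then obtain N0 where N0: "\<And>N. N \<ge> N0 \<Longrightarrow> max 0 (b N x - ((1 - \<beta>) * c + \<beta> * c * esc K n x)) < e / 2"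
        unfolding eventually_sequentially by blast
      have "norm (max 0 (b N x - (1 - \<beta>) * c) - 0) < e" if "N \<ge> N0" for N
        using n e N0[OF that] unfolding real_norm_def by linarith
      then show "\<exists>no. \<forall>N\<ge>no. norm (max 0 (b N x - (1 - \<beta>) * c) - 0) < e" by blast
    qed
  qed
  have pw: "AB (\<lambda>_. (1 - \<beta>) ^ k) x" if "x \<in> space S" for k x
    using that
  proof (induction k arbitrary: x)
    case 0
    have "max 0 (b N x - 1) = 0" for N using b(2)[OF 0, of N] by linarith
    then show ?case by (simp add: AB_def)
  next
    case (Suc k)
    then show ?case using step[of "(1 - \<beta>) ^ k" x] \<beta> by simp
  qed
  show ?thesis
  proof (rule LIMSEQ_I)
    fix e :: real assume e: "0 < e"
    have "(\<lambda>k. (1 - \<beta>) ^ k) \<longlonglongrightarrow> 0" using \<beta> by (intro LIMSEQ_power_zero) auto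
    then have "eventually (\<lambda>k. (1 - \<beta>) ^ k < e / 2) sequentially" using e by (intro order_tendstoD) auto
    then obtain k where k: "(1 - \<beta>) ^ k < e / 2" by (auto dest: eventually_happens)
    have "eventually (\<lambda>N. max 0 (b N x - (1 - \<beta>) ^ k) < e / 2) sequentially"
      using pw[OF x, of k] e unfolding AB_def by (intro order_tendstoD) auto
    then obtain N0 where N0: "\<And>N. N \<ge> N0 \<Longrightarrow> max 0 (b N x - (1 - \<beta>) ^ k) < e / 2"
      unfolding eventually_sequentially by blast
    have "norm (max 0 (b N x) - 0) < e" if "N \<ge> N0" for N
      using k e N0[OF that] unfolding real_norm_def by linarith
    then show "\<exists>no. \<forall>N\<ge>no. norm (max 0 (b N x) - 0) < e" by blast
  qed
qed

lemma almost_harmonic_tendsto_0: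
  fixes b :: "nat \<Rightarrow> 'a \<Rightarrow> real"
  assumes \<phi>: "prob_space \<phi>" "sets \<phi> = sets S"
    and K: "K \<in> sets S" and \<beta>: "0 < \<beta>" "\<beta> \<le> 1"
    and minor: "\<And>x. x \<in> K \<Longrightarrow> \<exists>n. \<forall>B\<in>sets S. \<beta> * measure \<phi> B \<le> measure (nstep S P n x) B"
    and rec: "\<And>x. x \<in> space S \<Longrightarrow> (\<lambda>n. esc K n x) \<longlonglongrightarrow> 0"
    and b: "\<And>N. bounded_measurable S (b N)" "\<And>N x. x \<in> space S \<Longrightarrow> \<bar>b N x\<bar> \<le> 1"
    and b0: "\<And>N. (\<integral>x. b N x \<partial>\<phi>) = 0"
    and harm: "\<And>x. x \<in> space S \<Longrightarrow> (\<lambda>N. b N x - pop (b N) x) \<longlonglongrightarrow> 0"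
    and x: "x \<in> space S"
  shows "(\<lambda>N. b N x) \<longlonglongrightarrow> 0"
proof -
  have "(\<lambda>N. max 0 (b N x)) \<longlonglongrightarrow> 0"
    by (rule almost_harmonic_upper[OF \<phi> K \<beta> minor rec b b0 harm x])
  moreover have "(\<lambda>N. max 0 (- b N x)) \<longlonglongrightarrow> 0"
  proof (rule almost_harmonic_upper[OF \<phi> K \<beta> minor rec _ _ _ _ x])
    show "bounded_measurable S (\<lambda>x. - b N x)" for N
      using bounded_measurable_cmult[OF b(1), of "-1" N] by simp
    show "(\<lambda>N. - b N x - pop (\<lambda>x. - b N x) x) \<longlonglongrightarrow> 0" if "x \<in> space S" for x
      using tendsto_minus[OF harm[OF that]] pop_cmult[of "-1"] by simp
  qed (use b b0 in auto)
  ultimately have "(\<lambda>N. max 0 (b N x) - max 0 (- b N x)) \<longlonglongrightarrow> 0 - 0" by (rule tendsto_diff)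
  moreover have "max 0 (b N x) - max 0 (- b N x) = b N x" for N by linarith
  ultimately show ?thesis by simp
qed

section \<open>Time averages and invariant probabilities\<close>

text \<open>At \<open>N = 0\<close> the value is 0 by the convention on division, so the bounds 0
  and 1 hold for all \<open>N\<close>.\<close>

definition avg :: "nat \<Rightarrow> ('a \<Rightarrow> real) \<Rightarrow> 'a \<Rightarrow> real" where
  "avg N f x = (\<Sum>n=1..N. (pop ^^ n) f x) / real N"

lemma bounded_measurable_avg:
  "bounded_measurable S f \<Longrightarrow> bounded_measurable S (avg N f)"
  unfolding avg_def[abs_def] divide_inverse mult.commute[of _ "inverse _"]
  by (intro bounded_measurable_cmult bounded_measurable_sum bounded_measurable_funpow_pop)

lemma avg_bounds:
  assumes "bounded_measurable S f" "\<And>x. x \<in> space S \<Longrightarrow> 0 \<le> f x \<and> f x \<le> 1" "x \<in> space S"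
  shows "0 \<le> avg N f x \<and> avg N f x \<le> 1"
proof -
  have r: "0 \<le> (pop ^^ n) f x \<and> (pop ^^ n) f x \<le> 1" for n
    by (rule funpow_pop_bounds[OF assms])
  then have "0 \<le> (\<Sum>n=1..N. (pop ^^ n) f x)" by (intro sum_nonneg) auto
  moreover have "(\<Sum>n=1..N. (pop ^^ n) f x) \<le> real (card {1..N}) * 1"
    using r by (intro sum_bounded_above) auto
  ultimately show ?thesis by (cases "N = 0") (auto simp: avg_def field_simps)
qed

lemma pop_sum:
  assumes "\<And>i. i \<in> I \<Longrightarrow> bounded_measurable S (f i)" "x \<in> space S"
  shows "pop (\<lambda>y. \<Sum>i\<in>I. f i y) x = (\<Sum>i\<in>I. pop (f i) x)"
  unfolding pop_def using integrable_P assms by (intro Bochner_Integration.integral_sum) auto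

text \<open>Telescoping leaves only the first and the last term. The averages of bounded functions
  are thus harmonic up to order 1/N, as the Liouville property requires.\<close>

lemma pop_avg_diff:
  assumes "bounded_measurable S f" "x \<in> space S"
  shows "avg N f x - pop (avg N f) x = ((pop ^^ 1) f x - (pop ^^ Suc N) f x) / real N"
proof -
  have "pop (avg N f) x = inverse (real N) * pop (\<lambda>x. \<Sum>n=1..N. (pop ^^ n) f x) x"
    unfolding pop_cmult[symmetric] avg_def[abs_def] by (simp add: divide_inverse mult.commute)
  also have "\<dots> = (\<Sum>n=1..N. (pop ^^ Suc n) f x) / real N"
    using assms by (subst pop_sum) (auto intro: bounded_measurable_funpow_pop simp: divide_inverse mult.commute)
  finally have "avg N f x - pop (avg N f) x = (\<Sum>n=1..N. (pop ^^ n) f x - (pop ^^ Suc n) f x) / real N"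
    by (simp add: avg_def sum_subtractf diff_divide_distrib del: funpow.simps)
  also have "(\<Sum>n=1..N. (pop ^^ n) f x - (pop ^^ Suc n) f x) = (pop ^^ 1) f x - (pop ^^ Suc N) f x"
    by (induction N) (auto simp del: funpow.simps)
  finally show ?thesis .
qed

lemma measure_cesaro:
  assumes "x \<in> space S" "B \<in> sets S" "N \<ge> 1"
  shows "measure (cesaro S P x N) B = avg N (indicator B) x"
proof -
  have "emeasure (nstep S P n x) B = ennreal ((pop ^^ n) (indicator B) x)" for n
  proof -
    interpret prob_space "nstep S P n x" by (rule prob_space_nstep[OF assms(1)])
    show ?thesis by (simp add: emeasure_eq_measure measure_nstep[OF assms(1,2)])
  qed
  moreover have nn: "0 \<le> (pop ^^ n) (indicator B) x" for n
    using measure_nonneg[of "nstep S P n x" B] by (simp add: measure_nstep[OF assms(1,2)])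
  ultimately have "emeasure (cesaro S P x N) B = ennreal (\<Sum>n=1..N. (pop ^^ n) (indicator B) x) / ennreal (real N)"
    using assms by (simp add: emeasure_cesaro[OF P_measurable] ennreal_of_nat_eq_real_of_nat)
  also have "\<dots> = ennreal (avg N (indicator B) x)"
    using nn assms(3) by (simp add: divide_ennreal sum_nonneg avg_def)
  finally show ?thesis using nn by (simp add: measure_def avg_def sum_nonneg)
qed

text \<open>Invariance on sets says \<open>\<pi> \<bind> P = \<pi>\<close>, and the integral over a
  bind is an iterated integral.\<close>

lemma integral_pop_invariant:
  assumes \<pi>: "invariant_prob S P \<pi>" and f: "bounded_measurable S f"
  shows "(\<integral>x. pop f x \<partial>\<pi>) = (\<integral>x. f x \<partial>\<pi>)"
proof -
  have p: "prob_space \<pi>" and s: "sets \<pi> = sets S" using \<pi> by (auto simp: invariant_prob_def)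
  interpret prob_space \<pi> by (rule p)
  have sp: "space \<pi> = space S" using s by (rule sets_eq_imp_space_eq)
  have Pm: "P \<in> measurable \<pi> (subprob_algebra S)"
    using measurable_prob_algebraD[OF P_measurable] s by (simp cong: measurable_cong_sets)
  have sb: "sets (\<pi> \<bind> P) = sets S"
    by (rule sets_bind) (use sets_P sp not_empty in auto)
  have eq: "\<pi> \<bind> P = \<pi>"
  proof (rule measure_eqI)
    show "sets (\<pi> \<bind> P) = sets \<pi>" using sb s by simp
    fix B assume "B \<in> sets (\<pi> \<bind> P)"
    then have "B \<in> sets S" using sb by simp
    then show "emeasure (\<pi> \<bind> P) B = emeasure \<pi> B"
      using \<pi> emeasure_bind[OF not_empty Pm] by (simp add: invariant_prob_def)
  qed
  obtain c where c: "\<forall>x\<in>space S. \<bar>f x\<bar> \<le> c" using f by (auto simp: bounded_measurable_def)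
  have "(\<integral>x. f x \<partial>(\<pi> \<bind> P)) = (\<integral>x. pop f x \<partial>\<pi>)"
    unfolding pop_def
  proof (rule integral_bind[where K = S and B' = 1 and B = c])
    show "f \<in> borel_measurable S" using f by (rule bounded_measurableD)
    show "P \<in> measurable \<pi> (subprob_algebra S)" by (rule Pm)
    show "AE x in \<pi>. emeasure (P x) (space (P x)) \<le> ennreal 1"
      using prob_space.emeasure_space_1[OF prob_space_P] sp by auto
  qed (use c in \<open>auto intro: finite_measure_axioms\<close>)
  then show ?thesis by (simp add: eq)
qed

lemma integral_avg_invariant:
  assumes \<pi>: "invariant_prob S P \<pi>" and f: "bounded_measurable S f" and "N \<ge> 1"
  shows "(\<integral>x. avg N f x \<partial>\<pi>) = (\<integral>x. f x \<partial>\<pi>)"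
proof -
  have p: "prob_space \<pi>" and s: "sets \<pi> = sets S" using \<pi> by (auto simp: invariant_prob_def)
  have e: "(\<integral>x. (pop ^^ n) f x \<partial>\<pi>) = (\<integral>x. f x \<partial>\<pi>)" for n
    by (induction n) (auto simp: integral_pop_invariant[OF \<pi>] bounded_measurable_funpow_pop f)
  have "(\<integral>x. avg N f x \<partial>\<pi>) = (\<integral>x. (\<Sum>n=1..N. (pop ^^ n) f x) \<partial>\<pi>) / real N"
    unfolding avg_def by simp
  also have "(\<integral>x. (\<Sum>n=1..N. (pop ^^ n) f x) \<partial>\<pi>) = (\<Sum>n=1..N. (\<integral>x. (pop ^^ n) f x \<partial>\<pi>))"
    using integrable_bounded_measurable[OF bounded_measurable_funpow_pop[OF f] p s]
    by (intro Bochner_Integration.integral_sum) auto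
  finally show ?thesis using assms(3) by (simp add: e)
qed

end

text \<open>The abstract input for Harris recurrence: \<open>K\<close> is met almost surely from
  every state, and from \<open>K\<close> the chain regenerates with a share \<beta> of \<phi>. The
  number of steps \<open>n\<close> in \<open>minor\<close> may vary with the state, which admits
  periodic chains.\<close>

locale recurrent_kernel = markov_kernel S P for S :: "'a measure" and P +
  fixes \<phi> :: "'a measure" and K :: "'a set" and \<beta> :: real
  assumes \<phi>: "prob_space \<phi>" "sets \<phi> = sets S"
    and K: "K \<in> sets S" and \<beta>: "0 < \<beta>" "\<beta> \<le> 1"
    and minor: "\<And>x. x \<in> K \<Longrightarrow> \<exists>n. \<forall>B\<in>sets S. \<beta> * measure \<phi> B \<le> measure (nstep S P n x) B"
    and rec: "\<And>x. x \<in> space S \<Longrightarrow> (\<lambda>n. esc K n x) \<longlonglongrightarrow> 0"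
begin

text \<open>Subtracting the \<phi>-mean leaves functions of \<phi>-mean 0 that are harmonic up to
  order 1/N, so the Liouville property applies. The set may change with \<open>N\<close>, since all
  bounds are the same for every set.\<close>

lemma avg_merge:
  assumes B: "\<And>N. B N \<in> sets S" and x: "x \<in> space S"
  shows "(\<lambda>N. avg N (indicator (B N)) x - (\<integral>y. avg N (indicator (B N)) y \<partial>\<phi>)) \<longlonglongrightarrow> 0"
proof -
  let ?a = "\<lambda>N. avg N (indicator (B N) :: 'a \<Rightarrow> real)"
  define c where "c N = (\<integral>y. ?a N y \<partial>\<phi>)" for N
  define b where "b N y = ?a N y - c N" for N y
  have ind: "bounded_measurable S (indicator (B N))" for N
    by (rule bounded_measurable_indicator[OF B])
  have bma: "bounded_measurable S (?a N)" for N by (rule bounded_measurable_avg[OF ind])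
  have sp: "space \<phi> = space S" by (rule sets_eq_imp_space_eq[OF \<phi>(2)])
  have r: "0 \<le> ?a N y \<and> ?a N y \<le> 1" if "y \<in> space S" for N y
    by (rule avg_bounds[OF ind _ that]) (auto simp: indicator_def)
  interpret \<phi>: prob_space \<phi> by (rule \<phi>(1))
  have int: "integrable \<phi> (?a N)" for N by (rule integrable_bounded_measurable[OF bma \<phi>])
  have cr: "0 \<le> c N \<and> c N \<le> 1" for N
    unfolding c_def using r sp int \<phi>.integral_ge_const[of "?a N" 0] \<phi>.integral_le_const[of "?a N" 1] by auto
  have "(\<lambda>N. b N x) \<longlonglongrightarrow> 0"
  proof (rule almost_harmonic_tendsto_0[OF \<phi> K \<beta> minor rec _ _ _ _ x])
    show bmb: "bounded_measurable S (b N)" for N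
      unfolding b_def by (intro bounded_measurable_diff bma bounded_measurable_const)
    show "\<bar>b N y\<bar> \<le> 1" if "y \<in> space S" for N y
      using r[OF that, of N] cr[of N] unfolding b_def by linarith
    show "(\<integral>y. b N y \<partial>\<phi>) = 0" for N
      unfolding b_def using int \<phi>.prob_space by (subst Bochner_Integration.integral_diff) (auto simp: c_def)
    show "(\<lambda>N. b N y - pop (b N) y) \<longlonglongrightarrow> 0" if y: "y \<in> space S" for y
    proof -
      have eq: "b N y - pop (b N) y
          = ((pop ^^ 1) (indicator (B N)) y - (pop ^^ Suc N) (indicator (B N)) y) / real N" for N
        using pop_diff[OF bma bounded_measurable_const y] pop_avg_diff[OF ind y]
        by (simp add: b_def[abs_def] pop_const[OF y])
      have "\<bar>b N y - pop (b N) y\<bar> \<le> 1 / real N" for N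
      proof -
        have "0 \<le> (pop ^^ n) (indicator (B N)) y \<and> (pop ^^ n) (indicator (B N)) y \<le> 1" for n
          by (rule funpow_pop_bounds[OF ind _ y]) (auto simp: indicator_def)
        from this[of 1] this[of "Suc N"]
        have "\<bar>(pop ^^ 1) (indicator (B N)) y - (pop ^^ Suc N) (indicator (B N)) y\<bar> \<le> 1" by linarith
        then show ?thesis unfolding eq by (simp add: abs_divide divide_right_mono)
      qed
      then show ?thesis
        by (intro tendsto_rabs_zero_cancel[OF tendsto_sandwich[OF _ _ tendsto_const lim_1_over_n]]) auto
    qed
  qed
  then show ?thesis by (simp add: b_def c_def)
qed

text \<open>The averages become constant in the state. Integrating against \<pi>, under which the
  average for \<open>B N\<close> has mean \<open>measure \<pi> (B N)\<close>, identifies the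
  constant.\<close>

lemma avg_tendsto_invariant:
  assumes \<pi>: "invariant_prob S P \<pi>" and B: "\<And>N. B N \<in> sets S" and x: "x \<in> space S"
  shows "(\<lambda>N. avg N (indicator (B N)) x - measure \<pi> (B N)) \<longlonglongrightarrow> 0"
proof -
  let ?a = "\<lambda>N. avg N (indicator (B N) :: 'a \<Rightarrow> real)"
  define c where "c N = (\<integral>y. ?a N y \<partial>\<phi>)" for N
  have p: "prob_space \<pi>" and s: "sets \<pi> = sets S" using \<pi> by (auto simp: invariant_prob_def)
  interpret \<pi>: prob_space \<pi> by (rule p)
  have ind: "bounded_measurable S (indicator (B N))" for N
    by (rule bounded_measurable_indicator[OF B])
  have bma: "bounded_measurable S (?a N)" for N by (rule bounded_measurable_avg[OF ind])
  have r: "0 \<le> ?a N y \<and> ?a N y \<le> 1" if "y \<in> space S" for N y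
    by (rule avg_bounds[OF ind _ that]) (auto simp: indicator_def)
  interpret \<phi>: prob_space \<phi> by (rule \<phi>(1))
  have sp: "space \<phi> = space S" by (rule sets_eq_imp_space_eq[OF \<phi>(2)])
  have int: "integrable \<phi> (?a N)" for N by (rule integrable_bounded_measurable[OF bma \<phi>])
  have cr: "0 \<le> c N \<and> c N \<le> 1" for N
    unfolding c_def using r sp int \<phi>.integral_ge_const[of "?a N" 0] \<phi>.integral_le_const[of "?a N" 1] by auto
  have bmd: "bounded_measurable S (\<lambda>y. ?a N y - c N)" for N
    by (intro bounded_measurable_diff bma bounded_measurable_const)
  have "(\<lambda>N. \<integral>y. ?a N y - c N \<partial>\<pi>) \<longlonglongrightarrow> 0"
  proof (rule integral_tendsto_0[OF _ _ _ p s, where c = 1])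
    show "\<bar>?a N y - c N\<bar> \<le> 1" if "y \<in> space S" for N y
      using r[OF that, of N] cr[of N] by linarith
  qed (use avg_merge[OF B] bounded_measurableD[OF bmd] in \<open>auto simp: c_def\<close>)
  moreover have "(\<integral>y. ?a N y - c N \<partial>\<pi>) = measure \<pi> (B N) - c N" if "N \<ge> 1" for N
    using integrable_bounded_measurable[OF bma p s] \<pi>.prob_space integral_avg_invariant[OF \<pi> ind that]
      sets.Int_space_eq2[of "B N" \<pi>] B s
    by (subst Bochner_Integration.integral_diff) auto
  ultimately have "(\<lambda>N. measure \<pi> (B N) - c N) \<longlonglongrightarrow> 0"
    by (elim Lim_transform_eventually) (auto simp: eventually_sequentially intro!: exI[of _ 1])
  from tendsto_diff[OF avg_merge[of B, OF B x] this] show ?thesis by (simp add: c_def)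
qed

text \<open>The averages started in one state converge to the values of both measures.\<close>

lemma invariant_prob_unique:
  assumes "invariant_prob S P \<pi>" "invariant_prob S P \<pi>'"
  shows "\<pi> = \<pi>'"
proof (rule measure_eqI)
  have p: "prob_space \<pi>" "prob_space \<pi>'" and s: "sets \<pi> = sets S" "sets \<pi>' = sets S"
    using assms by (auto simp: invariant_prob_def)
  interpret \<pi>: prob_space \<pi> by (rule p)
  interpret \<pi>': prob_space \<pi>' by (rule p)
  show "sets \<pi> = sets \<pi>'" using s by simp
  fix B assume "B \<in> sets \<pi>"
  then have B: "B \<in> sets S" using s by simp
  obtain x where "x \<in> space \<pi>" using \<pi>.not_empty by blast
  then have x: "x \<in> space S" using sets_eq_imp_space_eq[OF s(1)] by simp
  have lim: "(\<lambda>N. avg N (indicator B) x) \<longlonglongrightarrow> measure \<rho> B" if "invariant_prob S P \<rho>" for \<rho>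
    using avg_tendsto_invariant[OF that B x] by (rule LIM_zero_cancel)
  have "measure \<pi> B = measure \<pi>' B"
    using LIMSEQ_unique[OF lim[OF assms(1)] lim[OF assms(2)]] .
  then show "emeasure \<pi> B = emeasure \<pi>' B" by (simp add: \<pi>.emeasure_eq_measure \<pi>'.emeasure_eq_measure)
qed

text \<open>Choosing for each \<open>N\<close> a set within 1/N of the supremum reduces uniformity
  over all sets to convergence along one sequence of sets.\<close>

lemma tv_dist_cesaro_tendsto:
  assumes \<pi>: "invariant_prob S P \<pi>" and x: "x \<in> space S"
  shows "(\<lambda>N. tv_dist S (cesaro S P x N) \<pi>) \<longlonglongrightarrow> 0"
proof -
  interpret \<pi>: prob_space \<pi> using \<pi> by (simp add: invariant_prob_def)
  define d where "d N B = \<bar>measure (cesaro S P x N) B - measure \<pi> B\<bar>" for N B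
  have dle: "d N B \<le> 1" if "N \<ge> 1" "B \<in> sets S" for N B
  proof -
    have "0 \<le> avg N (indicator B) x \<and> avg N (indicator B) x \<le> 1"
      using that x by (intro avg_bounds bounded_measurable_indicator) (auto simp: indicator_def)
    then show ?thesis using \<pi>.prob_le_1[of B] measure_nonneg[of \<pi> B]
      unfolding d_def measure_cesaro[OF x that(2,1)] by linarith
  qed
  have tv: "tv_dist S (cesaro S P x N) \<pi> = (SUP B\<in>sets S. d N B)" for N
    by (simp add: tv_dist_def d_def)
  have bdd: "bdd_above (d N ` sets S)" if "N \<ge> 1" for N
    using dle[OF that] by (auto simp: bdd_above_def)
  have ex: "\<exists>B\<in>sets S. N \<ge> 1 \<longrightarrow> (SUP B\<in>sets S. d N B) - 1 / real N < d N B" for N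
  proof (cases "N \<ge> 1")
    case True
    then have "(SUP B\<in>sets S. d N B) - 1 / real N < (SUP B\<in>sets S. d N B)" by simp
    then have "\<exists>y\<in>d N ` sets S. (SUP B\<in>sets S. d N B) - 1 / real N < y"
      by (subst (asm) less_cSup_iff[OF _ bdd[OF True]]) auto
    then show ?thesis by auto
  qed auto
  then obtain B where B: "\<And>N. B N \<in> sets S"
    "\<And>N. N \<ge> 1 \<Longrightarrow> (SUP B\<in>sets S. d N B) - 1 / real N < d N (B N)" by metis
  show ?thesis unfolding tv
  proof (rule tendsto_sandwich)
    show "eventually (\<lambda>N. 0 \<le> (SUP B\<in>sets S. d N B)) sequentially"
      unfolding eventually_sequentially
    proof (intro exI[of _ 1] allI impI)
      fix N :: nat assume "1 \<le> N"
      have "0 \<le> d N {}" by (simp add: d_def)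
      also have "\<dots> \<le> (SUP B\<in>sets S. d N B)" using bdd[OF \<open>1 \<le> N\<close>] by (intro cSUP_upper) auto
      finally show "0 \<le> (SUP B\<in>sets S. d N B)" .
    qed
    show "eventually (\<lambda>N. (SUP B\<in>sets S. d N B)
        \<le> \<bar>avg N (indicator (B N)) x - measure \<pi> (B N)\<bar> + 1 / real N) sequentially"
      unfolding eventually_sequentially
    proof (intro exI[of _ 1] allI impI)
      fix N :: nat assume "1 \<le> N"
      from B(2)[OF this] show "(SUP B\<in>sets S. d N B)
        \<le> \<bar>avg N (indicator (B N)) x - measure \<pi> (B N)\<bar> + 1 / real N"
        unfolding d_def measure_cesaro[OF x B(1) \<open>1 \<le> N\<close>] by linarith
    qed
    show "(\<lambda>N. \<bar>avg N (indicator (B N)) x - measure \<pi> (B N)\<bar> + 1 / real N) \<longlonglongrightarrow> 0"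
      using tendsto_add[OF tendsto_rabs_zero[OF avg_tendsto_invariant[OF \<pi> B(1) x]] lim_1_over_n] by simp
  qed simp
qed

text \<open>If \<pi> did not charge \<open>B\<close>, invariance would make the
  \<open>n\<close>-step probabilities of \<open>B\<close> vanish for all \<open>n\<close> at once
  \<pi>-almost everywhere, hence at some state, contrary to \<open>irr\<close>.\<close>

lemma invariant_prob_pos:
  assumes \<pi>: "invariant_prob S P \<pi>" and B: "B \<in> sets S"
    and irr: "\<And>x. x \<in> space S \<Longrightarrow> \<exists>n. 0 < measure (nstep S P n x) B"
  shows "0 < measure \<pi> B"
proof (rule ccontr)
  assume "\<not> 0 < measure \<pi> B"
  then have 0: "measure \<pi> B = 0" using measure_nonneg[of \<pi> B] by linarith
  have p: "prob_space \<pi>" and s: "sets \<pi> = sets S" using \<pi> by (auto simp: invariant_prob_def)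
  interpret \<pi>: prob_space \<pi> by (rule p)
  have sp: "space \<pi> = space S" by (rule sets_eq_imp_space_eq[OF s])
  have ind: "bounded_measurable S (indicator B)" by (rule bounded_measurable_indicator[OF B])
  have "AE x in \<pi>. (pop ^^ n) (indicator B) x = 0" for n
  proof -
    have "(\<integral>x. (pop ^^ n) (indicator B) x \<partial>\<pi>) = (\<integral>x. indicator B x \<partial>\<pi>)"
      by (induction n) (auto simp: integral_pop_invariant[OF \<pi>] bounded_measurable_funpow_pop[OF ind])
    also have "\<dots> = measure \<pi> (B \<inter> space \<pi>)" using B s by simp
    also have "\<dots> = 0" using 0 sets.Int_space_eq2[of B \<pi>] B s by simp
    finally have z: "(\<integral>x. (pop ^^ n) (indicator B) x \<partial>\<pi>) = 0" .
    have "AE x in \<pi>. 0 \<le> (pop ^^ n) (indicator B) x"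
    proof (rule AE_I2)
      fix x assume "x \<in> space \<pi>"
      then show "0 \<le> (pop ^^ n) (indicator B) x"
        using measure_nstep[of x B n] measure_nonneg[of "nstep S P n x" B] B sp by simp
    qed
    from integral_nonneg_eq_0_iff_AE[OF
        integrable_bounded_measurable[OF bounded_measurable_funpow_pop[OF ind] p s] this] z
    show ?thesis by simp
  qed
  then have "AE x in \<pi>. \<forall>n. (pop ^^ n) (indicator B) x = 0" by (simp add: AE_all_countable)
  then have "AE x in \<pi>. False"
  proof (rule AE_mp[OF _ AE_I2], intro impI)
    fix x assume x: "x \<in> space \<pi>" "\<forall>n. (pop ^^ n) (indicator B) x = 0"
    then have xS: "x \<in> space S" by (simp add: sp)
    from irr[OF this] obtain n where "0 < measure (nstep S P n x) B" ..
    then show False using x(2) measure_nstep[OF xS B] by simp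
  qed
  then show False by simp
qed

text \<open>A finite potential bounds all partial sums and sends the averages to 0, but they tend to
  \<open>measure \<pi> B\<close>.\<close>

lemma potential_infinite:
  assumes \<pi>: "invariant_prob S P \<pi>" "0 < measure \<pi> B" and B: "B \<in> sets S" and x: "x \<in> space S"
  shows "potential S P x B = \<infinity>"
proof (rule ccontr)
  assume fin: "potential S P x B \<noteq> \<infinity>"
  define t where "t = enn2real (potential S P x B)"
  have "potential S P x B < \<top>" using fin by (simp add: top.not_eq_extremum[symmetric])
  then have t: "potential S P x B = ennreal t" unfolding t_def by (rule ennreal_enn2real[symmetric])
  have t0: "0 \<le> t" by (simp add: t_def)
  have ind: "bounded_measurable S (indicator B)" by (rule bounded_measurable_indicator[OF B])
  have e: "emeasure (nstep S P n x) B = ennreal ((pop ^^ n) (indicator B) x)" for n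
  proof -
    interpret prob_space "nstep S P n x" by (rule prob_space_nstep[OF x])
    show ?thesis by (simp add: emeasure_eq_measure measure_nstep[OF x B])
  qed
  have nn: "0 \<le> (pop ^^ n) (indicator B) x" for n
    using measure_nstep[OF x B, of n] measure_nonneg[of "nstep S P n x" B] by simp
  have le: "(\<Sum>n=1..N. (pop ^^ n) (indicator B) x) \<le> t" for N
  proof -
    have "ennreal (\<Sum>n=1..N. (pop ^^ n) (indicator B) x) = (\<Sum>n=1..N. emeasure (nstep S P n x) B)"
      unfolding e by (rule sum_ennreal[symmetric]) (rule nn)
    also have "\<dots> = (\<Sum>n<N. emeasure (nstep S P (Suc n) x) B)"
      unfolding One_nat_def by (rule sum.atLeast1_atMost_eq)
    also have "\<dots> \<le> potential S P x B" unfolding potential_def by (rule sum_le_suminf) auto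
    finally show ?thesis unfolding t ennreal_le_iff[OF t0] .
  qed
  have "(\<lambda>N. avg N (indicator B) x) \<longlonglongrightarrow> measure \<pi> B"
    by (rule LIM_zero_cancel[OF avg_tendsto_invariant[OF \<pi>(1) B x]])
  moreover have "(\<lambda>N. avg N (indicator B) x) \<longlonglongrightarrow> 0"
  proof (rule tendsto_sandwich[OF _ _ tendsto_const lim_const_over_n[of t]])
    show "eventually (\<lambda>N. 0 \<le> avg N (indicator B) x) sequentially"
      unfolding avg_def by (intro always_eventually allI divide_nonneg_nonneg sum_nonneg nn) simp
    show "eventually (\<lambda>N. avg N (indicator B) x \<le> t / of_nat N) sequentially"
      unfolding avg_def by (intro always_eventually allI divide_right_mono le) simp
  qed
  ultimately have "measure \<pi> B = 0" by (rule LIMSEQ_unique)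
  with \<pi>(2) show False by simp
qed

text \<open>\<open>irr\<close> carries positivity of a set from \<phi> over to \<pi>, and sets
  charged by \<pi> have infinite potential. Irreducibility comes along, as infinity is
  positive.\<close>

lemma Harris_recurrentI:
  assumes \<pi>: "invariant_prob S P \<pi>"
    and irr: "\<And>x B. x \<in> space S \<Longrightarrow> B \<in> sets S \<Longrightarrow> 0 < measure \<phi> B \<Longrightarrow> \<exists>n. 0 < measure (nstep S P n x) B"
  shows "Harris_recurrent S P"
proof -
  interpret \<phi>: prob_space \<phi> by (rule \<phi>)
  have "potential S P x B = \<infinity>" if "B \<in> sets S" "emeasure \<phi> B > 0" "x \<in> space S" for B x
  proof -
    have "0 < measure \<phi> B" using that(2) by (simp add: \<phi>.emeasure_eq_measure)
    then have "0 < measure \<pi> B" using irr that(1) by (intro invariant_prob_pos[OF \<pi>]) auto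
    then show ?thesis by (rule potential_infinite[OF \<pi> _ that(1,3)])
  qed
  moreover have "emeasure \<phi> (space S) = 1"
    using \<phi>.emeasure_space_1 sets_eq_imp_space_eq[OF \<phi>(2)] by simp
  ultimately have "Harris_recurrent_wrt S P \<phi>"
    unfolding Harris_recurrent_wrt_def irreducible_wrt_def
    using \<phi>(2) \<phi>.sigma_finite_measure_axioms by simp
  then show ?thesis by (auto simp: Harris_recurrent_def)
qed

end

section \<open>Recurrence and invariant probability of the random logistic map\<close>

locale logistic = prob_space M for M :: "'w measure" +
  fixes \<epsilon> :: "nat \<Rightarrow> 'w \<Rightarrow> real"
  assumes eps: "\<epsilon> 1 \<in> measurable M param_space"
begin

abbreviation LP :: "real \<Rightarrow> real measure" where "LP \<equiv> logistic_kernel M \<epsilon>"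

sublocale markov_kernel state_space LP
  by unfold_locales (rule logistic_kernel_measurable[where \<epsilon> = \<epsilon>, OF prob_space_axioms eps])

lemma space_state: "space state_space = {0<..<1::real}"
  by (simp add: space_restrict_space)

lemma sets_state_iff: "B \<in> sets state_space \<longleftrightarrow> B \<subseteq> {0<..<1::real} \<and> B \<in> sets borel"
  by (simp add: sets_restrict_space_iff)

lemma eps_measurable [measurable]: "\<epsilon> 1 \<in> borel_measurable M"
  using eps by (simp add: measurable_restrict_space2_iff)

lemma eps_range: "\<omega> \<in> space M \<Longrightarrow> 0 < \<epsilon> 1 \<omega> \<and> \<epsilon> 1 \<omega> < 4"
  using measurable_space[OF eps] by (auto simp: space_restrict_space)

lemma next_measurable:
  assumes "0 < x" "x < 1"
  shows "(\<lambda>\<omega>. \<epsilon> 1 \<omega> * x * (1 - x)) \<in> measurable M state_space"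
proof (rule measurable_restrict_space2)
  show "(\<lambda>\<omega>. \<epsilon> 1 \<omega> * x * (1 - x)) \<in> space M \<rightarrow> {0<..<1}"
  proof
    fix \<omega> assume "\<omega> \<in> space M"
    from eps_range[OF this] assms show "\<epsilon> 1 \<omega> * x * (1 - x) \<in> {0<..<1}"
      using logistic_map_unit[of "\<epsilon> 1 \<omega>" x] by (simp only: greaterThanLessThan_iff)
  qed
qed measurable

lemma pop_next:
  assumes "0 < x" "x < 1" "bounded_measurable state_space f"
  shows "pop f x = expectation (\<lambda>\<omega>. f (\<epsilon> 1 \<omega> * x * (1 - x)))"
  unfolding pop_def logistic_kernel_def
  by (rule integral_distr[OF next_measurable[OF assms(1,2)] bounded_measurableD[OF assms(3)]])

lemma integrable_next:
  assumes "0 < x" "x < 1" "bounded_measurable state_space f"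
  shows "integrable M (\<lambda>\<omega>. f (\<epsilon> 1 \<omega> * x * (1 - x)))"
proof -
  obtain c where c: "\<forall>x\<in>space state_space. \<bar>f x\<bar> \<le> c" using assms(3) by (auto simp: bounded_measurable_def)
  show ?thesis
  proof (rule integrable_const_bound[of _ c])
    show "AE \<omega> in M. norm (f (\<epsilon> 1 \<omega> * x * (1 - x))) \<le> c"
      using c measurable_space[OF next_measurable[OF assms(1,2)]] by auto
    show "(\<lambda>\<omega>. f (\<epsilon> 1 \<omega> * x * (1 - x))) \<in> borel_measurable M"
      by (rule measurable_compose[OF next_measurable[OF assms(1,2)] bounded_measurableD[OF assms(3)]])
  qed
qed

section \<open>Return to a compact set\<close>

text \<open>Both chains use the same parameter. While \<open>y < \<kappa>\<close>, a step preserves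
  \<open>x \<le> c * y\<close>: for \<open>y \<le> x\<close> because
  \<open>1 - x \<le> 1 - y\<close>, otherwise because \<open>c * (1 - y) \<ge> 1\<close>. Once
  \<open>y\<close> rises to \<kappa> or more it is in the taboo set and contributes nothing
  positive. So \<open>f\<close> has to be controlled only up to \<open>1 - \<kappa>\<close>.\<close>

lemma taboo_coupling:
  assumes \<kappa>: "0 < \<kappa>" "\<kappa> \<le> 1/5" and \<delta>: "\<delta> \<le> \<kappa>" and c: "1 / (1 - \<kappa>) \<le> c"
    and f: "bounded_measurable state_space f"
      "\<And>z. 0 < z \<Longrightarrow> z \<le> 1 - \<kappa> \<Longrightarrow> f z \<le> indicator ({0<..<1} \<inter> {..<\<delta>}) z"
    and xy: "0 < y" "y < \<kappa>" "0 < x" "x < 1" "x \<le> c * y"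
  shows "(taboo {\<kappa>..1-\<kappa>} ^^ n) f y \<le> (pop ^^ n) (indicator ({0<..<1} \<inter> {..<c*\<delta>})) x"
  using xy
proof (induction n arbitrary: x y)
  case 0
  have "0 < 1 / (1 - \<kappa>)" using \<kappa> by simp
  then have c0: "0 < c" using c by linarith
  have "y < \<delta> \<Longrightarrow> x < c * \<delta>" using 0 c0 by (meson le_less_trans mult_strict_left_mono)
  moreover have "f y \<le> indicator ({0<..<1} \<inter> {..<\<delta>}) y" using 0 \<kappa> by (intro f(2)) auto
  ultimately show ?case
    using 0 \<kappa> by (cases "y < \<delta>") (auto intro: order_trans[OF _ indicator_pos_le])
next
  case (Suc n)
  let ?K = "{\<kappa>..1-\<kappa>}"
  let ?g = "indicator ({0<..<1} \<inter> {..<c*\<delta>}) :: real \<Rightarrow> real"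
  have Kset: "?K \<in> sets state_space" using \<kappa> by (auto simp: sets_state_iff)
  have bg: "bounded_measurable state_space ?g"
    by (rule bounded_measurable_indicator) (auto simp: sets_state_iff)
  note bF = bounded_measurable_funpow_taboo[OF Kset f(1), of n]
  note bG = bounded_measurable_funpow_pop[OF bg, of n]
  have y1: "y < 1" using Suc.prems \<kappa> by linarith
  have "(taboo ?K ^^ Suc n) f y = pop ((taboo ?K ^^ n) f) y"
    using Suc.prems y1 by (simp add: taboo_def space_state)
  also have "\<dots> = expectation (\<lambda>\<omega>. (taboo ?K ^^ n) f (\<epsilon> 1 \<omega> * y * (1 - y)))"
    by (rule pop_next[OF Suc.prems(1) y1 bF])
  also have "\<dots> \<le> expectation (\<lambda>\<omega>. (pop ^^ n) ?g (\<epsilon> 1 \<omega> * x * (1 - x)))"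
  proof (rule integral_mono[OF integrable_next[OF Suc.prems(1) y1 bF] integrable_next[OF Suc.prems(3,4) bG]])
    fix \<omega> assume "\<omega> \<in> space M"
    then have t: "0 < \<epsilon> 1 \<omega>" "\<epsilon> 1 \<omega> < 4" using eps_range by auto
    define y' where "y' = \<epsilon> 1 \<omega> * y * (1 - y)"
    define x' where "x' = \<epsilon> 1 \<omega> * x * (1 - x)"
    have y': "0 < y'" "y' < 1" and x': "0 < x'" "x' < 1"
      unfolding y'_def x'_def using logistic_map_unit[OF t] Suc.prems y1 by auto
    have "\<epsilon> 1 \<omega> * y * (1 - y) \<le> 4 * y * 1"
      using t Suc.prems y1 by (intro mult_mono) auto
    then have yK: "y' \<le> 1 - \<kappa>" unfolding y'_def using Suc.prems \<kappa> by linarith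
    have le: "x * (1 - x) \<le> c * (y * (1 - y))"
    proof (cases "y \<le> x")
      case True
      have "x * (1 - x) \<le> (c * y) * (1 - y)"
        using True Suc.prems y1 by (intro mult_mono) auto
      then show ?thesis by (simp only: mult.assoc)
    next
      case False
      have "1 = 1 / (1 - \<kappa>) * (1 - \<kappa>)" using \<kappa> by simp
      also have "\<dots> \<le> c * (1 - y)"
        using \<kappa> c Suc.prems order_trans[of 0 "1 / (1 - \<kappa>)" c] by (intro mult_mono) auto
      finally have "y * 1 \<le> y * (c * (1 - y))" using Suc.prems by (intro mult_left_mono) auto
      moreover have "x * (1 - x) \<le> y * 1" using False Suc.prems by (intro mult_mono) auto
      ultimately show ?thesis by (simp add: mult.left_commute)
    qed
    have x'y': "x' \<le> c * y'"
    proof -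
      have "\<epsilon> 1 \<omega> * (x * (1 - x)) \<le> \<epsilon> 1 \<omega> * (c * (y * (1 - y)))"
        using le t by (intro mult_left_mono) auto
      then show ?thesis unfolding x'_def y'_def by (simp only: mult.assoc mult.left_commute[of c])
    qed
    have nn: "0 \<le> (pop ^^ n) ?g x'"
      using funpow_pop_bounds[OF bg, of 0 1 x' n] x' by (auto simp: space_state indicator_def)
    have "(taboo ?K ^^ n) f y' \<le> (pop ^^ n) ?g x'"
    proof (cases "y' < \<kappa>")
      case True
      then show ?thesis using Suc.IH[OF y'(1) _ x' x'y'] by simp
    next
      case False
      have "(taboo ?K ^^ n) f y' \<le> 0"
      proof (cases n)
        case 0
        have "f y' \<le> indicator ({0<..<1} \<inter> {..<\<delta>}) y'" using y' yK by (intro f(2)) auto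
        then show ?thesis using 0 False \<delta> by (simp add: indicator_def split: if_splits)
      next
        case (Suc k)
        then show ?thesis using False yK by (simp add: taboo_def)
      qed
      with nn show ?thesis by linarith
    qed
    then show "(taboo ?K ^^ n) f (\<epsilon> 1 \<omega> * y * (1 - y)) \<le> (pop ^^ n) ?g (\<epsilon> 1 \<omega> * x * (1 - x))"
      by (simp only: x'_def y'_def)
  qed
  also have "\<dots> = (pop ^^ Suc n) ?g x"
    using pop_next[OF Suc.prems(3,4) bG] by simp
  finally show ?case .
qed

text \<open>Below \<kappa>, a parameter of at least \<open>a\<close> multiplies the state by at
  least \<open>a * (1 - \<kappa>)\<close>; \<open>m\<close> such parameters in a row bring
  \<open>x\<close> into the set. The index is \<open>Suc m\<close> because arrival may happen as
  late as time \<open>m\<close>, and \<open>esc\<close> with index \<open>m\<close> looks only at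
  the times before \<open>m\<close>.\<close>

lemma esc_push:
  assumes \<kappa>: "0 < \<kappa>" "\<kappa> \<le> 1/5" and a: "0 < a"
    and x: "0 < x" "x \<le> 1 - \<kappa>" "\<kappa> \<le> x * (a * (1 - \<kappa>)) ^ m"
  shows "esc {\<kappa>..1-\<kappa>} (Suc m) x \<le> 1 - (prob {\<omega>\<in>space M. a \<le> \<epsilon> 1 \<omega>}) ^ m"
  using x
proof (induction m arbitrary: x)
  case 0
  then show ?case by (simp add: esc_in)
next
  case (Suc m)
  let ?K = "{\<kappa>..1-\<kappa>}"
  let ?A = "{\<omega>\<in>space M. a \<le> \<epsilon> 1 \<omega>}"
  let ?q = "prob ?A"
  have Kset: "?K \<in> sets state_space" using \<kappa> by (auto simp: sets_state_iff)
  have A: "?A \<in> sets M" by measurable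
  have intA: "integrable M (indicator ?A :: 'w \<Rightarrow> real)"
    by (rule integrable_const_bound[of _ 1]) (use A in \<open>auto simp: indicator_def\<close>)
  show ?case
  proof (cases "\<kappa> \<le> x")
    case True
    then have "esc ?K (Suc (Suc m)) x = 0" using Suc.prems by (intro esc_in) auto
    then show ?thesis by (simp add: power_le_one flip: power_Suc)
  next
    case False
    have x1: "x < 1" using Suc.prems \<kappa> by linarith
    note bE = bounded_measurable_esc[OF Kset, of "Suc m"]
    have "esc ?K (Suc (Suc m)) x = pop (esc ?K (Suc m)) x"
      using False Suc.prems x1 by (simp add: esc_Suc[of ?K "Suc m"] taboo_def[of ?K "esc ?K (Suc m)"] space_state)
    also have "\<dots> = expectation (\<lambda>\<omega>. esc ?K (Suc m) (\<epsilon> 1 \<omega> * x * (1 - x)))"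
      by (rule pop_next[OF Suc.prems(1) x1 bE])
    also have "\<dots> \<le> expectation (\<lambda>\<omega>. 1 - ?q ^ m * indicator ?A \<omega>)"
    proof (rule integral_mono[OF integrable_next[OF Suc.prems(1) x1 bE]])
      show "integrable M (\<lambda>\<omega>. 1 - ?q ^ m * indicator ?A \<omega>)"
        by (intro Bochner_Integration.integrable_diff integrable_mult_right integrable_const intA)
      fix \<omega> assume w: "\<omega> \<in> space M"
      then have t: "0 < \<epsilon> 1 \<omega>" "\<epsilon> 1 \<omega> < 4" using eps_range by auto
      define x' where "x' = \<epsilon> 1 \<omega> * x * (1 - x)"
      have x': "0 < x'" "x' < 1" unfolding x'_def using logistic_map_unit[OF t] Suc.prems x1 by auto
      have "\<epsilon> 1 \<omega> * x * (1 - x) \<le> 4 * x * 1" using t Suc.prems x1 by (intro mult_mono) auto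
      then have xK: "x' \<le> 1 - \<kappa>" unfolding x'_def using False \<kappa> by linarith
      have "esc ?K (Suc m) x' \<le> 1 - ?q ^ m * indicator ?A \<omega>"
      proof (cases "a \<le> \<epsilon> 1 \<omega>")
        case True
        have "a * x * (1 - \<kappa>) \<le> \<epsilon> 1 \<omega> * x * (1 - x)"
          using True False a Suc.prems \<kappa> by (intro mult_mono) auto
        then have ge: "x * (a * (1 - \<kappa>)) \<le> x'" unfolding x'_def by (simp only: mult.left_commute mult.assoc mult.commute)
        have "\<kappa> \<le> x * (a * (1 - \<kappa>)) * (a * (1 - \<kappa>)) ^ m" using Suc.prems(3) by (simp add: mult.assoc)
        also have "\<dots> \<le> x' * (a * (1 - \<kappa>)) ^ m" using ge a \<kappa> by (intro mult_right_mono) auto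
        finally show ?thesis using Suc.IH[OF x'(1) xK] True w by simp
      next
        case False
        then show ?thesis using esc_range[OF Kset, of x' "Suc m"] x' by (simp add: space_state)
      qed
      then show "esc ?K (Suc m) (\<epsilon> 1 \<omega> * x * (1 - x)) \<le> 1 - ?q ^ m * indicator ?A \<omega>"
        by (simp only: x'_def)
    qed
    also have "\<dots> = 1 - ?q ^ m * ?q"
    proof -
      have "expectation (\<lambda>\<omega>. 1 - ?q ^ m * indicator ?A \<omega>)
          = expectation (\<lambda>\<omega>. 1) - expectation (\<lambda>\<omega>. ?q ^ m * indicator ?A \<omega>)"
        by (intro Bochner_Integration.integral_diff integrable_mult_right integrable_const intA)
      also have "expectation (\<lambda>\<omega>. ?q ^ m * indicator ?A \<omega>) = ?q ^ m * ?q"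
        using A intA sets.Int_space_eq2[OF A] by simp
      finally show ?thesis by (simp add: prob_space)
    qed
    finally show ?thesis by (simp add: mult.commute)
  qed
qed

text \<open>If the chain started in \<open>y\<close> avoided \<open>{\<kappa>..1-\<kappa>}\<close> forever with positive probability, it would
  tend to 0 on that event, and \<open>taboo_coupling\<close> would drag the chain started in \<open>x\<^sub>0\<close> to 0 too.\<close>

lemma esc_tendsto_0_small:
  assumes \<kappa>: "0 < \<kappa>" "\<kappa> \<le> 1/5" and a: "1 < a * (1 - \<kappa>)" "prob {\<omega>\<in>space M. a \<le> \<epsilon> 1 \<omega>} > 0"
    and x0: "0 < x0" "x0 < 1" and tight: "tight_on {0<..<1} (cesaro state_space LP x0)"
    and y: "0 < y" "y < \<kappa>"
  shows "(\<lambda>n. esc {\<kappa>..1-\<kappa>} n y) \<longlonglongrightarrow> 0"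
proof -
  let ?K = "{\<kappa>..1-\<kappa>}"
  define q where "q = prob {\<omega>\<in>space M. a \<le> \<epsilon> 1 \<omega>}"
  have Kset: "?K \<in> sets state_space" using \<kappa> by (auto simp: sets_state_iff)
  have yS: "y \<in> space state_space" and xS: "x0 \<in> space state_space" using y \<kappa> x0 by (auto simp: space_state)
  have dec: "decseq (\<lambda>n. esc ?K n y)" by (rule esc_decseq[OF Kset yS])
  have rng: "0 \<le> esc ?K n z \<and> esc ?K n z \<le> 1" if "z \<in> space state_space" for n z
    by (rule esc_range[OF Kset that])
  have "\<forall>n. 0 \<le> esc ?K n y" using rng[OF yS] by simp
  from decseq_convergent[OF dec this]
  obtain L where L: "(\<lambda>n. esc ?K n y) \<longlonglongrightarrow> L" "\<forall>n. L \<le> esc ?K n y" by blast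
  have L0: "0 \<le> L" by (rule LIMSEQ_le_const[OF L(1)]) (use rng[OF yS] in auto)
  have "L \<le> 0"
  proof (rule ccontr)
    assume "\<not> L \<le> 0"
    then have Lpos: "L > 0" by simp
    \<comment> \<open>Tightness with \<open>\<eta> = L / 3\<close> leaves at most
      \<open>L / 3\<close> of each average from \<open>x0\<close> outside \<open>C\<close>; the
      coupling will put at least \<open>L / 2\<close> there.\<close>
    then have "L / 3 > 0" by simp
    from tight[unfolded tight_on_def, rule_format, OF this]
    obtain C where C: "compact C" "C \<subseteq> {0<..<1}"
      "\<forall>n\<ge>1. measure (cesaro state_space LP x0 n) C \<ge> 1 - L / 3" by (elim exE conjE)
    have Cset: "C \<in> sets state_space" using C by (auto simp: sets_state_iff intro: borel_closed compact_imp_closed)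
    have "\<exists>s>0. \<forall>z\<in>C. s \<le> z"
    proof (cases "C = {}")
      case False
      then obtain s where "s \<in> C" "\<forall>z\<in>C. s \<le> z" using compact_attains_inf[OF C(1)] by blast
      then show ?thesis using C(2) by (intro exI[of _ s]) auto
    qed (auto intro: exI[of _ 1])
    then obtain s where s: "0 < s" "\<forall>z\<in>C. s \<le> z" by blast
    \<comment> \<open>The first entry gives \<open>x0 \<le> c * y\<close> at the start, the second
      is the least ratio that \<open>taboo_coupling\<close> maintains.\<close>
    define c where "c = max (x0 / y) (1 / (1 - \<kappa>))"
    have c: "1 / (1 - \<kappa>) \<le> c" "x0 / y \<le> c" by (auto simp: c_def)
    have xcy: "x0 \<le> c * y" using c(2) y by (simp add: pos_divide_le_eq)
    have c0: "0 < c" using c(2) x0 y by (meson divide_pos_pos less_le_trans)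
    \<comment> \<open>With this choice a \<open>y\<close>-chain below \<delta> forces the
      \<open>x0\<close>-chain below \<open>s\<close>, hence out of \<open>C\<close>.\<close>
    define \<delta> where "\<delta> = min \<kappa> (s / c)"
    have \<delta>: "0 < \<delta>" "\<delta> \<le> \<kappa>" using \<kappa> s c0 by (auto simp: \<delta>_def)
    have "\<delta> \<le> s / c" by (simp add: \<delta>_def)
    then have cs: "c * \<delta> \<le> s" using c0 by (simp add: pos_le_divide_eq mult.commute)
    define B where "B = {0<..<1} \<inter> {..<c * \<delta>}"
    have Bset: "B \<in> sets state_space" by (auto simp: sets_state_iff B_def)
    let ?B = "indicator B :: real \<Rightarrow> real"
    \<comment> \<open>The part above \<open>1 - \<kappa>\<close> is there so that
      \<open>f + g\<close> dominates \<open>esc ?K 1\<close> on the whole state space.\<close>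
    define f :: "real \<Rightarrow> real" where "f = indicator ({0<..<\<delta>} \<union> {1-\<kappa><..<1})"
    define g :: "real \<Rightarrow> real" where "g = indicator {\<delta>..<\<kappa>}"
    have bf: "bounded_measurable state_space f" unfolding f_def
      using \<delta> \<kappa> by (intro bounded_measurable_indicator) (auto simp: sets_state_iff)
    have bg: "bounded_measurable state_space g" unfolding g_def
      using \<delta> \<kappa> by (intro bounded_measurable_indicator) (auto simp: sets_state_iff)
    have split: "esc ?K (Suc n) y \<le> (taboo ?K ^^ n) f y + (taboo ?K ^^ n) g y" for n
    proof -
      have "esc ?K (Suc n) y = (taboo ?K ^^ n) (esc ?K 1) y" using esc_add[of ?K n 1] by simp
      also have "\<dots> \<le> (taboo ?K ^^ n) (\<lambda>z. f z - (- 1) * g z) y"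
      proof (rule funpow_taboo_mono[OF Kset bounded_measurable_esc[OF Kset] _ _ yS])
        show "bounded_measurable state_space (\<lambda>z. f z - (- 1) * g z)"
          by (intro bounded_measurable_diff bounded_measurable_cmult bf bg)
        fix z :: real assume z: "z \<in> space state_space"
        show "esc ?K 1 z \<le> f z - (- 1) * g z"
        proof (cases "z \<in> ?K")
          case True
          then show ?thesis using esc_in[OF True, of 0] by (simp add: f_def g_def)
        next
          case False
          then have "z \<in> {0<..<\<delta>} \<union> {1-\<kappa><..<1} \<or> z \<in> {\<delta>..<\<kappa>}" using z \<delta> \<kappa> by (auto simp: space_state)
          then have "1 \<le> f z + g z" unfolding f_def g_def by (auto simp: indicator_def)
          then show ?thesis using rng[OF z, of 1] by simp
        qed
      qed
      also have "\<dots> = (taboo ?K ^^ n) f y + (taboo ?K ^^ n) g y"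
        by (subst funpow_taboo_diff[OF Kset bf bg yS]) simp
      finally show ?thesis .
    qed
    obtain m where m: "\<kappa> / \<delta> < (a * (1 - \<kappa>)) ^ m" using real_arch_pow[OF a(1)] by blast
    have m': "\<kappa> \<le> \<delta> * (a * (1 - \<kappa>)) ^ m" using m \<delta> by (simp add: pos_divide_less_eq mult.commute)
    define k where "k = Suc m"
    define p where "p = q ^ m"
    have p0: "0 < p" using a(2) by (simp add: p_def q_def)
    have a0: "0 < a"
    proof (rule ccontr)
      assume "\<not> 0 < a"
      then have "a * (1 - \<kappa>) \<le> 0" using \<kappa> by (intro mult_nonpos_nonneg) auto
      with a(1) show False by linarith
    qed
    \<comment> \<open>From \<open>{\<delta>..<\<kappa>}\<close> the set is entered within
      \<open>m\<close> steps with probability at least \<open>p\<close>, so being there at time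
      \<open>n\<close> costs a fixed share of survival. As survival converges, the surviving mass in
      this strip tends to 0, and what survives sits below \<delta>.\<close>
    have small: "p * (taboo ?K ^^ n) g y \<le> esc ?K n y - esc ?K (n + k) y" for n
    proof -
      have "esc ?K (n + k) y = (taboo ?K ^^ n) (esc ?K k) y" by (simp add: esc_add)
      also have "\<dots> \<le> (taboo ?K ^^ n) (\<lambda>z. 1 - p * g z) y"
      proof (rule funpow_taboo_mono[OF Kset bounded_measurable_esc[OF Kset] _ _ yS])
        show "bounded_measurable state_space (\<lambda>z. 1 - p * g z)"
          by (intro bounded_measurable_diff bounded_measurable_cmult bounded_measurable_const bg)
        fix z :: real assume z: "z \<in> space state_space"
        show "esc ?K k z \<le> 1 - p * g z"
        proof (cases "z \<in> {\<delta>..<\<kappa>}")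
          case True
          have "\<delta> * (a * (1 - \<kappa>)) ^ m \<le> z * (a * (1 - \<kappa>)) ^ m"
            using True a(1) by (intro mult_right_mono) auto
          with m' have zm: "\<kappa> \<le> z * (a * (1 - \<kappa>)) ^ m" by linarith
          have "0 < z" "z \<le> 1 - \<kappa>" using True \<delta> \<kappa> by auto
          then have "esc ?K k z \<le> 1 - p"
            unfolding k_def p_def q_def by (rule esc_push[OF \<kappa> a0 _ _ zm])
          then show ?thesis using True by (simp add: g_def)
        next
          case False
          then show ?thesis using rng[OF z] by (simp add: g_def)
        qed
      qed
      also have "\<dots> = esc ?K n y - p * (taboo ?K ^^ n) g y"
        using funpow_taboo_diff[OF Kset bounded_measurable_const bg yS, of n 1 p] by (simp add: esc_def)
      finally show ?thesis by simp
    qed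
    have "(\<lambda>n. esc ?K n y - esc ?K (n + k) y) \<longlonglongrightarrow> L - L"
      by (intro tendsto_diff L(1) LIMSEQ_ignore_initial_segment)
    then have "eventually (\<lambda>n. esc ?K n y - esc ?K (n + k) y < p * (L / 3)) sequentially"
      using p0 Lpos by (intro order_tendstoD) auto
    then obtain N1 where N1: "\<And>n. n \<ge> N1 \<Longrightarrow> esc ?K n y - esc ?K (n + k) y < p * (L / 3)"
      unfolding eventually_sequentially by blast
    have low: "2 * L / 3 \<le> (pop ^^ n) ?B x0" if "n \<ge> N1" for n
    proof -
      have "p * (taboo ?K ^^ n) g y < p * (L / 3)" using small[of n] N1[OF that] by linarith
      then have "(taboo ?K ^^ n) g y < L / 3" using p0 by simp
      moreover have "(taboo ?K ^^ n) f y \<le> (pop ^^ n) ?B x0" unfolding B_def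
      proof (rule taboo_coupling[OF \<kappa> \<delta>(2) c(1) bf _ y x0 xcy])
        show "f z \<le> indicator ({0<..<1} \<inter> {..<\<delta>}) z" if "0 < z" "z \<le> 1 - \<kappa>" for z
          using that \<delta> \<kappa> by (auto simp: f_def indicator_def)
      qed
      ultimately show ?thesis using split[of n] L(2)[rule_format, of "Suc n"] by linarith
    qed
    \<comment> \<open>The lower bound \<open>2 * L / 3\<close> holds from time \<open>N1\<close> on,
      hence for at least three quarters of the times 1 to \<open>4 * N\<close>; the average is
      therefore at least \<open>L / 2\<close>.\<close>
    define N where "N = Suc N1"
    have "3 * real N * (2 * L / 3) \<le> (\<Sum>n\<in>{N+1..4*N}. (pop ^^ n) ?B x0)"
    proof -
      have "real (card {N+1..4*N}) * (2 * L / 3) \<le> (\<Sum>n\<in>{N+1..4*N}. (pop ^^ n) ?B x0)"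
        by (rule sum_bounded_below) (use low in \<open>auto simp: N_def\<close>)
      moreover have "real (card {N+1..4*N}) = 3 * real N" by simp
      ultimately show ?thesis by simp
    qed
    also have "\<dots> \<le> (\<Sum>n=1..4*N. (pop ^^ n) ?B x0)"
    proof (rule sum_mono2)
      show "0 \<le> (pop ^^ n) ?B x0" for n
        using measure_nonneg[of "nstep state_space LP n x0" B] by (simp add: measure_nstep[OF xS Bset])
    qed auto
    finally have big: "L / 2 \<le> avg (4 * N) ?B x0" by (simp add: avg_def field_simps N_def)
    have disj: "(pop ^^ n) (indicator C) x0 \<le> 1 - (pop ^^ n) ?B x0" for n
    proof -
      interpret n: prob_space "nstep state_space LP n x0" by (rule prob_space_nstep[OF xS])
      have "C \<inter> B = {}" using s(2) cs by (force simp: B_def)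
      then have "measure (nstep state_space LP n x0) (C \<union> B)
          = measure (nstep state_space LP n x0) C + measure (nstep state_space LP n x0) B"
        using Cset Bset sets_nstep[OF xS] by (intro n.finite_measure_Union) auto
      then show ?thesis using n.prob_le_1[of "C \<union> B"] measure_nstep[OF xS Cset] measure_nstep[OF xS Bset]
        by simp
    qed
    have "avg (4 * N) (indicator C) x0 \<le> (\<Sum>n=1..4*N. 1 - (pop ^^ n) ?B x0) / real (4 * N)"
      unfolding avg_def by (intro divide_right_mono sum_mono disj) auto
    also have "\<dots> = 1 - avg (4 * N) ?B x0"
      by (simp add: avg_def sum_subtractf diff_divide_distrib N_def)
    finally have "avg (4 * N) (indicator C) x0 \<le> 1 - L / 2" using big by linarith
    moreover have "1 - L / 3 \<le> avg (4 * N) (indicator C) x0"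
      using C(3)[rule_format, of "4 * N"] measure_cesaro[OF xS Cset, of "4 * N"] by (simp add: N_def)
    ultimately show False using Lpos by linarith
  qed
  with L0 L(1) show ?thesis by simp
qed

text \<open>One step takes a state above \<open>1 - \<kappa>\<close> to at most
  \<open>4 * \<kappa> \<le> 1 - \<kappa>\<close>, and dominated convergence over that step reduces
  to the lower states.\<close>

lemma esc_tendsto_0:
  assumes \<kappa>: "0 < \<kappa>" "\<kappa> \<le> 1/5" and a: "1 < a * (1 - \<kappa>)" "prob {\<omega>\<in>space M. a \<le> \<epsilon> 1 \<omega>} > 0"
    and x0: "0 < x0" "x0 < 1" and tight: "tight_on {0<..<1} (cesaro state_space LP x0)"
    and y: "0 < y" "y < 1"
  shows "(\<lambda>n. esc {\<kappa>..1-\<kappa>} n y) \<longlonglongrightarrow> 0"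
proof -
  let ?K = "{\<kappa>..1-\<kappa>}"
  have Kset: "?K \<in> sets state_space" using \<kappa> by (auto simp: sets_state_iff)
  have low: "(\<lambda>n. esc ?K n z) \<longlonglongrightarrow> 0" if "0 < z" "z \<le> 1 - \<kappa>" for z
  proof (cases "z < \<kappa>")
    case True
    then show ?thesis using esc_tendsto_0_small[OF assms(1-7) that(1)] by simp
  next
    case False
    then have "(\<lambda>n. esc ?K (Suc n) z) \<longlonglongrightarrow> 0" using that by (simp add: esc_in)
    then show ?thesis by (rule LIMSEQ_imp_Suc)
  qed
  show ?thesis
  proof (cases "y \<le> 1 - \<kappa>")
    case True
    then show ?thesis using low y by simp
  next
    case False
    have "(\<lambda>n. expectation (\<lambda>\<omega>. esc ?K n (\<epsilon> 1 \<omega> * y * (1 - y)))) \<longlonglongrightarrow> expectation (\<lambda>\<omega>. 0)"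
    proof (rule integral_dominated_convergence[where w = "\<lambda>_. 1"])
      show "(\<lambda>\<omega>. esc ?K n (\<epsilon> 1 \<omega> * y * (1 - y))) \<in> borel_measurable M" for n
        by (rule measurable_compose[OF next_measurable[OF y] bounded_measurableD[OF bounded_measurable_esc[OF Kset]]])
      show "AE \<omega> in M. norm (esc ?K n (\<epsilon> 1 \<omega> * y * (1 - y))) \<le> 1" for n
        using esc_range[OF Kset] measurable_space[OF next_measurable[OF y]] by auto
      show "AE \<omega> in M. (\<lambda>n. esc ?K n (\<epsilon> 1 \<omega> * y * (1 - y))) \<longlonglongrightarrow> 0"
      proof (rule AE_I2)
        fix \<omega> assume "\<omega> \<in> space M"
        then have t: "0 < \<epsilon> 1 \<omega>" "\<epsilon> 1 \<omega> < 4" using eps_range by auto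
        have "\<epsilon> 1 \<omega> * y * (1 - y) \<le> 4 * 1 * \<kappa>" using t y False by (intro mult_mono) auto
        then have "\<epsilon> 1 \<omega> * y * (1 - y) \<le> 1 - \<kappa>" using \<kappa> by linarith
        then show "(\<lambda>n. esc ?K n (\<epsilon> 1 \<omega> * y * (1 - y))) \<longlonglongrightarrow> 0"
          using logistic_map_unit(1)[OF t y] by (intro low)
      qed
    qed auto
    moreover have "esc ?K (Suc n) y = expectation (\<lambda>\<omega>. esc ?K n (\<epsilon> 1 \<omega> * y * (1 - y)))" for n
      using False y pop_next[OF y bounded_measurable_esc[OF Kset]]
      by (simp add: esc_Suc taboo_def[of ?K "esc ?K n"] space_state)
    ultimately have "(\<lambda>n. esc ?K (Suc n) y) \<longlonglongrightarrow> 0" by simp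
    then show ?thesis by (rule LIMSEQ_imp_Suc)
  qed
qed

text \<open>The measures \<open>cesaro\<close> once more, as mixtures, so that \<open>integral_bind\<close> computes their integrals.\<close>

definition occ :: "real \<Rightarrow> nat \<Rightarrow> real measure" where
  "occ x N = measure_pmf (pmf_of_set {1..Suc N}) \<bind> (\<lambda>n. nstep state_space LP n x)"

lemma occ_prob:
  assumes "x \<in> space state_space"
  shows "prob_space (occ x N)" "sets (occ x N) = sets state_space"
proof -
  have k: "(\<lambda>n. nstep state_space LP n x) \<in> measurable (measure_pmf (pmf_of_set {1..Suc N})) (subprob_algebra state_space)"
    using prob_space_nstep[OF assms] sets_nstep[OF assms]
    by (auto simp: space_subprob_algebra prob_space_imp_subprob_space)
  show "prob_space (occ x N)" unfolding occ_def
    by (rule prob_space.prob_space_bind[OF measure_pmf.prob_space_axioms _ k])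
       (use prob_space_nstep[OF assms] in auto)
  show "sets (occ x N) = sets state_space" unfolding occ_def
    by (rule sets_bind) (use sets_nstep[OF assms] in auto)
qed

lemma integral_occ:
  assumes "x \<in> space state_space" "bounded_measurable state_space f"
  shows "(\<integral>y. f y \<partial>occ x N) = avg (Suc N) f x"
proof -
  have k: "(\<lambda>n. nstep state_space LP n x) \<in> measurable (measure_pmf (pmf_of_set {1..Suc N})) (subprob_algebra state_space)"
    using prob_space_nstep[OF assms(1)] sets_nstep[OF assms(1)]
    by (auto simp: space_subprob_algebra prob_space_imp_subprob_space)
  obtain C where C: "\<forall>x\<in>space state_space. \<bar>f x\<bar> \<le> C" using assms(2) by (auto simp: bounded_measurable_def)
  have "(\<integral>y. f y \<partial>occ x N) = (\<integral>n. (\<integral>y. f y \<partial>nstep state_space LP n x) \<partial>measure_pmf (pmf_of_set {1..Suc N}))"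
    unfolding occ_def
  proof (rule integral_bind[where K = state_space and B' = 1 and B = C, OF _ _ k])
    show "f \<in> borel_measurable state_space" using assms(2) by (rule bounded_measurableD)
    show "AE n in measure_pmf (pmf_of_set {1..Suc N}).
        emeasure (nstep state_space LP n x) (space (nstep state_space LP n x)) \<le> ennreal 1"
      using prob_space.emeasure_space_1[OF prob_space_nstep[OF assms(1)]] by simp
  qed (use C in \<open>auto intro: measure_pmf.finite_measure_axioms\<close>)
  also have "\<dots> = (\<integral>n. (pop ^^ n) f x \<partial>measure_pmf (pmf_of_set {1..Suc N}))"
    by (simp add: integral_nstep[OF assms])
  also have "\<dots> = (\<Sum>n\<in>{1..Suc N}. (pop ^^ n) f x) / real (card {1..Suc N})"
    by (rule integral_pmf_of_set) auto
  finally show ?thesis by (simp add: avg_def)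
qed

text \<open>Passing from \<open>f\<close> to \<open>pop f\<close> shifts the averaged times by one,
  so only two boundary terms differ. This makes weak limits of the averages invariant.\<close>

lemma avg_pop_diff_tendsto:
  assumes "x \<in> space state_space" "bounded_measurable state_space f"
  shows "(\<lambda>N. avg (Suc N) f x - avg (Suc N) (pop f) x) \<longlonglongrightarrow> 0"
proof -
  obtain C where C: "\<forall>x\<in>space state_space. \<bar>f x\<bar> \<le> C" using assms(2) by (auto simp: bounded_measurable_def)
  have r: "- C \<le> (pop ^^ n) f x \<and> (pop ^^ n) f x \<le> C" for n
    by (rule funpow_pop_bounds[OF assms(2) _ assms(1)]) (use C in fastforce)
  have tele: "(\<Sum>n=1..N. (pop ^^ n) f x) - (\<Sum>n=1..N. (pop ^^ n) (pop f) x) = (pop ^^ 1) f x - (pop ^^ Suc N) f x" for N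
    by (induction N) (auto simp: funpow_swap1)
  have "\<bar>avg (Suc N) f x - avg (Suc N) (pop f) x\<bar> \<le> 2 * C * inverse (real (Suc N))" for N
  proof -
    have "avg (Suc N) f x - avg (Suc N) (pop f) x = ((pop ^^ 1) f x - (pop ^^ Suc (Suc N)) f x) / real (Suc N)"
      unfolding avg_def diff_divide_distrib[symmetric] tele ..
    also have "\<bar>\<dots>\<bar> \<le> 2 * C / real (Suc N)"
      using r[of 1] r[of "Suc (Suc N)"] unfolding abs_divide by (intro frac_le) auto
    finally show ?thesis by (simp only: divide_inverse)
  qed
  note le = this
  have lim: "(\<lambda>N. 2 * C * inverse (real (Suc N))) \<longlonglongrightarrow> 0"
    by (rule tendsto_mult_right_zero[OF LIMSEQ_inverse_real_of_nat])
  show ?thesis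
    by (rule tendsto_rabs_zero_cancel[OF tendsto_sandwich[OF _ _ tendsto_const lim]])
       (intro always_eventually allI abs_ge_zero le)+
qed

section \<open>Feller property and weak limits of the averages\<close>

text \<open>\<open>pop\<close> extended to the whole line, since weak convergence is tested with
  functions continuous there. For bounded measurable \<open>f\<close> the two agree on (0,1) by
  \<open>pop_next\<close>.\<close>

definition lpop :: "(real \<Rightarrow> real) \<Rightarrow> real \<Rightarrow> real" where
  "lpop f x = expectation (\<lambda>\<omega>. f (\<epsilon> 1 \<omega> * x * (1 - x)))"

lemma measurable_next: "f \<in> borel_measurable borel \<Longrightarrow> (\<lambda>\<omega>. f (\<epsilon> 1 \<omega> * x * (1 - x))) \<in> borel_measurable M"
  by (rule measurable_compose[where f = "\<lambda>\<omega>. \<epsilon> 1 \<omega> * x * (1 - x)"]) measurable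

lemma isCont_lpop:
  assumes f: "\<And>x. isCont f x" "\<And>x. \<bar>f x\<bar> \<le> 1"
  shows "isCont (lpop f) x"
proof -
  have fb: "f \<in> borel_measurable borel"
    using f(1) by (intro borel_measurable_continuous_onI continuous_at_imp_continuous_on) auto
  have "continuous_on UNIV (lpop f)"
    unfolding continuous_on_sequentially
  proof (intro allI ballI impI, elim conjE)
    fix X x assume X: "X \<longlonglongrightarrow> (x :: real)"
    have "(\<lambda>n. lpop f (X n)) \<longlonglongrightarrow> lpop f x" unfolding lpop_def
    proof (rule integral_dominated_convergence[where w = "\<lambda>_. 1"])
      show "AE \<omega> in M. (\<lambda>n. f (\<epsilon> 1 \<omega> * X n * (1 - X n))) \<longlonglongrightarrow> f (\<epsilon> 1 \<omega> * x * (1 - x))"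
        by (intro AE_I2 isCont_tendsto_compose[OF f(1)] tendsto_intros X)
    qed (rule measurable_next[OF fb] | use f(2) in simp)+
    then show "(lpop f \<circ> X) \<longlonglongrightarrow> lpop f x" by (simp add: comp_def)
  qed
  then show ?thesis by (simp add: continuous_on_eq_continuous_at)
qed

lemma abs_lpop_le:
  assumes "\<And>x. isCont f x" "\<And>x. \<bar>f x\<bar> \<le> 1" shows "\<bar>lpop f x\<bar> \<le> 1"
proof -
  have fb: "f \<in> borel_measurable borel"
    using assms(1) by (intro borel_measurable_continuous_onI continuous_at_imp_continuous_on) auto
  have "integrable M (\<lambda>\<omega>. f (\<epsilon> 1 \<omega> * x * (1 - x)))"
  proof (rule integrable_const_bound[where B = 1])
    show "AE \<omega> in M. norm (f (\<epsilon> 1 \<omega> * x * (1 - x))) \<le> 1" using assms(2) by simp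
  qed (rule measurable_next[OF fb])
  then have "\<bar>lpop f x\<bar> \<le> expectation (\<lambda>\<omega>. \<bar>f (\<epsilon> 1 \<omega> * x * (1 - x))\<bar>)"
    unfolding lpop_def by (intro integral_abs_bound)
  also have "\<dots> \<le> 1"
    using assms(2) \<open>integrable M _\<close> by (intro integral_le_const) auto
  finally show ?thesis .
qed

text \<open>Weak limits are taken on the real line, where tightness is automatic because all mass
  lies in \<open>{0<..1}\<close>. The danger is mass lost to the end points 0 and 1; tightness on
  the open interval excludes it in \<open>Q01\<close>, and the limit can be restricted to
  (0,1).\<close>

lemma exists_invariant_prob:
  assumes x0: "0 < x0" "x0 < 1" and tight: "tight_on {0<..<1} (cesaro state_space LP x0)"
  shows "\<exists>\<pi>. invariant_prob state_space LP \<pi>"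
proof -
  have xS: "x0 \<in> space state_space" using x0 by (simp add: space_state)
  note occ = occ_prob[OF xS]
  have spo: "space (occ x0 N) = {0<..<1}" for N using sets_eq_imp_space_eq[OF occ(2)[of N]] by (simp add: space_state)
  have idm: "(\<lambda>x. x) \<in> measurable (occ x0 N) borel" for N
    using occ(2)[of N] by (simp add: measurable_restrict_space1 cong: measurable_cong_sets)
  define \<mu> where "\<mu> N = distr (occ x0 N) borel (\<lambda>x. x)" for N
  have rd: "real_distribution (\<mu> N)" for N
    unfolding \<mu>_def by (rule real_distribution.intro[OF prob_space.prob_space_distr[OF occ(1) idm]])
       (simp add: real_distribution_axioms_def)
  have bmS: "bounded_measurable state_space f" if "f \<in> borel_measurable borel" "\<And>x. \<bar>f x\<bar> \<le> 1" for f :: "real \<Rightarrow> real"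
    using that by (intro bounded_measurableI[of _ _ 1] measurable_restrict_space1) auto
  have int\<mu>: "(\<integral>x. f x \<partial>\<mu> N) = avg (Suc N) f x0"
    if "f \<in> borel_measurable borel" "\<And>x. \<bar>f x\<bar> \<le> 1" for f :: "real \<Rightarrow> real" and N
    unfolding \<mu>_def using that by (simp add: integral_distr[OF idm] integral_occ[OF xS bmS])
  have "tight \<mu>"
    unfolding tight_def
  proof (intro conjI allI impI rd)
    fix e :: real assume "0 < e"
    have "measure (\<mu> N) {0<..1} = 1" for N
    proof -
      interpret o: prob_space "occ x0 N" by (rule occ(1))
      have "(\<lambda>x. x) -` {0<..1} \<inter> space (occ x0 N) = space (occ x0 N)" using spo[of N] by auto
      then show ?thesis unfolding \<mu>_def using o.prob_space by (simp add: measure_distr[OF idm])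
    qed
    then show "\<exists>a b. a < b \<and> (\<forall>n. 1 - e < measure (\<mu> n) {a<..b})"
      using \<open>0 < e\<close> by (intro exI[of _ 0] exI[of _ 1]) auto
  qed
  from tight_imp_convergent_subsubsequence[OF this strict_mono_id]
  obtain r Q where r: "strict_mono r" and Q: "real_distribution Q" and wc: "weak_conv_m (\<mu> \<circ> id \<circ> r) Q"
    by blast
  interpret Q: real_distribution Q by (rule Q)
  have conv: "(\<lambda>k. \<integral>x. f x \<partial>\<mu> (r k)) \<longlonglongrightarrow> (\<integral>x. f x \<partial>Q)" if "\<And>x. isCont f x" "\<And>x. \<bar>f x\<bar> \<le> 1" for f :: "real \<Rightarrow> real"
    using weak_conv_imp_integral_bdd_continuous_conv[OF _ Q wc, of f 1] rd that by simp
  have fborel: "f \<in> borel_measurable borel" if "\<And>x. isCont f x" for f :: "real \<Rightarrow> real"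
    using that by (intro borel_measurable_continuous_onI continuous_at_imp_continuous_on) auto
  have Q01: "measure Q {0<..<1} = 1"
  proof (rule antisym)
    show "measure Q {0<..<1} \<le> 1" by simp
    show "1 \<le> measure Q {0<..<1}"
    proof (rule field_le_epsilon)
      fix \<eta> :: real assume "0 < \<eta>"
      from tight[unfolded tight_on_def, rule_format, OF this]
      obtain C where C: "compact C" "C \<subseteq> {0<..<1}"
        "\<forall>n\<ge>1. measure (cesaro state_space LP x0 n) C \<ge> 1 - \<eta>" by (elim exE conjE)
      have Cset: "C \<in> sets state_space" using C by (auto simp: sets_state_iff intro: borel_closed compact_imp_closed)
      have "\<exists>s>0. \<forall>z\<in>C. s \<le> z * (1 - z)"
      proof (cases "C = {}")
        case False
        have "\<exists>z\<in>C. \<forall>w\<in>C. z * (1 - z) \<le> w * (1 - w)"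
          using C(1) False by (intro continuous_attains_inf continuous_intros)
        then obtain z where "z \<in> C" "\<forall>w\<in>C. z * (1 - z) \<le> w * (1 - w)" by blast
        then show ?thesis using C(2) by (intro exI[of _ "z * (1 - z)"]) (auto intro: mult_pos_pos)
      qed (auto intro: exI[of _ 1])
      then obtain s where s: "0 < s" "\<forall>z\<in>C. s \<le> z * (1 - z)" by blast
      \<comment> \<open>A continuous stand-in for the indicator: it is 1 on \<open>C\<close>, where
        \<open>z * (1 - z) \<ge> s\<close>, and 0 outside (0,1), where
        \<open>z * (1 - z) \<le> 0\<close>.\<close>
      define f where "f z = max 0 (min 1 (z * (1 - z) / s))" for z :: real
      have fc: "isCont f z" for z unfolding f_def using s(1) by (intro continuous_intros) auto
      have f01: "0 \<le> f z" "f z \<le> 1" "\<bar>f z\<bar> \<le> 1" for z by (auto simp: f_def)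
      have fC: "f z = 1" if "z \<in> C" for z
      proof -
        have "1 \<le> z * (1 - z) / s" using s that by (simp add: pos_le_divide_eq)
        then show ?thesis by (simp add: f_def)
      qed
      have fout: "f z = 0" if "z \<notin> {0<..<1}" for z
      proof -
        have "z * (1 - z) \<le> 0" using that by (auto simp: mult_le_0_iff)
        then have "z * (1 - z) / s \<le> 0" using s(1) by (simp add: divide_le_0_iff)
        then show ?thesis by (simp add: f_def)
      qed
      have "1 - \<eta> \<le> (\<integral>x. f x \<partial>\<mu> N)" for N
      proof -
        have "1 - \<eta> \<le> avg (Suc N) (indicator C) x0"
          using C(3)[rule_format, of "Suc N"] measure_cesaro[OF xS Cset, of "Suc N"] by simp
        also have "\<dots> = (\<integral>x. indicator C x \<partial>occ x0 N)"
          by (rule integral_occ[OF xS bounded_measurable_indicator[OF Cset], symmetric])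
        also have "\<dots> \<le> (\<integral>x. f x \<partial>occ x0 N)"
          by (rule integral_mono_bounded_measurable[OF bounded_measurable_indicator[OF Cset] bmS occ])
             (use fborel[OF fc] f01 fC in \<open>auto simp: indicator_def\<close>)
        also have "\<dots> = (\<integral>x. f x \<partial>\<mu> N)"
          using int\<mu>[OF fborel[OF fc] f01(3)] integral_occ[OF xS bmS[OF fborel[OF fc] f01(3)]] by simp
        finally show ?thesis .
      qed
      then have "1 - \<eta> \<le> (\<integral>x. f x \<partial>Q)" by (intro LIMSEQ_le_const[OF conv[OF fc f01(3)]]) auto
      also have "\<dots> \<le> (\<integral>x. indicator {0<..<1} x \<partial>Q)"
      proof (rule integral_mono)
        show "integrable Q f" by (rule Q.integrable_const_bound[of _ 1]) (use fborel[OF fc] f01 in auto)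
        show "integrable Q (indicator {0<..<1} :: real \<Rightarrow> real)"
          by (rule Q.integrable_const_bound[of _ 1]) (auto simp: indicator_def)
        show "f z \<le> indicator {0<..<1} z" for z using f01(2) fout by (cases "z \<in> {0<..<1}") auto
      qed
      also have "\<dots> = measure Q {0<..<1}" by simp
      finally show "1 \<le> measure Q {0<..<1} + \<eta>" by simp
    qed
  qed
  have inv: "(\<integral>x. f x \<partial>Q) = (\<integral>x. lpop f x \<partial>Q)" if f: "\<And>x. isCont f x" "\<And>x. \<bar>f x\<bar> \<le> 1" for f :: "real \<Rightarrow> real"
  proof -
    have cl: "\<And>x. isCont (lpop f) x" and al: "\<And>x. \<bar>lpop f x\<bar> \<le> 1"
      using isCont_lpop abs_lpop_le f by auto
    note bf = bmS[OF fborel[OF f(1)] f(2)]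
    have "(\<integral>x. lpop f x \<partial>\<mu> N) = avg (Suc N) (pop f) x0" for N
    proof -
      have "(\<integral>x. lpop f x \<partial>\<mu> N) = (\<integral>x. lpop f x \<partial>occ x0 N)"
        using int\<mu>[OF fborel[OF cl] al] integral_occ[OF xS bmS[OF fborel[OF cl] al]] by simp
      also have "\<dots> = (\<integral>x. pop f x \<partial>occ x0 N)"
        by (rule Bochner_Integration.integral_cong) (use spo pop_next[OF _ _ bf] in \<open>auto simp: lpop_def\<close>)
      also have "\<dots> = avg (Suc N) (pop f) x0" by (rule integral_occ[OF xS bounded_measurable_pop[OF bf]])
      finally show ?thesis .
    qed
    then have "(\<lambda>k. (\<integral>x. f x \<partial>\<mu> (r k)) - (\<integral>x. lpop f x \<partial>\<mu> (r k))) \<longlonglongrightarrow> 0"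
      using LIMSEQ_subseq_LIMSEQ[OF avg_pop_diff_tendsto[OF xS bf] r] int\<mu>[OF fborel[OF f(1)] f(2)]
      by (simp add: comp_def)
    moreover have "(\<lambda>k. (\<integral>x. f x \<partial>\<mu> (r k)) - (\<integral>x. lpop f x \<partial>\<mu> (r k))) \<longlonglongrightarrow> (\<integral>x. f x \<partial>Q) - (\<integral>x. lpop f x \<partial>Q)"
      by (intro tendsto_diff conv f cl al)
    ultimately show ?thesis using LIMSEQ_unique by fastforce
  qed
  define \<pi> where "\<pi> = restrict_space Q {0<..<1}"
  have s\<pi>: "sets \<pi> = sets state_space" unfolding \<pi>_def by (rule sets_restrict_space_cong) simp
  have p\<pi>: "prob_space \<pi>" unfolding \<pi>_def
    by (rule prob_space_restrict_space) (use Q01 in \<open>simp_all add: Q.emeasure_eq_measure\<close>)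
  interpret \<pi>: prob_space \<pi> by (rule p\<pi>)
  have AE01: "AE x in Q. x \<in> {0<..<1}" using Q01 by (intro Q.AE_prob_1) simp
  have int\<pi>: "(\<integral>x. f x \<partial>\<pi>) = (\<integral>x. f x \<partial>Q)" if "f \<in> borel_measurable borel" for f :: "real \<Rightarrow> real"
  proof -
    have "(\<integral>x. f x \<partial>\<pi>) = (\<integral>x. indicator {0<..<1} x *\<^sub>R f x \<partial>Q)"
      unfolding \<pi>_def by (rule integral_restrict_space) simp
    also have "\<dots> = (\<integral>x. f x \<partial>Q)"
      by (rule integral_cong_AE) (use that AE01 in auto)
    finally show ?thesis .
  qed
  have sp\<pi>: "space \<pi> = {0<..<1}" using sets_eq_imp_space_eq[OF s\<pi>] by (simp add: space_state)
  have km: "LP \<in> measurable \<pi> (subprob_algebra state_space)"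
    using measurable_prob_algebraD[OF P_measurable] s\<pi> by (simp cong: measurable_cong_sets)
  have sb: "sets (\<pi> \<bind> LP) = sets state_space"
    by (rule sets_bind) (use sets_P sp\<pi> space_state \<pi>.not_empty in auto)
  have pb: "prob_space (\<pi> \<bind> LP)"
    by (rule prob_space.prob_space_bind[OF p\<pi> _ km]) (use prob_space_P sp\<pi> space_state in auto)
  have idb: "(\<lambda>x. x) \<in> measurable (\<pi> \<bind> LP) borel"
    using sb by (simp add: measurable_restrict_space1 cong: measurable_cong_sets)
  define Q' where "Q' = distr (\<pi> \<bind> LP) borel (\<lambda>x. x)"
  have Q': "real_distribution Q'"
    unfolding Q'_def by (rule real_distribution.intro[OF prob_space.prob_space_distr[OF pb idb]])
       (simp add: real_distribution_axioms_def)
  interpret Q': real_distribution Q' by (rule Q')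
  have eqf: "(\<integral>x. f x \<partial>Q') = (\<integral>x. f x \<partial>Q)" if f: "\<And>x. isCont f x" "\<And>x. \<bar>f x\<bar> \<le> 1" for f :: "real \<Rightarrow> real"
  proof -
    note fb = fborel[OF f(1)]
    note bf = bmS[OF fb f(2)]
    have "(\<integral>x. f x \<partial>Q') = (\<integral>x. f x \<partial>(\<pi> \<bind> LP))" unfolding Q'_def by (rule integral_distr[OF idb fb])
    also have "\<dots> = (\<integral>x. pop f x \<partial>\<pi>)" unfolding pop_def
    proof (rule integral_bind[where K = state_space and B' = 1 and B = 1, OF _ _ km])
      show "f \<in> borel_measurable state_space" by (rule bounded_measurableD[OF bf])
      show "AE x in \<pi>. emeasure (LP x) (space (LP x)) \<le> ennreal 1"
        using prob_space.emeasure_space_1[OF prob_space_P] sp\<pi> by (auto simp: space_state)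
    qed (use f(2) in \<open>auto intro: \<pi>.finite_measure_axioms\<close>)
    also have "\<dots> = (\<integral>x. lpop f x \<partial>\<pi>)"
      by (rule Bochner_Integration.integral_cong) (use sp\<pi> pop_next[OF _ _ bf] in \<open>auto simp: lpop_def\<close>)
    also have "\<dots> = (\<integral>x. lpop f x \<partial>Q)" by (rule int\<pi>[OF fborel[OF isCont_lpop[OF f]]])
    also have "\<dots> = (\<integral>x. f x \<partial>Q)" by (rule inv[OF f, symmetric])
    finally show ?thesis .
  qed
  \<comment> \<open>Cosine and sine are continuous and bounded by 1, so \<open>eqf\<close>
    identifies real and imaginary parts of the characteristic functions.\<close>
  have "char Q' = char Q"
  proof
    fix t
    have ie: "integrable R (\<lambda>x. iexp (t * x))" if "real_distribution R" for R
    proof -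
      interpret R: real_distribution R by (rule that)
      show ?thesis by (rule R.integrable_const_bound[of _ 1]) auto
    qed
    have re: "Re (iexp (t * x)) = cos (t * x)" and im: "Im (iexp (t * x)) = sin (t * x)" for x
      by (simp_all add: Re_exp Im_exp)
    have "Re (char R t) = (\<integral>x. cos (t * x) \<partial>R)" "Im (char R t) = (\<integral>x. sin (t * x) \<partial>R)"
      if "real_distribution R" for R
      unfolding char_def integral_Re[OF ie[OF that], symmetric] integral_Im[OF ie[OF that], symmetric] re im
      by (rule refl)+
    note char_eq = this
    have "Re (char Q' t) = Re (char Q t)"
      using eqf[of "\<lambda>x. cos (t * x)"] by (simp add: char_eq[OF Q] char_eq[OF Q'])
    moreover have "Im (char Q' t) = Im (char Q t)"
      using eqf[of "\<lambda>x. sin (t * x)"] by (simp add: char_eq[OF Q] char_eq[OF Q'])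
    ultimately show "char Q' t = char Q t" by (rule complex_eqI)
  qed
  then have QQ: "Q' = Q" by (rule Levy_uniqueness[OF Q' Q])
  have "invariant_prob state_space LP \<pi>"
    unfolding invariant_prob_def
  proof (intro conjI ballI p\<pi> s\<pi>)
    fix B assume B: "B \<in> sets state_space"
    then have Bb: "B \<in> sets borel" "B \<subseteq> {0<..<1}" by (auto simp: sets_state_iff)
    have "emeasure \<pi> B = emeasure Q B" unfolding \<pi>_def using Bb by (intro emeasure_restrict_space) auto
    also have "\<dots> = emeasure Q' B" by (simp add: QQ)
    also have "\<dots> = emeasure (\<pi> \<bind> LP) B"
    proof -
      have "(\<lambda>x. x) -` B \<inter> space (\<pi> \<bind> LP) = B"
        using Bb(2) sets_eq_imp_space_eq[OF sb] by (auto simp: space_state)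
      then show ?thesis unfolding Q'_def using emeasure_distr[OF idb Bb(1)] by simp
    qed
    also have "\<dots> = (\<integral>\<^sup>+x. emeasure (LP x) B \<partial>\<pi>)" by (rule emeasure_bind[OF \<pi>.not_empty km B])
    finally show "emeasure \<pi> B = (\<integral>\<^sup>+x. emeasure (LP x) B \<partial>\<pi>)" .
  qed
  then show ?thesis by blast
qed

end

section \<open>Minorization\<close>

lemma fmeasurable_unit: "B \<in> sets borel \<Longrightarrow> B \<subseteq> {0<..<1::real} \<Longrightarrow> B \<in> fmeasurable lborel"
  by (rule fmeasurableI2[of "{0<..<1}"]) (auto simp: fmeasurable_def)

lemma measure_lborel_open_pos:
  assumes "open V" "V \<noteq> {}" "V \<subseteq> {0<..<1::real}" shows "0 < measure lborel V"
proof -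
  obtain z where "z \<in> V" using assms by blast
  then obtain e where e: "e > 0" "ball z e \<subseteq> V" using assms(1) by (auto simp: open_contains_ball)
  have "{z-e<..<z+e} \<subseteq> V" using e(2) by (auto simp: dist_real_def subset_iff)
  then have "measure lborel {z-e<..<z+e} \<le> measure lborel V"
    using assms by (intro measure_mono_fmeasurable fmeasurable_unit) auto
  then show ?thesis using e(1) by simp
qed

locale logistic_density = logistic M \<epsilon> for M :: "'w measure" and \<epsilon> +
  fixes a b c :: real
  assumes ab: "1 < a" "a < b" "b < 4" and c: "0 < c"
    and dens: "\<And>B. B \<in> sets borel \<Longrightarrow>
      c * measure lborel (B \<inter> {a<..<b}) \<le> prob {\<omega>\<in>space M. \<epsilon> 1 \<omega> \<in> B}"
begin

text \<open>With \<open>s = x * (1 - x)\<close> the next state is the parameter times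
  \<open>s\<close>. The substitution divides the density bound by \<open>s \<le> 1 / 4\<close>,
  hence the factor 4.\<close>

lemma pop_indicator_lower:
  assumes x: "0 < x" "x < 1" and B: "B \<in> sets state_space"
  shows "4 * c * measure lborel (B \<inter> {a * (x * (1 - x))<..<b * (x * (1 - x))}) \<le> pop (indicator B) x"
proof -
  define s where "s = x * (1 - x)"
  have s: "0 < s" using x by (simp add: s_def)
  have s4: "4 * s \<le> 1" using mult_one_minus_le_quarter[of x] by (simp add: s_def)
  have Bb [measurable]: "B \<in> sets borel" using B by (simp add: sets_state_iff)
  define A where "A = {t. t * s \<in> B}"
  have "(\<lambda>t::real. t * s) \<in> borel_measurable borel" by measurable
  from measurable_sets[OF this Bb] have Ab: "A \<in> sets borel" by (simp add: A_def vimage_def)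
  have "emeasure lborel (B \<inter> {a * s<..<b * s}) = (\<integral>\<^sup>+t. indicator (B \<inter> {a * s<..<b * s}) t \<partial>lborel)"
    by simp
  also have "\<dots> = ennreal \<bar>s\<bar> * (\<integral>\<^sup>+t. indicator (B \<inter> {a * s<..<b * s}) (0 + s * t) \<partial>lborel)"
    using s by (intro nn_integral_real_affine) auto
  also have "(\<integral>\<^sup>+t. indicator (B \<inter> {a * s<..<b * s}) (0 + s * t) \<partial>lborel)
      = (\<integral>\<^sup>+t. indicator (A \<inter> {a<..<b}) t \<partial>lborel)"
    using s by (intro nn_integral_cong) (auto simp: indicator_def A_def mult.commute)
  also have "\<dots> = emeasure lborel (A \<inter> {a<..<b})" using Ab by simp
  finally have "measure lborel (B \<inter> {a * s<..<b * s}) = s * measure lborel (A \<inter> {a<..<b})"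
    using s by (simp add: measure_def enn2real_mult)
  then have "4 * c * measure lborel (B \<inter> {a * s<..<b * s}) = (4 * s) * (c * measure lborel (A \<inter> {a<..<b}))"
    by simp
  also have "\<dots> \<le> 1 * (c * measure lborel (A \<inter> {a<..<b}))"
    using s4 c by (intro mult_right_mono) auto
  also have "\<dots> \<le> prob {\<omega>\<in>space M. \<epsilon> 1 \<omega> \<in> A}" using dens[OF Ab] by simp
  also have "\<dots> = pop (indicator B) x"
  proof -
    have "{\<omega>\<in>space M. \<epsilon> 1 \<omega> \<in> A} = \<epsilon> 1 -` A \<inter> space M" by auto
    then have ev: "{\<omega>\<in>space M. \<epsilon> 1 \<omega> \<in> A} \<in> events" using measurable_sets[OF eps_measurable Ab] by simp
    have "pop (indicator B) x = expectation (\<lambda>\<omega>. indicator B (\<epsilon> 1 \<omega> * x * (1 - x)))"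
      by (rule pop_next[OF x bounded_measurable_indicator[OF B]])
    also have "\<dots> = expectation (indicator {\<omega>\<in>space M. \<epsilon> 1 \<omega> \<in> A})"
      by (rule Bochner_Integration.integral_cong) (auto simp: indicator_def A_def s_def mult.assoc)
    also have "\<dots> = prob ({\<omega>\<in>space M. \<epsilon> 1 \<omega> \<in> A} \<inter> space M)" using ev by simp
    also have "{\<omega>\<in>space M. \<epsilon> 1 \<omega> \<in> A} \<inter> space M = {\<omega>\<in>space M. \<epsilon> 1 \<omega> \<in> A}" by auto
    finally show ?thesis ..
  qed
  finally show ?thesis by (simp only: s_def)
qed

text \<open>A minorization by Lebesgue measure on \<open>V\<close>, uniform over starting points
  near a given one. Openness of \<open>U\<close> and \<open>V\<close> is what allows two such
  statements to be chained.\<close>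

definition spreads :: "nat \<Rightarrow> real set \<Rightarrow> real set \<Rightarrow> real \<Rightarrow> bool" where
  "spreads n U V \<delta> \<longleftrightarrow> open U \<and> open V \<and> V \<subseteq> {0<..<1} \<and> 0 < \<delta> \<and>
     (\<forall>x\<in>U \<inter> {0<..<1}. \<forall>B\<in>sets state_space.
        \<delta> * measure lborel (B \<inter> V) \<le> measure (nstep state_space LP n x) B)"

text \<open>An interval around \<open>y\<close> with end points strictly inside the reachable
  interval of \<open>x\<close> stays inside that of every state near \<open>x\<close>, by
  continuity.\<close>

lemma spreads_step:
  assumes x: "0 < x" "x < 1" and xy: "lstep a b x y"
  shows "\<exists>n U V \<delta>. x \<in> U \<and> y \<in> V \<and> spreads n U V \<delta>"
proof -
  have y: "a * (x * (1 - x)) < y" "y < b * (x * (1 - x))" using lstep_iff[OF x] xy by auto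
  obtain y0 y1 where y01: "a * (x * (1 - x)) < y0" "y0 < y" "y < y1" "y1 < b * (x * (1 - x))"
    using dense[OF y(1)] dense[OF y(2)] by blast
  have "0 < x * (1 - x)" using x by simp
  have "0 < a" using ab by simp
  from mult_pos_pos[OF this \<open>0 < x * (1 - x)\<close>] have "0 < a * (x * (1 - x))" .
  then have y0: "0 < y0" using y01 by linarith
  have "b * (x * (1 - x)) \<le> 4 * (1 / 4)" using mult_one_minus_le_quarter ab less_imp_le[OF \<open>0 < x * (1 - x)\<close>] by (intro mult_mono) (assumption | simp)+
  then have y1: "y1 < 1" using y01 by linarith
  define U where "U = {z. a * (z * (1 - z)) < y0} \<inter> {z. y1 < b * (z * (1 - z))}"
  have "spreads 1 U {y0<..<y1} (4 * c)"
    unfolding spreads_def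
  proof (intro conjI ballI)
    show "open U" unfolding U_def by (intro open_Int open_Collect_less continuous_intros)
    show "{y0<..<y1} \<subseteq> {0<..<1}" using y0 y1 by auto
    show "0 < 4 * c" using c by simp
    fix z B assume z: "z \<in> U \<inter> {0<..<1}" and B: "B \<in> sets state_space"
    then have z01: "0 < z" "z < 1" by auto
    have "measure lborel (B \<inter> {y0<..<y1}) \<le> measure lborel (B \<inter> {a * (z * (1 - z))<..<b * (z * (1 - z))})"
      using B z by (intro measure_mono_fmeasurable fmeasurable_unit) (auto simp: sets_state_iff U_def)
    then have "4 * c * measure lborel (B \<inter> {y0<..<y1})
        \<le> 4 * c * measure lborel (B \<inter> {a * (z * (1 - z))<..<b * (z * (1 - z))})"
      using c by (intro mult_left_mono) auto
    also have "\<dots> \<le> pop (indicator B) z" by (rule pop_indicator_lower[OF z01 B])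
    also have "\<dots> = measure (nstep state_space LP 1 z) B"
      using measure_nstep[of z B 1] z01 B by (simp add: space_state)
    finally show "4 * c * measure lborel (B \<inter> {y0<..<y1}) \<le> measure (nstep state_space LP 1 z) B" .
  qed auto
  moreover have "x \<in> U" using y01 by (simp add: U_def)
  moreover have "y \<in> {y0<..<y1}" using y01 by simp
  ultimately show ?thesis by blast
qed

text \<open>The path goes through \<open>V \<inter> U'\<close>, which is open and nonempty and thus
  has positive length; that length is the third factor of the new constant.\<close>

lemma spreads_comp:
  assumes 1: "spreads m U V \<delta>" and 2: "spreads k U' V' \<delta>'" and ne: "V \<inter> U' \<noteq> {}"
  shows "\<exists>\<delta>''. spreads (m + k) U V' \<delta>''"
proof -
  let ?W = "V \<inter> U'"
  have W: "open ?W" "?W \<subseteq> {0<..<1}" using 1 2 by (auto simp: spreads_def)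
  have Wset: "?W \<in> sets state_space" using W by (auto simp: sets_state_iff)
  have w: "0 < measure lborel ?W" by (rule measure_lborel_open_pos[OF W(1) ne W(2)])
  define \<delta>'' where "\<delta>'' = \<delta>' * (\<delta> * measure lborel ?W)"
  have d: "0 < \<delta>" "0 < \<delta>'" using 1 2 by (auto simp: spreads_def)
  have "spreads (m + k) U V' \<delta>''"
    unfolding spreads_def
  proof (intro conjI ballI)
    show "0 < \<delta>''" using d w by (simp add: \<delta>''_def)
    fix x B assume x: "x \<in> U \<inter> {0<..<1}" and B: "B \<in> sets state_space"
    have xS: "x \<in> space state_space" using x by (simp add: space_state)
    have ind: "bounded_measurable state_space (indicator B)" by (rule bounded_measurable_indicator[OF B])
    have indW: "bounded_measurable state_space (indicator ?W)" by (rule bounded_measurable_indicator[OF Wset])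
    let ?l = "\<delta>' * measure lborel (B \<inter> V')"
    let ?\<mu> = "nstep state_space LP m x"
    have "\<delta> * measure lborel (?W \<inter> V) \<le> measure ?\<mu> ?W" using 1 x Wset by (auto simp: spreads_def)
    also have "?W \<inter> V = ?W" by auto
    finally have "?l * (\<delta> * measure lborel ?W) \<le> ?l * measure ?\<mu> ?W"
      using d by (intro mult_left_mono) auto
    also have "\<dots> = ?l * (\<integral>y. indicator ?W y \<partial>?\<mu>)"
      using integral_nstep[OF xS indW, of m] measure_nstep[OF xS Wset, of m] by simp
    also have "\<dots> = (\<integral>y. ?l * indicator ?W y \<partial>?\<mu>)" by simp
    also have "\<dots> \<le> (\<integral>y. (pop ^^ k) (indicator B) y \<partial>?\<mu>)"
    proof (rule integral_mono_bounded_measurable[OF _ _ prob_space_nstep[OF xS] sets_nstep[OF xS]])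
      show "bounded_measurable state_space (\<lambda>y. ?l * indicator ?W y)"
        by (rule bounded_measurable_cmult[OF indW])
      show "bounded_measurable state_space ((pop ^^ k) (indicator B))"
        by (rule bounded_measurable_funpow_pop[OF ind])
      fix y :: real assume y: "y \<in> space state_space"
      have eq: "(pop ^^ k) (indicator B) y = measure (nstep state_space LP k y) B"
        by (rule measure_nstep[OF y B, symmetric])
      show "?l * indicator ?W y \<le> (pop ^^ k) (indicator B) y"
      proof (cases "y \<in> ?W")
        case True
        then have "?l \<le> measure (nstep state_space LP k y) B"
          using 2 y B by (auto simp: spreads_def space_state)
        then show ?thesis using True by (simp add: eq)
      qed (simp add: eq)
    qed
    also have "\<dots> = (pop ^^ m) ((pop ^^ k) (indicator B)) x"
      by (rule integral_nstep[OF xS bounded_measurable_funpow_pop[OF ind]])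
    also have "\<dots> = measure (nstep state_space LP (m + k) x) B"
      by (simp add: measure_nstep[OF xS B] funpow_add)
    finally show "\<delta>'' * measure lborel (B \<inter> V') \<le> measure (nstep state_space LP (m + k) x) B"
      by (simp add: \<delta>''_def mult_ac)
  qed (use 1 2 in \<open>auto simp: spreads_def\<close>)
  then show ?thesis by blast
qed

lemma spreads_reach:
  assumes "(lstep a b)\<^sup>+\<^sup>+ x y" and x: "0 < x" "x < 1"
  shows "\<exists>n U V \<delta>. x \<in> U \<and> y \<in> V \<and> spreads n U V \<delta>"
  using assms(1)
proof (induction rule: tranclp_induct)
  case (base y)
  then show ?case by (rule spreads_step[OF x])
next
  case (step y w)
  from step.IH obtain n U V \<delta> where 1: "x \<in> U" "y \<in> V" "spreads n U V \<delta>" by blast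
  then have "0 < y" "y < 1" by (auto simp: spreads_def)
  from spreads_step[OF this step.hyps(2)]
  obtain n' U' V' \<delta>' where 2: "y \<in> U'" "w \<in> V'" "spreads n' U' V' \<delta>'" by blast
  have "V \<inter> U' \<noteq> {}" using 1 2 by blast
  from spreads_comp[OF 1(3) 2(3) this] 1 2 show ?case by blast
qed

text \<open>Every state reaches \<open>q\<close>, and a neighbourhood of \<open>q\<close> spreads
  over a fixed \<open>V\<close>. So each state has a neighbourhood spreading over the same
  \<open>V\<close>, and \<phi> is uniform on it. On a compact set finitely many neighbourhoods
  suffice, which gives one \<beta>, but not one number of steps.\<close>

lemma minorization:
  obtains \<phi> where "prob_space \<phi>" "sets \<phi> = sets state_space"
    "\<forall>K. compact K \<longrightarrow> K \<subseteq> {0<..<1} \<longrightarrow> (\<exists>\<beta>>0. \<beta> \<le> 1 \<and>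
      (\<forall>x\<in>K. \<exists>n. \<forall>B\<in>sets state_space. \<beta> * measure \<phi> B \<le> measure (nstep state_space LP n x) B))"
proof -
  obtain q where q: "0 < q" "q < 1" "\<And>x. 0 < x \<Longrightarrow> x < 1 \<Longrightarrow> (lstep a b)\<^sup>+\<^sup>+ x q"
    by (rule lstep_hub[OF ab]) blast
  from spreads_reach[OF q(3)[OF q(1,2)] q(1,2)]
  obtain k U' V \<delta>' where V: "q \<in> U'" "q \<in> V" "spreads k U' V \<delta>'" by blast
  have oV: "open V" "V \<subseteq> {0<..<1}" using V(3) by (auto simp: spreads_def)
  have loc: "\<exists>U n \<delta>. x \<in> U \<and> spreads n U V \<delta>" if x: "x \<in> {0<..<1}" for x
  proof -
    have "0 < x" "x < 1" using x by auto
    from spreads_reach[OF q(3)[OF this] this]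
    obtain n U W \<delta> where 1: "x \<in> U" "q \<in> W" "spreads n U W \<delta>" by blast
    then have "W \<inter> U' \<noteq> {}" using V by blast
    from spreads_comp[OF 1(3) V(3) this] 1 show ?thesis by blast
  qed
  define l where "l = measure lborel V"
  have l: "0 < l" unfolding l_def by (rule measure_lborel_open_pos[OF oV(1) _ oV(2)]) (use V in blast)
  have efin: "emeasure lborel V = ennreal l" unfolding l_def
    using fmeasurable_unit[of V] oV by (intro emeasure_eq_measure2) auto
  have e: "emeasure lborel V \<noteq> 0" "emeasure lborel V \<noteq> \<infinity>" using efin l by auto
  define \<phi> where "\<phi> = restrict_space (uniform_measure lborel V) {0<..<1}"
  have mU: "measure (uniform_measure lborel V) B = measure lborel (V \<inter> B) / l" if "B \<in> sets lborel" for B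
    using measure_uniform_measure[OF e that] by (simp add: l_def)
  have m\<phi>: "measure \<phi> B = measure lborel (B \<inter> V) / l" if "B \<in> sets state_space" for B
    using that mU[of B] unfolding \<phi>_def by (subst measure_restrict_space) (auto simp: sets_state_iff Int_commute)
  have "sets \<phi> = sets state_space" unfolding \<phi>_def by (rule sets_restrict_space_cong) simp
  moreover have "prob_space \<phi>" unfolding \<phi>_def
  proof (rule prob_space_restrict_space)
    interpret u: prob_space "uniform_measure lborel V" by (rule prob_space_uniform_measure[OF e])
    have "V \<inter> {0<..<1} = V" using oV by auto
    then show "emeasure (uniform_measure lborel V) {0<..<1} = 1"
      using mU[of "{0<..<1}"] l by (simp add: u.emeasure_eq_measure l_def)
  qed simp
  moreover have "\<exists>\<beta>>0. \<beta> \<le> 1 \<and>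
      (\<forall>x\<in>K. \<exists>n. \<forall>B\<in>sets state_space. \<beta> * measure \<phi> B \<le> measure (nstep state_space LP n x) B)"
    if K: "compact K" "K \<subseteq> {0<..<1}" for K
  proof -
    from loc K(2) have "\<forall>x\<in>K. \<exists>U n \<delta>. x \<in> U \<and> spreads n U V \<delta>" by blast
    then obtain U n \<delta> where U: "\<And>x. x \<in> K \<Longrightarrow> x \<in> U x \<and> spreads (n x) (U x) V (\<delta> x)" by metis
    have "K \<subseteq> (\<Union>x\<in>K. U x)" using U by blast
    moreover have "\<And>x. x \<in> K \<Longrightarrow> open (U x)" using U by (auto simp: spreads_def)
    ultimately obtain C where C: "C \<subseteq> K" "finite C" "K \<subseteq> (\<Union>x\<in>C. U x)"
      using compactE_image[OF K(1), of K U] by blast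
    \<comment> \<open>The entry 1 secures \<open>\<beta> \<le> 1\<close> and a nonempty set under
      the minimum; the factor \<open>l\<close> turns Lebesgue measure on \<open>V\<close> into
      \<phi>.\<close>
    define \<beta> where "\<beta> = Min (insert 1 ((\<lambda>x. \<delta> x * l) ` C))"
    have \<beta>: "0 < \<beta>" "\<beta> \<le> 1" unfolding \<beta>_def using C U l by (auto simp: spreads_def subset_iff)
    have "\<exists>n. \<forall>B\<in>sets state_space. \<beta> * measure \<phi> B \<le> measure (nstep state_space LP n x) B" if x: "x \<in> K" for x
    proof -
      obtain z where z: "z \<in> C" "x \<in> U z" using C(3) x by blast
      have "\<beta> * measure \<phi> B \<le> measure (nstep state_space LP (n z) x) B" if B: "B \<in> sets state_space" for B
      proof -
        have "\<beta> \<le> \<delta> z * l" unfolding \<beta>_def using z C by (intro Min_le) auto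
        then have "\<beta> * measure \<phi> B \<le> \<delta> z * l * measure \<phi> B" by (intro mult_right_mono) auto
        also have "\<dots> = \<delta> z * measure lborel (B \<inter> V)" using l by (simp add: m\<phi>[OF B])
        also have "\<dots> \<le> measure (nstep state_space LP (n z) x) B"
          using U[of z] z C(1) x K(2) B by (auto simp: spreads_def)
        finally show ?thesis .
      qed
      then show ?thesis by blast
    qed
    with \<beta> show ?thesis by blast
  qed
  ultimately show thesis by (intro that[of \<phi>]) auto
qed

end

text \<open>The singular part only adds mass, so the absolutely continuous part alone bounds the law
  of the noise from below.\<close>

lemma lebesgue_decomposition_lower_bound:
  assumes "prob_space M" and e: "e \<in> measurable M param_space"
    and ld: "lebesgue_decomposition (restrict_space lborel {0<..<4}) (distr M param_space e) h \<sigma>"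
    and uv: "0 \<le> u" "v \<le> 4" and "0 < c" and h: "\<And>t. u < t \<Longrightarrow> t < v \<Longrightarrow> ennreal c \<le> h t"
    and B: "B \<in> sets borel"
  shows "c * measure lborel (B \<inter> {u<..<v}) \<le> measure M {\<omega>\<in>space M. e \<omega> \<in> B}"
proof -
  interpret prob_space M by fact
  let ?\<mu> = "restrict_space lborel {0<..<4::real}"
  define A where "A = B \<inter> {u<..<v}"
  have A04: "A \<subseteq> {0<..<4}" using uv by (auto simp: A_def)
  have Ab: "A \<in> sets borel" using B by (simp add: A_def)
  have As: "A \<in> sets ?\<mu>" "A \<in> sets param_space" using A04 Ab by (simp_all add: sets_restrict_space_iff)
  have hm: "h \<in> borel_measurable ?\<mu>" using ld by (simp add: lebesgue_decomposition_def)
  have fin: "emeasure lborel A \<noteq> \<infinity>"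
  proof -
    have "emeasure lborel A \<le> emeasure lborel {0<..<4::real}" using A04 by (intro emeasure_mono) auto
    then show ?thesis by (auto simp: top_unique)
  qed
  have em: "e \<in> borel_measurable M" using e by (simp add: measurable_restrict_space2_iff)
  have "ennreal c * emeasure lborel A = ennreal c * emeasure ?\<mu> A"
    using A04 by (subst emeasure_restrict_space) auto
  also have "\<dots> = (\<integral>\<^sup>+t. ennreal c * indicator A t \<partial>?\<mu>)"
    by (rule nn_integral_cmult_indicator[OF As(1), symmetric])
  also have "\<dots> \<le> (\<integral>\<^sup>+t. h t * indicator A t \<partial>?\<mu>)"
    using h by (intro nn_integral_mono) (auto simp: indicator_def A_def)
  also have "\<dots> = emeasure (density ?\<mu> h) A" using hm As by (simp add: emeasure_density)
  also have "\<dots> \<le> emeasure (distr M param_space e) A"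
    using ld As by (auto simp: lebesgue_decomposition_def)
  also have "\<dots> = emeasure M (e -` A \<inter> space M)" by (rule emeasure_distr[OF e As(2)])
  also have "\<dots> \<le> emeasure M {\<omega>\<in>space M. e \<omega> \<in> B}"
  proof (rule emeasure_mono)
    show "{\<omega>\<in>space M. e \<omega> \<in> B} \<in> sets M"
      using measurable_sets[OF em B] by (simp add: vimage_def Int_def conj_commute)
  qed (auto simp: A_def)
  finally have le: "ennreal c * emeasure lborel A \<le> ennreal (measure M {\<omega>\<in>space M. e \<omega> \<in> B})"
    by (simp add: emeasure_eq_measure)
  have "emeasure lborel A = ennreal (measure lborel A)" using fin by (intro emeasure_eq_ennreal_measure) simp
  with le show ?thesis using \<open>0 < c\<close> by (simp add: A_def flip: ennreal_mult)
qed

theorem theorem2p1: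
  fixes M :: "'w measure"
    and \<epsilon> X :: "nat \<Rightarrow> 'w \<Rightarrow> real"
    and h :: "real \<Rightarrow> ennreal" and \<sigma> :: "real measure" and J :: "real set" and c :: real
  defines "P \<equiv> logistic_kernel M \<epsilon>"
  assumes "prob_space M"
    and "prob_space.indep_vars M (\<lambda>_. param_space) \<epsilon> {1..}"
    and "\<And>n. n \<ge> 1 \<Longrightarrow> distr M param_space (\<epsilon> n) = distr M param_space (\<epsilon> 1)"
    and "X 0 \<in> measurable M state_space"
    and "prob_space.indep_set M
           (sets (vimage_algebra (space M) (X 0) state_space))
           (sets (vimage_algebra (space M) (\<lambda>\<omega>. \<lambda>n\<in>{1..}. \<epsilon> n \<omega>)
              (Pi\<^sub>M {1..} (\<lambda>_. param_space))))"
    and "\<And>n \<omega>. \<omega> \<in> space M \<Longrightarrow> X (Suc n) \<omega> = \<epsilon> (Suc n) \<omega> * X n \<omega> * (1 - X n \<omega>)"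
    and "lebesgue_decomposition (restrict_space lborel {0<..<4})
           (distr M param_space (\<epsilon> 1)) h \<sigma>"
    and "emeasure (density (restrict_space lborel {0<..<4}) h) {0<..<4} \<noteq> 0"
    and "is_interval J" and "J \<subseteq> {1<..<4}" and "\<exists>u\<in>J. \<exists>v\<in>J. u < v"
    and "c > 0" and "\<And>t. t \<in> J \<Longrightarrow> h t \<ge> ennreal c"
    and "\<exists>x\<in>{0<..<1}. tight_on {0<..<1} (cesaro state_space P x)"
  shows "(Harris_recurrent state_space P \<and> (\<exists>!\<pi>. invariant_prob state_space P \<pi>)) \<and>
         (\<forall>\<pi>. invariant_prob state_space P \<pi> \<longrightarrow>
            (\<forall>x\<in>{0<..<1}. (\<lambda>N. tv_dist state_space (cesaro state_space P x N) \<pi>) \<longlonglongrightarrow> 0))"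
proof -
  interpret prob_space M by fact
  have eps: "\<epsilon> 1 \<in> measurable M param_space"
    using \<open>indep_vars (\<lambda>_. param_space) \<epsilon> {1..}\<close> by (simp add: indep_vars_def)
  obtain u v where uv: "u \<in> J" "v \<in> J" "u < v" using \<open>\<exists>u\<in>J. \<exists>v\<in>J. u < v\<close> by blast
  then have ab: "1 < u" "u < v" "v < 4" using \<open>J \<subseteq> {1<..<4}\<close> by auto
  have J: "t \<in> J" if "u < t" "t < v" for t
    using \<open>is_interval J\<close> uv that unfolding is_interval_1 by (meson less_imp_le)
  interpret logistic_density M \<epsilon> u v c
  proof unfold_locales
    show "c * measure lborel (B \<inter> {u<..<v}) \<le> prob {\<omega>\<in>space M. \<epsilon> 1 \<omega> \<in> B}" if "B \<in> sets borel" for B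
      by (rule lebesgue_decomposition_lower_bound[OF \<open>prob_space M\<close> eps
            \<open>lebesgue_decomposition (restrict_space lborel {0<..<4}) (distr M param_space (\<epsilon> 1)) h \<sigma>\<close> _ _ \<open>c > 0\<close> _ that])
         (use ab J \<open>\<And>t. t \<in> J \<Longrightarrow> h t \<ge> ennreal c\<close> in auto)
  qed (fact eps ab \<open>c > 0\<close>)+
  obtain x0 where x0: "0 < x0" "x0 < 1" and tight: "tight_on {0<..<1} (cesaro state_space LP x0)"
    using \<open>\<exists>x\<in>{0<..<1}. tight_on {0<..<1} (cesaro state_space P x)\<close> by (auto simp: P_def)
  \<comment> \<open>The nonzero fixed point of the map with parameter \<open>u\<close>. Below it
    this map pushes upwards: \<open>u * (1 - \<kappa>) > 1\<close> whenever
    \<open>\<kappa> < w\<close>.\<close>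
  define w where "w = 1 - 1 / u"
  have w: "0 < w" "u * (1 - w) = 1" using ab by (simp_all add: w_def)
  define \<kappa> where "\<kappa> = min (1/5) (w / 2)"
  have \<kappa>: "0 < \<kappa>" "\<kappa> \<le> 1/5" "\<kappa> < w" using w(1) by (simp_all add: \<kappa>_def min_less_iff_disj)
  have "u * (1 - w) < u * (1 - \<kappa>)" using ab \<kappa>(3) by (intro mult_strict_left_mono) auto
  then have \<kappa>u: "1 < u * (1 - \<kappa>)" by (simp only: w(2))
  have "c * measure lborel ({u..} \<inter> {u<..<v}) \<le> prob {\<omega>\<in>space M. \<epsilon> 1 \<omega> \<in> {u..}}"
    by (rule dens) simp
  moreover have "{u..} \<inter> {u<..<v} = {u<..<v}" by auto
  moreover have "0 < c * (v - u)" using ab c by simp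
  ultimately have pos: "0 < prob {\<omega>\<in>space M. u \<le> \<epsilon> 1 \<omega>}" using ab by simp
  obtain \<phi> where \<phi>: "prob_space \<phi>" "sets \<phi> = sets state_space" and
    minor_compact: "\<forall>K. compact K \<longrightarrow> K \<subseteq> {0<..<1} \<longrightarrow> (\<exists>\<beta>>0. \<beta> \<le> 1 \<and>
      (\<forall>x\<in>K. \<exists>n. \<forall>B\<in>sets state_space. \<beta> * measure \<phi> B \<le> measure (nstep state_space LP n x) B))"
    by (rule minorization)
  have sub: "{\<kappa>..1-\<kappa>} \<subseteq> {0<..<1}" using \<kappa> by auto
  from minor_compact[THEN spec, THEN mp, THEN mp, OF compact_Icc sub] obtain \<beta> where \<beta>: "0 < \<beta>" "\<beta> \<le> 1"
    "\<forall>x\<in>{\<kappa>..1-\<kappa>}. \<exists>n. \<forall>B\<in>sets state_space. \<beta> * measure \<phi> B \<le> measure (nstep state_space LP n x) B"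
    by (elim exE conjE)
  interpret recurrent_kernel state_space LP \<phi> "{\<kappa>..1-\<kappa>}" \<beta>
  proof (intro recurrent_kernel.intro recurrent_kernel_axioms.intro markov_kernel_axioms \<phi> \<beta>(1,2))
    show "{\<kappa>..1-\<kappa>} \<in> sets state_space" using \<kappa> by (auto simp: sets_state_iff)
    show "\<exists>n. \<forall>B\<in>sets state_space. \<beta> * measure \<phi> B \<le> measure (nstep state_space LP n x) B"
      if "x \<in> {\<kappa>..1-\<kappa>}" for x using \<beta>(3) that by blast
    show "(\<lambda>n. esc {\<kappa>..1-\<kappa>} n x) \<longlonglongrightarrow> 0" if "x \<in> space state_space" for x
      using that esc_tendsto_0[OF \<kappa>(1,2) \<kappa>u pos x0 tight] by (simp add: space_state)
  qed
  \<comment> \<open>Minorization on a singleton: irreducibility concerns every state, not only those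
    in \<open>{\<kappa>..1-\<kappa>}\<close>.\<close>
  have irr: "\<exists>n. 0 < measure (nstep state_space LP n x) B"
    if x: "x \<in> space state_space" and B: "B \<in> sets state_space" "0 < measure \<phi> B" for x B
  proof -
    have sub: "{x} \<subseteq> {0<..<1}" using x by (simp add: space_state)
    from minor_compact[THEN spec, THEN mp, THEN mp, OF compact_sing sub] obtain \<beta>' where "0 < \<beta>'"
      "\<forall>y\<in>{x}. \<exists>n. \<forall>B\<in>sets state_space. \<beta>' * measure \<phi> B \<le> measure (nstep state_space LP n y) B"
      by (elim exE conjE)
    then obtain n where "\<beta>' * measure \<phi> B \<le> measure (nstep state_space LP n x) B" using B by blast
    moreover have "0 < \<beta>' * measure \<phi> B" using \<open>0 < \<beta>'\<close> B by simp
    ultimately show ?thesis by (intro exI[of _ n]) linarith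
  qed
  obtain \<pi> where \<pi>: "invariant_prob state_space LP \<pi>" using exists_invariant_prob[OF x0 tight] by blast
  have "Harris_recurrent state_space LP" by (rule Harris_recurrentI[OF \<pi> irr])
  moreover have "\<exists>!\<pi>. invariant_prob state_space LP \<pi>" using \<pi> invariant_prob_unique by blast
  moreover have "(\<lambda>N. tv_dist state_space (cesaro state_space LP x N) \<pi>) \<longlonglongrightarrow> 0"
    if "invariant_prob state_space LP \<pi>" "x \<in> {0<..<1}" for \<pi> x
    using that by (intro tv_dist_cesaro_tendsto) (simp_all add: space_state)
  ultimately show ?thesis unfolding P_def by blast
qed

end
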